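(* There is an integer $q>0$ such that there is an algorithm that, given as input two deterministic finite state automata $\gamma:\Gamma\to\Delta$ and $\lambda:\Lambda\to\Delta$ (over the same alphabet), decides whether $L(\Gamma)\cap L(\Lambda)\ne\emptyset$ in $O(m^q\cdot n)$ time, where $$m=(\beta_1(\Gamma)+|\partial\Gamma|)+(\beta_1(\Lambda)+|\partial\Lambda|),\qquad n=|E(\Gamma)|+|E(\Lambda)|.$$
   Context: A graph is a finite directed graph $\Gamma=(V,E,o,t)$ with origin and target maps $o,t:E\to V$ (loops and multiple edges allowed). A graph map commutes with $o,t$; it is a forwards immersion if, at every vertex $v$, it is injective on the set of edges with origin $v$. $\beta_1$ is the first Betti number of the underlying topological graph. $\partial\Gamma\subset V(\Gamma)$ is the set of vertices with indegree $0$ or outdegree $0$. Let $\Delta$ be a graph with a single vertex and one edge for each letter of a finite alphabet $\Sigma$. A finite state automaton over $\Sigma$ is a graph $\Gamma$ with one initial vertex, $V^i(\Gamma)=\{x\}$, a set $V^f(\Gamma)$ of final vertices, and a graph map $\gamma:\Gamma\to\Delta$ (equivalently, a labelling of the edges by $\Sigma$). It is deterministic if $\gamma$ is a forwards immersion. A path $g:I\to\Gamma$ (a graph map from a directed segment) is accepting if it starts at the initial vertex and ends at a final vertex, and $L(\Gamma)=\{\gamma\circ g\mid g \text{ an accepting path in }\Gamma\}$. Time is the number of elementary steps of a deterministic algorithm. *)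

theory Defs
  imports
    "Graph_Theory.Digraph"
    "Graph_Theory.Arc_Walk"
    "HOL-Library.Function_Algebras"
begin

section \<open>Graphs\<close>

text \<open>
  A finite directed graph with loops and multiple edges is a \<^locale>\<open>fin_digraph\<close>; the origin and
  target maps are \<^const>\<open>tail\<close> and \<^const>\<open>head\<close>.
\<close>

definition graph_map ::
    "('v, 'e) pre_digraph \<Rightarrow> ('w, 'f) pre_digraph \<Rightarrow> ('v \<Rightarrow> 'w) \<Rightarrow> ('e \<Rightarrow> 'f) \<Rightarrow> bool" where
  "graph_map G H f g \<longleftrightarrow>
     f ` verts G \<subseteq> verts H \<and> g ` arcs G \<subseteq> arcs H \<and>
     (\<forall>e\<in>arcs G. tail H (g e) = f (tail G e) \<and> head H (g e) = f (head G e))"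

definition forwards_immersion ::
    "('v, 'e) pre_digraph \<Rightarrow> ('w, 'f) pre_digraph \<Rightarrow> ('v \<Rightarrow> 'w) \<Rightarrow> ('e \<Rightarrow> 'f) \<Rightarrow> bool" where
  "forwards_immersion G H f g \<longleftrightarrow>
     graph_map G H f g \<and> (\<forall>v\<in>verts G. inj_on g (out_arcs G v))"

definition boundary :: "('v, 'e) pre_digraph \<Rightarrow> 'v set" where
  "boundary G = {v \<in> verts G. in_degree G v = 0 \<or> out_degree G v = 0}"

text \<open>
  The first Betti number is the dimension of the first rational homology of the graph as a
  one-dimensional cell complex. There are no 2-cells, so this homology is the kernel of the cellular
  boundary map from 1-chains to 0-chains, which sends an edge to its target minus its origin.
\<close>

definition chain_scale :: "rat \<Rightarrow> ('e \<Rightarrow> rat) \<Rightarrow> 'e \<Rightarrow> rat" where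
  "chain_scale r c = (\<lambda>e. r * c e)"

lemma vector_space_chain_scale: "vector_space chain_scale"
  by (rule vector_space.intro)
    (simp_all only: chain_scale_def fun_eq_iff plus_fun_def ring_distribs mult.assoc mult_1 simp_thms)

definition boundary_map :: "('v, 'e) pre_digraph \<Rightarrow> ('e \<Rightarrow> rat) \<Rightarrow> 'v \<Rightarrow> rat" where
  "boundary_map G c v = (\<Sum>e\<in>in_arcs G v. c e) - (\<Sum>e\<in>out_arcs G v. c e)"

definition cycle_space :: "('v, 'e) pre_digraph \<Rightarrow> ('e \<Rightarrow> rat) set" where
  "cycle_space G =
     {c. (\<forall>e. e \<notin> arcs G \<longrightarrow> c e = 0) \<and> (\<forall>v\<in>verts G. boundary_map G c v = 0)}"

definition betti1 :: "('v, 'e) pre_digraph \<Rightarrow> nat" where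
  "betti1 G = vector_space.dim chain_scale (cycle_space G)"


section \<open>Finite state automata\<close>

definition rose :: "'l set \<Rightarrow> (unit, 'l) pre_digraph" where
  "rose \<Sigma> = \<lparr>verts = UNIV, arcs = \<Sigma>, tail = (\<lambda>_. ()), head = (\<lambda>_. ())\<rparr>"

text \<open>
  The vertex map of a graph map to the rose is forced, so only its edge map \<open>letter\<close> is recorded.
\<close>

record ('v, 'e, 'l) fsa =
  graph_of :: "('v, 'e) pre_digraph"
  initial :: 'v
  finals :: "'v set"
  letter :: "'e \<Rightarrow> 'l"

definition is_fsa :: "'l set \<Rightarrow> ('v, 'e, 'l) fsa \<Rightarrow> bool" where
  "is_fsa \<Sigma> A \<longleftrightarrow>
     fin_digraph (graph_of A) \<and>
     initial A \<in> verts (graph_of A) \<and>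
     finals A \<subseteq> verts (graph_of A) \<and>
     graph_map (graph_of A) (rose \<Sigma>) (\<lambda>_. ()) (letter A)"

definition deterministic_fsa :: "'l set \<Rightarrow> ('v, 'e, 'l) fsa \<Rightarrow> bool" where
  "deterministic_fsa \<Sigma> A \<longleftrightarrow>
     is_fsa \<Sigma> A \<and> forwards_immersion (graph_of A) (rose \<Sigma>) (\<lambda>_. ()) (letter A)"

text \<open>
  A path (a graph map from a directed segment, possibly of length 0) is given by its list of edges,
  \<^const>\<open>pre_digraph.awalk\<close>; its image in the rose is then a list of letters.
\<close>

definition accepting_path :: "('v, 'e, 'l) fsa \<Rightarrow> 'e list \<Rightarrow> bool" where
  "accepting_path A p \<longleftrightarrow> (\<exists>v\<in>finals A. pre_digraph.awalk (graph_of A) (initial A) p v)"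

definition language :: "('v, 'e, 'l) fsa \<Rightarrow> 'l list set" where
  "language A = {map (letter A) p | p. accepting_path A p}"


section \<open>Algorithms and their running time\<close>

text \<open>
  Algorithms are programs for a random access machine with unit costs, in structured form. The
  memory consists of infinite arrays of natural numbers (a program mentions only finitely many of
  them, so they could be interleaved into one), the cells being addressed by computed
  indices. The elementary operations are constants, reading a cell, addition, truncated subtraction,
  comparison and writing a cell; each of them takes one step. There is no multiplication.
\<close>

type_synonym memory = "nat \<Rightarrow> nat \<Rightarrow> nat"

datatype expr =
    Const nat
  | Read nat expr
  | Plus expr expr
  | Minus expr expr

primrec expr_val :: "expr \<Rightarrow> memory \<Rightarrow> nat" where
  "expr_val (Const k) s = k"
| "expr_val (Read a x) s = s a (expr_val x s)"
| "expr_val (Plus x y) s = expr_val x s + expr_val y s"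
| "expr_val (Minus x y) s = expr_val x s - expr_val y s"

primrec expr_steps :: "expr \<Rightarrow> nat" where
  "expr_steps (Const k) = 1"
| "expr_steps (Read a x) = expr_steps x + 1"
| "expr_steps (Plus x y) = expr_steps x + expr_steps y + 1"
| "expr_steps (Minus x y) = expr_steps x + expr_steps y + 1"

text \<open>\<open>Write a x y\<close> stores the value of \<open>y\<close> in the cell of array \<open>a\<close> whose index is the value of \<open>x\<close>.\<close>

datatype program =
    Skip
  | Write nat expr expr
  | Seq program program
  | IfLess expr expr program program
  | WhileLess expr expr program

text \<open>\<open>run P s t s'\<close>: started with memory \<open>s\<close>, \<open>P\<close> halts after exactly \<open>t\<close> steps with memory \<open>s'\<close>.\<close>

inductive run :: "program \<Rightarrow> memory \<Rightarrow> nat \<Rightarrow> memory \<Rightarrow> bool" where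
  Skip: "run Skip s 1 s"
| Write: "run (Write a x y) s (expr_steps x + expr_steps y + 1)
            (s(a := (s a)(expr_val x s := expr_val y s)))"
| Seq: "run P s t s' \<Longrightarrow> run Q s' u s'' \<Longrightarrow> run (Seq P Q) s (t + u) s''"
| IfTrue: "expr_val x s < expr_val y s \<Longrightarrow> run P s t s' \<Longrightarrow>
     run (IfLess x y P Q) s (expr_steps x + expr_steps y + 1 + t) s'"
| IfFalse: "\<not> expr_val x s < expr_val y s \<Longrightarrow> run Q s t s' \<Longrightarrow>
     run (IfLess x y P Q) s (expr_steps x + expr_steps y + 1 + t) s'"
| WhileFalse: "\<not> expr_val x s < expr_val y s \<Longrightarrow>
     run (WhileLess x y P) s (expr_steps x + expr_steps y + 1) s"
| WhileTrue: "expr_val x s < expr_val y s \<Longrightarrow> run P s t s' \<Longrightarrow>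
     run (WhileLess x y P) s' u s'' \<Longrightarrow>
     run (WhileLess x y P) s (expr_steps x + expr_steps y + 1 + t + u) s''"

lemma run_deterministic:
  "run P s t s' \<Longrightarrow> run P s u s'' \<Longrightarrow> u = t \<and> s'' = s'"
proof (induction P s t s' arbitrary: u s'' rule: run.induct)
  case (Skip s)
  then show ?case by cases simp
next
  case (Write a x y s)
  then show ?case by cases simp
next
  case (Seq P s t s' Q v r)
  from Seq.prems show ?case
  proof cases
    case a: (Seq t1 s1 t2)
    have "t1 = t \<and> s1 = s'" by (rule Seq.IH(1)[OF a(2)])
    with a(3) have "t2 = v \<and> s'' = r" by (intro Seq.IH(2)) simp
    with a(1) \<open>t1 = t \<and> s1 = s'\<close> show ?thesis by simp
  qed
next
  case (IfTrue x s y P t s' Q)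
  from IfTrue.prems show ?case
  proof cases
    case a: (IfTrue v)
    with IfTrue.IH[OF a(3)] show ?thesis by simp
  next
    case IfFalse
    with IfTrue.hyps show ?thesis by simp
  qed
next
  case (IfFalse x s y Q t s' P)
  from IfFalse.prems show ?case
  proof cases
    case a: (IfFalse v)
    with IfFalse.IH[OF a(3)] show ?thesis by simp
  next
    case IfTrue
    with IfFalse.hyps show ?thesis by simp
  qed
next
  case (WhileFalse x s y P)
  from WhileFalse.prems show ?case
    by cases (use WhileFalse.hyps in simp_all)
next
  case (WhileTrue x s y P t s' v r)
  from WhileTrue.prems show ?case
  proof cases
    case a: WhileFalse
    with WhileTrue.hyps show ?thesis by simp
  next
    case a: (WhileTrue t1 s1 t2)
    have "t1 = t \<and> s1 = s'" by (rule WhileTrue.IH(1)[OF a(3)])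
    with a(4) have "t2 = v \<and> s'' = r" by (intro WhileTrue.IH(2)) simp
    with a(1) \<open>t1 = t \<and> s1 = s'\<close> show ?thesis by simp
  qed
qed

text \<open>
  To be given as input, the vertices and the edges of an automaton are numbered consecutively from
  0 and its letters are numbers. Its final vertices are given by their characteristic function.
\<close>

definition numbered :: "(nat, nat, nat) fsa \<Rightarrow> bool" where
  "numbered A \<longleftrightarrow>
     (\<exists>k. verts (graph_of A) = {..<k}) \<and> (\<exists>l. arcs (graph_of A) = {..<l})"

definition fsa_arrays :: "(nat, nat, nat) fsa \<Rightarrow> (nat \<Rightarrow> nat) list" where
  "fsa_arrays A = (let G = graph_of A in
     [\<lambda>i. if i = 0 then card (verts G) else 0,
      \<lambda>i. if i = 0 then card (arcs G) else 0,
      \<lambda>i. if i = 0 then initial A else 0,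
      \<lambda>i. if i \<in> finals A then 1 else 0,
      \<lambda>i. if i \<in> arcs G then tail G i else 0,
      \<lambda>i. if i \<in> arcs G then head G i else 0,
      \<lambda>i. if i \<in> arcs G then letter A i else 0])"

definition input_memory :: "(nat, nat, nat) fsa \<Rightarrow> (nat, nat, nat) fsa \<Rightarrow> memory" where
  "input_memory A B = (\<lambda>a i.
     let inp = fsa_arrays A @ fsa_arrays B in if a < length inp then (inp ! a) i else 0)"

text \<open>The answer, 1 for yes and 0 for no, is left in cell 0 of array 0.\<close>

definition answers_within :: "program \<Rightarrow> memory \<Rightarrow> bool \<Rightarrow> nat \<Rightarrow> bool" where
  "answers_within P s b T \<longleftrightarrow>
     (\<exists>t s'. run P s t s' \<and> t \<le> T \<and> s' 0 0 = (if b then 1 else 0))"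

end

theory Submission
  imports Defs "HOL-Library.List_Lexorder"
begin

text \<open>
  Call a vertex plain if it has exactly one incoming and one outgoing edge. The edges that leave the
  other vertices are \<open>O(m)\<close> in number, because \<open>|E| - |V|\<close> is less than the first Betti number, and
  they cut the two automata into segments along which a path is forced. A pair of vertices of the
  product automaton has at most one successor unless both components branch. So the reachable pairs
  lie on deterministic trajectories, which start at the initial pair or at one of the \<open>O(m\<^sup>2)\<close>
  successors of pairs where both components branch.

  A trajectory can visit more than \<open>O(m\<^sup>5 n)\<close> distinct pairs only if both of its components become
  periodic. By the pigeonhole principle it passes through the same two segments at many different
  but close offsets, and comparing two offsets shows that the common label word has a short period
  there. Take for \<open>U\<close> an unbordered rotation of the period word. If every one of these periodic runs
  came to an end, the first occurrence of \<open>U\<close> in the run would lie at a different place for each offset,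
  but there are only \<open>O(m)\<close> edges in either automaton at which such an occurrence can lie. So some run
  goes on, and both components follow it periodically, each visiting some edge exactly once per
  period.

  If the periods are \<open>z\<close> and \<open>z'\<close>, then by the Chinese remainder theorem the pairs visited from then
  on are those of the \<open>i\<close>-th vertex of the first cycle and the \<open>j\<close>-th vertex of the second one with
  \<open>i\<close> and \<open>j\<close> congruent modulo \<open>gcd z z'\<close>. Final and branching vertices among them are found in time
  \<open>O(z + z')\<close> by comparing residues, although the trajectory itself has length \<open>lcm z z'\<close>.
\<close>

section \<open>Long trajectories in a product of two graphs\<close>

text \<open>A trajectory can have quadratically many pairs in n, since two cycles of coprime lengths
  of order n are traversed jointly in a time equal to the product. A bound linear in n therefore has
  to recognize such a trajectory from a prefix. In the rectangle spanned by two segments, a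
  trajectory moves along diagonals, one for each offset. A diagonal has at most n points, so many
  times n distinct visits need many long diagonals. As there are only O(n) offsets, many of these
  lie within a small fraction of their lengths from each other, and so share most of their extent.
  The unbordered word acts as a clock: inside a run of period p its occurrences are multiples of p
  apart, so it tells the time modulo p and singles out one first place in the run. In B = c^5 n the
  rectangles account for c^2, the required number of close offsets for another c^2, and the fifth
  factor c, at least 2500, swallows the numerical constants. Vertices do not enter n; those without
  an outgoing edge lie in the boundary and are paid for by m.\<close>

text \<open>
  \<open>e k\<close> is the edge traversed at time \<open>k\<close>, \<open>W k\<close> its label, and a new segment starts whenever an
  edge of \<open>S\<close> is traversed.
\<close>

locale track =
  fixes e :: "nat \<Rightarrow> 'e" and S :: "'e set" and W :: "nat \<Rightarrow> 'l" and K :: nat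
  assumes e0: "e 0 \<in> S"
    and pred: "\<lbrakk>Suc i < K; Suc j < K; e (Suc i) = e (Suc j); e (Suc i) \<notin> S\<rbrakk> \<Longrightarrow> e i = e j"
    and forced: "\<lbrakk>Suc i < K; Suc j < K; e i = e j; e (Suc i) \<notin> S\<rbrakk> \<Longrightarrow> e (Suc j) = e (Suc i)"
    and det: "\<lbrakk>Suc i < K; Suc j < K; e i = e j; W (Suc i) = W (Suc j)\<rbrakk> \<Longrightarrow> e (Suc i) = e (Suc j)"
    and lab: "\<lbrakk>i < K; j < K; e i = e j\<rbrakk> \<Longrightarrow> W i = W j"
begin

text \<open>With \<open>seg\<close> below, these are coordinates of the current edge and not merely
  of the time: going back by \<open>pred\<close> gives \<open>edge_coord\<close>, going forward from
  the start of the segment by \<open>forced\<close> gives \<open>coord_edge\<close>.\<close>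

primrec pos :: "nat \<Rightarrow> nat" where
  "pos 0 = 0"
| "pos (Suc k) = (if e (Suc k) \<in> S then 0 else Suc (pos k))"

primrec seg :: "nat \<Rightarrow> 'e" where
  "seg 0 = e 0"
| "seg (Suc k) = (if e (Suc k) \<in> S then e (Suc k) else seg k)"

lemma pos_0_iff: "pos k = 0 \<longleftrightarrow> e k \<in> S"
  using e0 by (cases k) auto

lemma seg_start: "e k \<in> S \<Longrightarrow> seg k = e k"
  by (cases k) auto

lemma seg_in: "seg k \<in> S"
  using e0 by (induction k) auto

lemma edge_coord: "\<lbrakk>i < K; j < K; e i = e j\<rbrakk> \<Longrightarrow> pos i = pos j \<and> seg i = seg j"
proof (induction i arbitrary: j)
  case 0
  then have "e j \<in> S" using e0 by simp
  then show ?case using pos_0_iff[of j] seg_start[of j] "0.prems"(3) by simp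
next
  case (Suc i)
  show ?case
  proof (cases "e (Suc i) \<in> S")
    case True
    then have "e j \<in> S" using Suc.prems(3) by simp
    then show ?thesis using pos_0_iff[of j] seg_start[of j] True Suc.prems(3) by simp
  next
    case False
    then obtain j' where j: "j = Suc j'" using Suc.prems(3) e0 by (cases j) auto
    have lt: "i < K" "j' < K" using Suc.prems(1,2) unfolding j by simp_all
    have "e i = e j'"
      by (rule pred[OF Suc.prems(1) Suc.prems(2)[unfolded j] Suc.prems(3)[unfolded j] False])
    from Suc.IH[OF lt this] show ?thesis using Suc.prems(3) False j by simp
  qed
qed

lemma backward: "r \<le> pos i \<Longrightarrow> r \<le> i \<and> pos (i - r) = pos i - r \<and> seg (i - r) = seg i"
proof (induction i arbitrary: r)
  case (Suc i)
  then show ?case by (cases r) (auto split: if_splits)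
qed simp

lemma coord_edge: "\<lbrakk>i < K; j < K; seg i = seg j; pos i = pos j\<rbrakk> \<Longrightarrow> e i = e j"
proof (induction i arbitrary: j)
  case 0
  then have "e j \<in> S" using pos_0_iff[of j] by simp
  then show ?case using seg_start[of j] "0.prems"(3) by simp
next
  case (Suc i)
  show ?case
  proof (cases "e (Suc i) \<in> S")
    case True
    then have "e j \<in> S" using pos_0_iff[of j] Suc.prems(4) by simp
    then show ?thesis using seg_start[of j] Suc.prems(3) True by simp
  next
    case False
    then obtain j' where j: "j = Suc j'" using Suc.prems(4) by (cases j) auto
    have ns: "e (Suc j') \<notin> S" using pos_0_iff[of j] Suc.prems(4) False j by auto
    have eq: "seg i = seg j'" "pos i = pos j'"
      using Suc.prems(3,4) False ns unfolding j by simp_all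
    have lt: "i < K" "j' < K" using Suc.prems(1,2) unfolding j by simp_all
    have "e i = e j'" by (rule Suc.IH[OF lt eq])
    then show ?thesis using forced[OF Suc.prems(1) Suc.prems(2)[unfolded j] _ False] j by simp
  qed
qed

text \<open>The length of a segment is not part of the data. That the walk stays in it for
  \<open>d\<close> more steps is inferred from another visit, at time \<open>j\<close>, which is
  \<open>d\<close> steps further along the same segment; forcedness makes the two passages
  agree.\<close>

lemma forward:
  assumes "seg i = seg j" "pos j = pos i + d" "i + d < K" "j < K" "r \<le> d"
  shows "seg (i + r) = seg i \<and> pos (i + r) = pos i + r"
  using assms(5)
proof (induction r)
  case (Suc r)
  then have IH: "seg (i + r) = seg i" "pos (i + r) = pos i + r" by auto
  have b: "d - r \<le> pos j" "d - Suc r \<le> pos j" using assms(2) by linarith+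
  have b1: "d - r \<le> j" "pos (j - (d - r)) = pos i + r" "seg (j - (d - r)) = seg i"
    using backward[OF b(1)] assms(1,2) Suc.prems by simp_all
  have b2: "pos (j - (d - Suc r)) = pos i + Suc r" "seg (j - (d - Suc r)) = seg i"
    using backward[OF b(2)] assms(1,2) Suc.prems by simp_all
  have J: "j - (d - Suc r) = Suc (j - (d - r))" using Suc.prems b1(1) by linarith
  have lt: "Suc (j - (d - r)) < K" "Suc (i + r) < K" "j - (d - r) < K" "i + r < K"
    using J assms(3,4) Suc.prems by linarith+
  have "e (j - (d - r)) = e (i + r)"
    by (rule coord_edge[OF lt(3,4)]) (simp_all only: IH b1)
  moreover have "e (Suc (j - (d - r))) \<notin> S"
    unfolding J[symmetric] pos_0_iff[symmetric] b2 by simp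
  ultimately have "e (Suc (i + r)) = e (Suc (j - (d - r)))"
    using forced[OF lt(1,2)] by blast
  from edge_coord[OF lt(2,1) this] show ?case
    unfolding J[symmetric] b2 by (simp only: add_Suc_right)
qed simp

lemma coord_lab: "\<lbrakk>i < K; j < K; seg i = seg j; pos i = pos j\<rbrakk> \<Longrightarrow> W i = W j"
  by (rule lab[OF _ _ coord_edge])

text \<open>Going back along the current segment meets pairwise different edges, since their
  coordinates differ.\<close>

lemma pos_less:
  assumes "k < K" "finite (e ` {..<K})"
  shows "pos k < card (e ` {..<K})"
proof -
  have "inj_on (\<lambda>r. e (k - r)) {..pos k}"
  proof (rule inj_onI)
    fix r r' assume A: "r \<in> {..pos k}" "r' \<in> {..pos k}" "e (k - r) = e (k - r')"
    then have "pos (k - r) = pos (k - r')" using edge_coord[of "k - r" "k - r'"] assms by auto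
    then show "r = r'" using backward[of r k] backward[of r' k] A by auto
  qed
  then have "card {..pos k} = card ((\<lambda>r. e (k - r)) ` {..pos k})" by (simp add: card_image)
  also have "\<dots> \<le> card (e ` {..<K})" using assms by (intro card_mono) auto
  finally show ?thesis by simp
qed

lemma same_labels:
  assumes "e i = e j" "\<And>r. r \<le> m \<Longrightarrow> W (i + r) = W (j + r)" "i + m < K" "j + m < K"
  shows "e (i + m) = e (j + m)"
  using assms
proof (induction m)
  case (Suc m)
  then have "e (i + m) = e (j + m)" by auto
  moreover have "W (Suc (i + m)) = W (Suc (j + m))" using Suc.prems(2)[of "Suc m"] by simp
  ultimately show ?case using det[of "i + m" "j + m"] Suc.prems by auto
qed simp

end

section \<open>Unbordered words and their occurrences in periodic words\<close>

definition unbordered :: "(nat \<Rightarrow> 'l) \<Rightarrow> nat \<Rightarrow> bool" where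
  "unbordered U p \<longleftrightarrow> (\<forall>d. 0 < d \<longrightarrow> d < p \<longrightarrow> (\<exists>i<d. U i \<noteq> U (p - d + i)))"

text \<open>Shifting by \<open>p\<close> reduces to \<open>d < p\<close>; there the two occurrences
  of \<open>U\<close> overlap in \<open>p - d\<close> letters, which would be a border unless
  \<open>d = 0\<close>.\<close>

lemma unbordered_occurrence:
  assumes "unbordered U p" "0 < p"
    and "\<And>i. i < p \<Longrightarrow> V i = U i" "\<And>i. i < d \<Longrightarrow> V (i + p) = V i"
    and "\<And>i. i < p \<Longrightarrow> V (d + i) = U i"
  shows "p dvd d"
  using assms(3-)
proof (induction d arbitrary: V rule: less_induct)
  case (less d)
  show ?case
  proof (cases "d < p")
    case True
    show ?thesis
    proof (rule ccontr)
      assume "\<not> p dvd d"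
      then have "d \<noteq> 0" by (metis dvd_0_right)
      then have "0 < p - d" "p - d < p" using True by simp_all
      then obtain i where i: "i < p - d" "U i \<noteq> U (p - (p - d) + i)"
        using assms(1) unfolding unbordered_def by blast
      have "U i = V (d + i)" using less.prems(3)[of i] i by simp
      also have "\<dots> = U (d + i)" using less.prems(1)[of "d + i"] i by simp
      finally show False using i True by simp
    qed
  next
    case False
    have "p dvd d - p"
    proof (rule less.IH[where V = "\<lambda>i. V (i + p)"])
      show "d - p < d" using False assms(2) by auto
      show "V (i + p) = U i" if "i < p" for i using less.prems(1,2)[of i] that False by auto
      show "V (i + p + p) = V (i + p)" if "i < d - p" for i using less.prems(2)[of "i + p"] that by auto
      show "V (d - p + i + p) = U i" if "i < p" for i
        using less.prems(3)[of i] that False by (simp add: add.commute)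
    qed
    then show ?thesis using False by (metis dvd_minus_self nat_less_le not_le)
  qed
qed

definition has_period :: "(nat \<Rightarrow> 'l) \<Rightarrow> nat \<Rightarrow> nat \<Rightarrow> bool" where
  "has_period V N p \<longleftrightarrow> (\<forall>i. i + p < N \<longrightarrow> V (i + p) = V i)"

lemma has_period_mult:
  assumes "has_period V N p" "i + p * q < N"
  shows "V (i + p * q) = V i"
  using assms(2)
proof (induction q)
  case (Suc q)
  then have "V (i + p * q + p) = V (i + p * q)" using assms(1) unfolding has_period_def by simp
  with Suc show ?case by (simp add: algebra_simps)
qed simp

lemma has_period_cong:
  assumes "has_period V N p" "i < N" "j < N" "i mod p = j mod p"
  shows "V i = V j"
proof -
  have "V i = V (i mod p)"
    using has_period_mult[OF assms(1), of "i mod p" "i div p"] assms(2) by simp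
  moreover have "V j = V (j mod p)"
    using has_period_mult[OF assms(1), of "j mod p" "j div p"] assms(3) by simp
  ultimately show ?thesis using assms(4) by simp
qed

text \<open>The lexicographically least rotation of a primitive word has no border.\<close>

lemma unbordered_rotation:
  fixes V :: "nat \<Rightarrow> 'l::linorder"
  assumes per: "has_period V N p" "0 < p" "3 * p \<le> N"
    and least: "\<And>d. 0 < d \<Longrightarrow> d < p \<Longrightarrow> \<not> has_period V N d"
  obtains r where "r < p" "unbordered (\<lambda>i. V (r + i)) p"
proof -
  define rot where "rot r = map (\<lambda>i. V (r + i)) [0..<p]" for r
  have "\<exists>x\<in>rot ` {..<p}. \<forall>y\<in>rot ` {..<p}. x \<le> y"
    using per(2) by (intro bexI[of _ "Min (rot ` {..<p})"] ballI Min_le Min_in) auto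
  then obtain r where r: "r < p" "\<And>s. s < p \<Longrightarrow> rot r \<le> rot s" by auto
  have rot_mod: "rot s = rot (s mod p)" if "s < 2 * p" for s
    unfolding rot_def
  proof (rule map_cong)
    fix i assume "i \<in> set [0..<p]"
    then show "V (s + i) = V (s mod p + i)"
      using that per mod_less_divisor[OF per(2), of s]
      by (intro has_period_cong[OF per(1)]) (auto simp: mod_simps simp del: mod_less_divisor)
  qed simp
  have min: "rot r \<le> rot s" if "s < 2 * p" for s
    using rot_mod[OF that] r(2)[of "s mod p"] per(2) by simp
  have "unbordered (\<lambda>i. V (r + i)) p"
    unfolding unbordered_def
  proof (intro allI impI, rule ccontr)
    fix d assume d: "0 < d" "d < p" and "\<not> (\<exists>i<d. V (r + i) \<noteq> V (r + (p - d + i)))"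
    then have bd: "V (r + i) = V (r + (p - d + i))" if "i < d" for i using that by auto
    \<comment> \<open>A border \<open>A\<close> of the least rotation gives
      \<open>A @ Y = Z @ A\<close>. Comparing it with the rotations \<open>A @ Z\<close> and
      \<open>Y @ A\<close> yields \<open>Y \<le> Z\<close> and \<open>Z \<le> Y\<close>, so rotating
      by \<open>p - d\<close> changes nothing and \<open>p - d\<close> would be a shorter
      period.\<close>
    define A where "A = map (\<lambda>i. V (r + i)) [0..<d]"
    define Y where "Y = map (\<lambda>i. V (r + d + i)) [0..<p - d]"
    define Z where "Z = map (\<lambda>i. V (r + i)) [0..<p - d]"
    have X1: "rot r = A @ Y"
      unfolding rot_def A_def Y_def using d
      by (auto intro!: nth_equalityI simp: nth_append)
    have X2: "rot r = Z @ A"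
      unfolding rot_def A_def Z_def using d
      by (auto intro!: nth_equalityI simp: nth_append bd)
    have R1: "rot (r + (p - d)) = A @ Z"
      unfolding rot_def A_def Z_def
    proof (intro nth_equalityI)
      fix i assume "i < length (map (\<lambda>i. V (r + (p - d) + i)) [0..<p])"
      then have i: "i < p" by simp
      show "map (\<lambda>i. V (r + (p - d) + i)) [0..<p] ! i = (map (\<lambda>i. V (r + i)) [0..<d] @ map (\<lambda>i. V (r + i)) [0..<p - d]) ! i"
      proof (cases "i < d")
        case True
        then show ?thesis using i d bd[of i] by (simp add: nth_append add.assoc)
      next
        case False
        then have "V (r + (p - d) + i) = V (r + (i - d) + p)" using d by (intro arg_cong[of _ _ V]) auto
        also have "\<dots> = V (r + (i - d))" 
          by (rule per(1)[unfolded has_period_def, rule_format]) (use per i d r(1) False in simp)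
        finally show ?thesis using i d False by (simp add: nth_append)
      qed
    qed (use d in simp)
    have R2: "rot (r + d) = Y @ A"
      unfolding rot_def A_def Y_def
    proof (intro nth_equalityI)
      fix i assume "i < length (map (\<lambda>i. V (r + d + i)) [0..<p])"
      then have i: "i < p" by simp
      show "map (\<lambda>i. V (r + d + i)) [0..<p] ! i = (map (\<lambda>i. V (r + d + i)) [0..<p - d] @ map (\<lambda>i. V (r + i)) [0..<d]) ! i"
      proof (cases "i < p - d")
        case True
        then show ?thesis using i d by (simp add: nth_append)
      next
        case False
        then have "V (r + d + i) = V (r + (i - (p - d)) + p)" using d by (intro arg_cong[of _ _ V]) auto
        also have "\<dots> = V (r + (i - (p - d)))" 
          by (rule per(1)[unfolded has_period_def, rule_format]) (use per i d r(1) False in simp)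
        finally have "V (r + d + i) = V (r + (i - (p - d)))" .
        moreover have "i - (p - d) < d" using i d False by simp
        ultimately show ?thesis using i False by (simp add: nth_append del: upt_Suc)
      qed
    qed (use d in simp)
    have len: "length Y = length Z" by (simp add: Y_def Z_def)
    have "A @ Y \<le> A @ Z" using min[of "r + (p - d)"] X1 R1 r(1) d by simp
    then have YZ: "Y \<le> Z"
      by (auto simp: list_le_def list_less_def lexord_same_pref_iff)
    have "Z @ A \<le> Y @ A" using min[of "r + d"] X2 R2 r(1) d by simp
    then have "Z \<le> Y"
      using lexord_sufE[of Z A Y A "{(u, v). u < v}"] len by (auto simp: list_le_def list_less_def)
    with YZ have "Y = Z" by simp
    then have eq: "rot (r + (p - d)) = rot r" using X1 R1 by simp
    have eq': "V (r + (p - d) + i) = V (r + i)" if "i < p" for i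
      using arg_cong[OF eq, of "\<lambda>xs. xs ! i"] that by (simp add: rot_def)
    have "has_period V N (p - d)"
      unfolding has_period_def
    proof (intro allI impI)
      fix i assume i: "i + (p - d) < N"
      define j where "j = (i + (p - r)) mod p"
      have j: "j < p" using per(2) by (simp add: j_def)
      have mod: "(r + j) mod p = i mod p"
        unfolding j_def using r(1) by (simp add: mod_simps)
      have "V (i + (p - d)) = V (r + (p - d) + j)"
      proof (rule has_period_cong[OF per(1) i])
        show "r + (p - d) + j < N" using j r(1) per d by simp
        show "(i + (p - d)) mod p = (r + (p - d) + j) mod p"
          using mod_add_cong[OF mod refl, of "p - d"] by (simp add: ac_simps)
      qed
      also have "\<dots> = V (r + j)" using eq' j by simp
      also have "\<dots> = V i" using mod i j r(1) per by (intro has_period_cong[OF per(1)]) auto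
      finally show "V (i + (p - d)) = V i" .
    qed
    then show False using least[of "p - d"] d by simp
  qed
  with r(1) show ?thesis by (rule that)
qed

text \<open>
  The label word has period \<open>p\<close> on the interval \<open>{L j..<kap j + p}\<close>, which cannot be extended to the
  left, and \<open>lam j\<close> is the first place in it with a copy of the unbordered word \<open>U\<close> on either side.
  As \<open>U\<close> has no border, two such places in one segment are at distance at least \<open>p\<close>; as the
  interval ends just before them, their distance is less than \<open>3 * p\<close>.
\<close>

lemma (in track) few_run_starts:
  fixes J :: "'j set"
  assumes fin: "finite J" "finite S" and p: "0 < p"
    and L: "\<And>j. j \<in> J \<Longrightarrow> 0 < L j \<and> L j + p \<le> lam j \<and> lam j < L j + 2 * p \<and> lam j \<le> kap j \<and> kap j + p < K"
    and run: "\<And>j k. \<lbrakk>j \<in> J; L j \<le> k; k < kap j\<rbrakk> \<Longrightarrow> W (k + p) = W k"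
    and break: "\<And>j. j \<in> J \<Longrightarrow> W (L j - 1 + p) \<noteq> W (L j - 1)"
    and U: "\<And>j i. \<lbrakk>j \<in> J; i < p\<rbrakk> \<Longrightarrow> W (lam j + i) = U i \<and> W (lam j - p + i) = U i"
    and unb: "unbordered U p"
    and core: "\<And>j. j \<in> J \<Longrightarrow> seg (kap j) = g \<and> pos (kap j) \<le> M"
    and core_period: "\<And>j k k'. \<lbrakk>j \<in> J; k < K; k' < K; seg k = g; seg k' = g; pos k' = pos k + p;
        pos (kap j) \<le> pos k; pos k \<le> M\<rbrakk> \<Longrightarrow> W k' = W k"
  shows "card (e ` lam ` J) \<le> 3 * (card S + 1)"
proof -
  \<comment> \<open>Beyond position \<open>M\<close> the segment \<open>g\<close> is treated as a
    segment of its own, because near the core periodicity is known only up to \<open>M\<close> and a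
    break may follow. This is the extra 1 in \<open>card S + 1\<close>.\<close>
  define key where "key j = (if seg (lam j) = g \<and> M < pos (lam j) then None else Some (seg (lam j)))" for j
  have lamK: "lam j < K" if "j \<in> J" for j using L[OF that] by simp
  \<comment> \<open>Otherwise the copy of \<open>U\<close> beginning at \<open>lam j\<close> and the
    copy ending just before \<open>lam j'\<close> overlap in a border of \<open>U\<close>.\<close>
  have spacing: "pos (lam j) + p \<le> pos (lam j')"
    if j: "j \<in> J" "j' \<in> J" and s: "seg (lam j) = seg (lam j')" and lt: "pos (lam j) < pos (lam j')" for j j'
  proof (rule ccontr)
    assume "\<not> ?thesis"
    then obtain d where d: "pos (lam j') = pos (lam j) + d" "0 < d" "d < p"
      using lt by (metis less_imp_add_positive nat_add_left_cancel_less not_le)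
    from unb d obtain i where i: "i < d" "U i \<noteq> U (p - d + i)" unfolding unbordered_def by blast
    have F: "seg (lam j + i) = seg (lam j) \<and> pos (lam j + i) = pos (lam j) + i"
      using forward[OF s d(1), of i] L[OF j(1)] lamK[OF j(2)] d i by simp
    have dle: "d - i \<le> pos (lam j')" using d by simp
    note B = backward[OF dle]
    have lt2: "lam j + i < K" "lam j' - (d - i) < K" using L[OF j(1)] d i lamK[OF j(2)] by simp_all
    have "W (lam j + i) = W (lam j' - (d - i))"
      using coord_lab[OF lt2] F B s d i by simp
    moreover have "lam j' - (d - i) = lam j' - p + (p - d + i)"
    proof -
      have "p \<le> lam j'" using L[OF j(2)] by linarith
      with d(3) i(1) show ?thesis by linarith
    qed
    ultimately have "W (lam j + i) = W (lam j' - p + (p - d + i))" by (simp only:)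
    then show False using U[OF j(1), of i] U[OF j(2), of "p - d + i"] i d by simp
  qed
  \<comment> \<open>If \<open>lam j'\<close> were \<open>3 * p\<close> or more ahead, the break
    \<open>w\<close> left of run \<open>j'\<close> would lie after \<open>lam j\<close> on the same
    segment. Run \<open>j\<close> passes over the same edges: before \<open>kap j\<close> it is
    periodic there, and if \<open>kap j\<close> comes first, the segment is \<open>g\<close> and
    \<open>core_period\<close> takes over.\<close>
  have range: "pos (lam j') < pos (lam j) + 3 * p"
    if j: "j \<in> J" "j' \<in> J" and k: "key j = key j'" for j j'
  proof (rule ccontr)
    assume far: "\<not> ?thesis"
    have s: "seg (lam j) = seg (lam j')" using k by (auto simp: key_def split: if_splits)
    define w where "w = L j' - 1"
    have w: "w + p < lam j'" "lam j' \<le> w + 2 * p" "W (w + p) \<noteq> W w"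
      using L[OF j(2)] break[OF j(2)] by (auto simp: w_def)
    define t where "t = pos (lam j') - (lam j' - w) - pos (lam j)"
    have b: "lam j' - w \<le> pos (lam j')" "lam j' - (w + p) \<le> pos (lam j')" using w far by linarith+
    have e1: "lam j' - (lam j' - w) = w" "lam j' - (lam j' - (w + p)) = w + p" using w by simp_all
    have bw: "pos w = pos (lam j) + t" "seg w = seg (lam j)"
      using backward[OF b(1)] e1 s far w unfolding t_def by simp_all
    have bwp: "pos (w + p) = pos (lam j) + t + p" "seg (w + p) = seg (lam j)"
      using backward[OF b(2)] e1 s far w bw unfolding t_def by simp_all
    have ltK: "w + p < K" "w < K" using w lamK[OF j(2)] by simp_all
    show False
    proof (cases "lam j + t < kap j")
      case True
      have K1: "lam j + (t + p) < K" using True L[OF j(1)] by simp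
      have D: "pos (w + p) = pos (lam j) + (t + p)" "seg (lam j) = seg (w + p)" using bwp by simp_all
      have F1: "seg (lam j + t) = seg (lam j) \<and> pos (lam j + t) = pos (lam j) + t"
        by (rule forward[OF D(2,1) K1 ltK(1)]) simp
      have F2: "seg (lam j + (t + p)) = seg (lam j) \<and> pos (lam j + (t + p)) = pos (lam j) + (t + p)"
        by (rule forward[OF D(2,1) K1 ltK(1)]) simp
      have "W (lam j + t) = W w"
        using coord_lab[of "lam j + t" w] K1 ltK F1 bw by simp
      moreover have "W (lam j + (t + p)) = W (w + p)"
        using coord_lab[of "lam j + (t + p)" "w + p"] K1 ltK F2 bwp by simp
      moreover have "W (lam j + t + p) = W (lam j + t)"
        using run[OF j(1) _ True] L[OF j(1)] by simp
      ultimately show False using w(3) by (simp add: add.assoc)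
    next
      case False
      define r where "r = kap j - lam j"
      have r: "r \<le> t" "lam j + r = kap j" using False L[OF j(1)] by (auto simp: r_def)
      have D: "pos (kap j) = pos (lam j) + r \<and> seg (kap j) = seg (lam j)"
        using forward[of "lam j" w r r] bw r ltK L[OF j(1)] False
      proof -
        have "pos w = pos (lam j) + t" "seg (lam j) = seg w" using bw by simp_all
        have r': "r \<le> pos w" "t - r \<le> pos w" using bw r by simp_all
        have x: "seg (lam j) = seg (w - (t - r))" "pos (w - (t - r)) = pos (lam j) + r"
          using backward[OF r'(2)] bw r by simp_all
        have y: "lam j + r < K" "w - (t - r) < K" using r L[OF j(1)] ltK by simp_all
        show ?thesis using forward[OF x y order_refl] r by simp
      qed
      have g: "seg (lam j) = g" using D core[OF j(1)] by simp
      show False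
      proof (cases "M < pos (lam j)")
        case True
        then show False using D core[OF j(1)] by simp
      next
        case nM: False
        then have "pos (lam j') \<le> M" using k g s by (auto simp: key_def split: if_splits)
        then have "pos w \<le> M" using bwp w far bw by (simp add: t_def)
        then have "W (w + p) = W w"
          using core_period[OF j(1) ltK(2,1)] g bw bwp D r by simp
        then show False using w by simp
      qed
    qed
  qed
  define ms where "ms v = Min ((\<lambda>j. pos (lam j)) ` {j \<in> J. key j = v})" for v
  have ms: "ms (key j) \<le> pos (lam j) \<and> pos (lam j) < ms (key j) + 3 * p" if "j \<in> J" for j
  proof -
    have fi: "finite ((\<lambda>i. pos (lam i)) ` {i \<in> J. key i = key j})" using fin by simp
    have ne: "(\<lambda>i. pos (lam i)) ` {i \<in> J. key i = key j} \<noteq> {}" using that by auto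
    obtain i where i: "i \<in> J" "key i = key j" "ms (key j) = pos (lam i)"
      using Min_in[OF fi ne] unfolding ms_def by auto
    have "ms (key j) \<le> pos (lam j)" unfolding ms_def using fi that by (intro Min_le) auto
    with range[OF i(1) that i(2)] i(3) show ?thesis by simp
  qed
  \<comment> \<open>A class lies in a window of length \<open>3 * p\<close>. Cut into three buckets
    of width \<open>p\<close>, it has one place per bucket, as distinct places are at least
    \<open>p\<close> apart.\<close>
  define h where "h j = (key j, (pos (lam j) - ms (key j)) div p)" for j
  have hj: "h j \<in> insert None (Some ` S) \<times> {..<3}" if "j \<in> J" for j
    using ms[OF that] seg_in by (auto simp: h_def key_def div_less_iff_less_mult p)
  have same: "e (lam j) = e (lam j')" if j: "j \<in> J" "j' \<in> J" and hh: "h j = h j'" for j j'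
  proof -
    have k: "key j = key j'" and q: "(pos (lam j) - ms (key j)) div p = (pos (lam j') - ms (key j)) div p"
      using hh by (auto simp: h_def)
    have s: "seg (lam j) = seg (lam j')" using k by (auto simp: key_def split: if_splits)
    have close: False if "a + p \<le> b" "m \<le> a" "(a - m) div p = (b - m) div p" for a b m
    proof -
      have "(a - m) div p + 1 = (a - m + p) div p" using div_add_self2[of p "a - m"] p by linarith
      also have "\<dots> \<le> (b - m) div p" using that by (intro div_le_mono) simp
      finally show False using that by simp
    qed
    have "pos (lam j) = pos (lam j')"
    proof (rule ccontr)
      assume "pos (lam j) \<noteq> pos (lam j')"
      then consider "pos (lam j) < pos (lam j')" | "pos (lam j') < pos (lam j)" by linarith
      then show False
      proof cases
        case 1
        from close[OF spacing[OF j s 1], of "ms (key j)"] ms[OF j(1)] q show False by simp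
      next
        case 2
        from close[OF spacing[OF j(2,1) s[symmetric] 2], of "ms (key j)"] ms[OF j(2)] k q show False by simp
      qed
    qed
    with coord_edge[OF lamK[OF j(1)] lamK[OF j(2)] s] show ?thesis by simp
  qed
  define f where "f v = e (lam (SOME j. j \<in> J \<and> h j = v))" for v
  have "e (lam j) = f (h j)" if "j \<in> J" for j
  proof -
    have "(SOME i. i \<in> J \<and> h i = h j) \<in> J \<and> h (SOME i. i \<in> J \<and> h i = h j) = h j"
      by (rule someI[of _ j]) (use that in simp)
    then show ?thesis unfolding f_def using same that by metis
  qed
  then have "e ` lam ` J \<subseteq> f ` (insert None (Some ` S) \<times> {..<3})" using hj by force
  then have "card (e ` lam ` J) \<le> card (insert None (Some ` S) \<times> {..<3::nat})"
    using fin by (meson card_image_le card_mono finite_SigmaI finite_imageI finite_insert finite_lessThan le_trans)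
  also have "\<dots> = (card S + 1) * 3"
    using fin by (simp add: card_cartesian_product card_insert_if card_image)
  finally show ?thesis by simp
qed

section \<open>From a periodic label word to a periodic walk\<close>

lemma (in track) copy_labels:
  assumes "e k = e a" "seg (a + i) = seg a" "pos (a + i) = pos a + i" "a + i < K" "k + i < K"
  shows "W (k + i) = W (a + i)"
proof -
  have s: "pos k = pos a" "seg k = seg a" using edge_coord[of k a] assms by simp_all
  then have "seg (k + i) = seg k \<and> pos (k + i) = pos k + i"
    using forward[of k "a + i" i i] assms by simp
  then show ?thesis using coord_lab[of "k + i" "a + i"] assms s by simp
qed

text \<open>The edge visited once per period has to lie outside \<open>S\<close>. In the application
  its tail then has no other outgoing edge, so that the period can be read off the vertices, which
  are all that the program records.\<close>

definition once_periodic :: "(nat \<Rightarrow> 'e) \<Rightarrow> 'e set \<Rightarrow> nat \<Rightarrow> nat \<Rightarrow> nat \<Rightarrow> bool" where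
  "once_periodic e S p B K \<longleftrightarrow> (\<exists>z. 0 < z \<and> z \<le> B \<and> p dvd z \<and>
     (\<forall>k\<ge>B. k + z < K \<longrightarrow> e (k + z) = e k) \<and>
     (\<exists>k. B \<le> k \<and> k < B + z \<and> e k \<notin> S \<and> (\<forall>k'. k < k' \<longrightarrow> k' < k + z \<longrightarrow> e k' \<noteq> e k)))"

lemma (in track) once_periodicI:
  assumes p: "0 < p" and per: "\<And>k. \<lbrakk>a \<le> k; k + p < K\<rbrakk> \<Longrightarrow> W (k + p) = W k"
    and a: "e a \<notin> S" "a < a'" "e a' = e a" "a' \<le> B" and K: "3 * B \<le> K"
    and visits: "\<And>k. \<lbrakk>a \<le> k; k \<le> B; e k = e a\<rbrakk> \<Longrightarrow> p dvd k - a"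
  shows "once_periodic e S p B K"
proof -
  \<comment> \<open>The first return time to \<open>e a\<close>. It is a multiple of
    \<open>p\<close>, so the labels repeat after \<open>z\<close>, and by determinism the edges do
    too.\<close>
  define z where "z = (LEAST z. 0 < z \<and> e (a + z) = e a)"
  have ex: "0 < a' - a \<and> e (a + (a' - a)) = e a" using a by simp
  have z: "0 < z" "e (a + z) = e a" using LeastI[of "\<lambda>z. 0 < z \<and> e (a + z) = e a", OF ex] by (auto simp: z_def)
  have zle: "z \<le> a' - a" unfolding z_def using ex by (rule Least_le)
  have zmin: "\<not> (0 < i \<and> e (a + i) = e a)" if "i < z" for i
    using not_less_Least[of i "\<lambda>z. 0 < z \<and> e (a + z) = e a"] that by (simp add: z_def)
  have B: "a + z \<le> B" "a < B" using a zle by simp_all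
  have pz: "p dvd z" using visits[of "a + z"] z B by simp
  have perW: "has_period (\<lambda>i. W (a + i)) (K - a) p"
    unfolding has_period_def using per[of "a + i" for i] by (simp add: ac_simps less_diff_conv)
  have per_e: "has_period (\<lambda>i. e (a + i)) (K - a) z"
    unfolding has_period_def
  proof (intro allI impI)
    fix i assume i: "i + z < K - a"
    have "e (a + z + i) = e (a + i)"
    proof (rule same_labels[OF z(2)])
      fix r assume r: "r \<le> i"
      obtain q where q: "z = p * q" using pz by auto
      show "W (a + z + r) = W (a + r)"
        using has_period_mult[OF perW, of r q] i r q by (simp add: ac_simps)
    qed (use i in simp_all)
    then show "e (a + (i + z)) = e (a + i)" by (simp add: ac_simps)
  qed
  \<comment> \<open>A quotient rounded up: \<open>k\<close> is the first of the times
    \<open>a + z * i\<close> that is not before \<open>B\<close>.\<close>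
  define q where "q = (B - a + z - 1) div z"
  define k where "k = a + z * q"
  have "z * q \<le> B - a + z - 1" unfolding q_def by simp
  moreover have "B - a + z - 1 < z * q + z"
    unfolding q_def using z(1) by (metis add.commute dividend_less_times_div mult_Suc_right)
  ultimately have k: "B \<le> k" "k < B + z" using B z(1) unfolding k_def by linarith+
  have kK: "k < K - z" using k K B a z by linarith
  have ek: "e k = e a" using has_period_mult[OF per_e, of 0 q] kK by (simp add: k_def)
  have only: "e k' \<noteq> e k" if "k < k'" "k' < k + z" for k'
  proof
    assume "e k' = e k"
    moreover have "e (a + (k' - k + z * q)) = e (a + (k' - k))"
      using has_period_mult[OF per_e, of "k' - k" q] that kK by (simp add: k_def)
    moreover have "a + (k' - k + z * q) = k'" using that by (simp add: k_def)
    ultimately have "e (a + (k' - k)) = e a" using ek by simp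
    moreover have "k' - k < z" "0 < k' - k" using that by simp_all
    ultimately show False using zmin by blast
  qed
  have "e (i + z) = e i" if "B \<le> i" "i + z < K" for i
    using per_e[unfolded has_period_def, rule_format, of "i - a"] that B by (simp add: ac_simps)
  moreover have "z \<le> B" using B by simp
  ultimately show ?thesis
    unfolding once_periodic_def using z(1) pz k ek a(1) only by metis
qed

text \<open>\<open>unbranched\<close> says that \<open>W (Suc k)\<close> is the only letter that
  both components can read after the edges \<open>e k\<close> and \<open>f k\<close>. The witnesses
  \<open>i\<close> and \<open>j\<close> may be different times, since each component shows on its
  own that it can read a letter. The order on the labels is there to choose a least
  rotation.\<close>

locale two_tracks = x: track e S W K + y: track f S' W K
  for e :: "nat \<Rightarrow> 'e" and S and f :: "nat \<Rightarrow> 'f" and S' and W :: "nat \<Rightarrow> 'l::linorder" and K +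
  assumes unbranched: "\<lbrakk>Suc k < K; Suc i < K; Suc j < K; e i = e k; f j = f k; W (Suc i) = W (Suc j)\<rbrakk>
    \<Longrightarrow> W (Suc i) = W (Suc k)"

text \<open>
  For every offset \<open>\<delta> \<in> J\<close> the two tracks run, from time \<open>b \<delta>\<close> on, for \<open>N\<close> steps in step through the
  segments \<open>g\<close> and \<open>h\<close>, the second one \<open>\<delta>\<close> behind the first.
\<close>

locale cluster = two_tracks +
  fixes J :: "int set" and b :: "int \<Rightarrow> nat" and al N D B :: nat and g h
  assumes finJ: "finite J" and finS: "finite S" "finite S'"
    and D: "1 \<le> D" "12 * D \<le> N"
    and b: "\<delta> \<in> J \<Longrightarrow> b \<delta> + N + D \<le> B" and K: "3 * B \<le> K"
    and bx: "\<delta> \<in> J \<Longrightarrow> r < N \<Longrightarrow> x.seg (b \<delta> + r) = g \<and> x.pos (b \<delta> + r) = al + r"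
    and byy: "\<delta> \<in> J \<Longrightarrow> r < N \<Longrightarrow> y.seg (b \<delta> + r) = h \<and> int (y.pos (b \<delta> + r)) = int al + int r - \<delta>"
    and close: "\<delta> \<in> J \<Longrightarrow> \<delta>' \<in> J \<Longrightarrow> \<bar>\<delta> - \<delta>'\<bar> \<le> int D"
    and distinct: "inj_on (\<lambda>k. (e k, f k)) {..<B}"
    and large: "9 * (card S + 1) * (card S' + 1) + 1 < card J"
begin

text \<open>Runs beginning at a break are limited by \<open>few_run_starts\<close> in either track,
  which gives the factor 9 = 3 * 3, and at most one run begins at time 0. More offsets than that
  force two of them into a single run, and a run that crosses the rectangle at two offsets never
  ends.\<close>

lemma regime:
  "\<exists>p>0. (\<forall>k\<ge>B. k + p < K \<longrightarrow> W (k + p) = W k) \<and> once_periodic e S p B K \<and> once_periodic f S' p B K"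
proof -
  have bK: "b \<delta> + N \<le> B" "b \<delta> + N \<le> K" "B \<le> K" if "\<delta> \<in> J" for \<delta>
    using b[OF that] K by linarith+
  have "\<not> is_singleton J" "J \<noteq> {}" using large by (auto simp: is_singleton_altdef)
  then obtain \<delta>0 \<delta>1 where d01: "\<delta>0 \<in> J" "\<delta>1 \<in> J" "\<delta>0 < \<delta>1"
    by (metis equals0I is_singletonI' linorder_neqE)
  \<comment> \<open>Along \<open>g\<close> all offsets read the same word. Along \<open>h\<close> it
    is read shifted by the offset, so each difference of two offsets is a period of it.\<close>
  define \<sigma> where "\<sigma> r = W (b \<delta>0 + r)" for r
  have W\<sigma>: "W (b \<delta> + r) = \<sigma> r" if "\<delta> \<in> J" "r < N" for \<delta> r
    unfolding \<sigma>_def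
    by (rule x.coord_lab) (use bx[OF that] bx[OF d01(1) that(2)] bK(2)[OF that(1)] bK(2)[OF d01(1)] that in simp_all)
  have W\<sigma>y: "W k = \<sigma> r" if "\<delta> \<in> J" "r < N" "k < K" "y.seg k = h" "int (y.pos k) = int al + int r - \<delta>" for k \<delta> r
    unfolding W\<sigma>[OF that(1,2), symmetric]
    by (rule y.coord_lab) (use byy[OF that(1,2)] bK(2)[OF that(1)] that in simp_all)
  have period: "has_period \<sigma> N (nat (\<delta>' - \<delta>))" if d: "\<delta> \<in> J" "\<delta>' \<in> J" "\<delta> \<le> \<delta>'" for \<delta> \<delta>'
    unfolding has_period_def
  proof (intro allI impI)
    fix i assume i: "i + nat (\<delta>' - \<delta>) < N"
    have "W (b \<delta> + i) = \<sigma> (i + nat (\<delta>' - \<delta>))"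
      by (rule W\<sigma>y[OF d(2) i]) (use byy[OF d(1), of i] i d bK(2)[OF d(1)] in simp_all)
    then show "\<sigma> (i + nat (\<delta>' - \<delta>)) = \<sigma> i" using W\<sigma>[OF d(1), of i] i by simp
  qed
  define p where "p = (LEAST p. 0 < p \<and> has_period \<sigma> N p)"
  have ex: "0 < nat (\<delta>1 - \<delta>0) \<and> has_period \<sigma> N (nat (\<delta>1 - \<delta>0))"
    using period[OF d01(1,2)] d01 by simp
  have p: "0 < p" "has_period \<sigma> N p" using LeastI[of "\<lambda>p. 0 < p \<and> has_period \<sigma> N p", OF ex] by (auto simp: p_def)
  have "p \<le> nat (\<delta>1 - \<delta>0)" unfolding p_def using ex by (rule Least_le)
  then have pD: "p \<le> D" using close[OF d01(1,2)] by linarith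
  have pmin: "\<not> has_period \<sigma> N d" if "0 < d" "d < p" for d
    using not_less_Least[of d "\<lambda>p. 0 < p \<and> has_period \<sigma> N p"] that by (auto simp: p_def)
  have "3 * p \<le> N" using pD D by linarith
  from unbordered_rotation[OF p(2,1) this pmin]
  obtain r0 where r0: "r0 < p" "unbordered (\<lambda>i. \<sigma> (r0 + i)) p" by blast
  define U where "U i = \<sigma> (r0 + i)" for i
  \<comment> \<open>Congruent to \<open>r0\<close> modulo \<open>p\<close>, so a copy of
    \<open>U\<close> starts there. The \<open>4 * p\<close> leaves room for four periods before it
    in the core; by \<open>p \<le> D\<close> and \<open>12 * D \<le> N\<close> there is room for
    \<open>D + 2 * p\<close> letters after it.\<close>
  define m where "m = r0 + 4 * p"
  have unb: "unbordered U p" 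
  proof -
    have "U = (\<lambda>i. \<sigma> (r0 + i))" by (rule ext) (rule U_def)
    with r0(2) show ?thesis by (simp only:)
  qed
  have m: "4 * p \<le> m" "m < 5 * D" "m + D + p + p \<le> N" "m + D + p < N"
    using r0(1) pD D by (auto simp: m_def)
  have per: "\<sigma> (r + p) = \<sigma> r" if "r + p < N" for r using p(2) that by (simp add: has_period_def)
  have U: "\<sigma> (m + i) = U i" if "i < p" for i
    using has_period_mult[OF p(2), of "r0 + i" 4] m that by (simp add: m_def U_def algebra_simps)
  \<comment> \<open>\<open>\<delta>' - \<delta>\<close> is a period, so \<open>U\<close> recurs at
    that distance inside the core.\<close>
  have pd: "p dvd nat (\<delta>' - \<delta>)" if d: "\<delta> \<in> J" "\<delta>' \<in> J" "\<delta> \<le> \<delta>'" for \<delta> \<delta>'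
  proof (rule unbordered_occurrence[OF unb p(1), of "\<lambda>i. \<sigma> (m + i)"])
    have le: "nat (\<delta>' - \<delta>) \<le> D" using close[OF d(1,2)] by simp
    show "\<sigma> (m + i) = U i" if "i < p" for i using U that .
    show "\<sigma> (m + (i + p)) = \<sigma> (m + i)" if "i < nat (\<delta>' - \<delta>)" for i
      using per[of "m + i"] m le that by (simp add: add.assoc)
    show "\<sigma> (m + (nat (\<delta>' - \<delta>) + i)) = U i" if "i < p" for i
      using period[OF d, unfolded has_period_def, rule_format, of "m + i"] U[OF that] le m that
      by (simp add: ac_simps)
  qed
  define kap where "kap \<delta> = b \<delta> + m" for \<delta>
  define L where "L \<delta> = (LEAST l. \<forall>k. l \<le> k \<longrightarrow> k < kap \<delta> \<longrightarrow> W (k + p) = W k)" for \<delta>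
  have core: "W (k + p) = W k" if "\<delta> \<in> J" "b \<delta> \<le> k" "k + p < b \<delta> + N" for \<delta> k
    using W\<sigma>[OF that(1), of "k - b \<delta>"] W\<sigma>[OF that(1), of "k - b \<delta> + p"] per[of "k - b \<delta>"] that
    by simp
  have Lb: "L \<delta> \<le> b \<delta>" if "\<delta> \<in> J" for \<delta>
    unfolding L_def using core[OF that] m by (intro Least_le) (auto simp: kap_def)
  have run: "W (k + p) = W k" if "\<delta> \<in> J" "L \<delta> \<le> k" "k < kap \<delta>" for \<delta> k
  proof -
    have "\<forall>k. L \<delta> \<le> k \<longrightarrow> k < kap \<delta> \<longrightarrow> W (k + p) = W k"
      unfolding L_def by (rule LeastI[of _ "kap \<delta>"]) simp
    with that show ?thesis by simp
  qed
  have brk: "W (L \<delta> - 1 + p) \<noteq> W (L \<delta> - 1)" if "\<delta> \<in> J" "0 < L \<delta>" for \<delta>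
  proof
    assume eq: "W (L \<delta> - 1 + p) = W (L \<delta> - 1)"
    have "\<forall>k. L \<delta> - 1 \<le> k \<longrightarrow> k < kap \<delta> \<longrightarrow> W (k + p) = W k"
    proof (intro allI impI)
      fix k assume "L \<delta> - 1 \<le> k" "k < kap \<delta>"
      then show "W (k + p) = W k" using eq run[OF that(1), of k] by (cases "k = L \<delta> - 1") auto
    qed
    moreover have "\<not> (\<forall>k. L \<delta> - 1 \<le> k \<longrightarrow> k < kap \<delta> \<longrightarrow> W (k + p) = W k)"
      by (rule not_less_Least) (use that in \<open>simp add: L_def[symmetric]\<close>)
    ultimately show False by simp
  qed
  define q where "q \<delta> = (kap \<delta> - L \<delta>) div p" for \<delta>
  \<comment> \<open>Whole periods back from \<open>kap \<delta>\<close>, stopping one period short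
    so that a copy of \<open>U\<close> also fits on the left.\<close>
  define lam where "lam \<delta> = kap \<delta> - p * (q \<delta> - 1)" for \<delta>
  have lam: "L \<delta> + p \<le> lam \<delta> \<and> lam \<delta> < L \<delta> + 2 * p \<and> lam \<delta> + p * (q \<delta> - 1) = kap \<delta> \<and> lam \<delta> - p + p * q \<delta> = kap \<delta> \<and> 1 \<le> q \<delta>"
    if "\<delta> \<in> J" for \<delta>
  proof -
    have "4 * p \<le> kap \<delta> - L \<delta>" using Lb[OF that] m by (simp add: kap_def)
    then have q4: "4 \<le> q \<delta>" unfolding q_def using p(1) by (simp add: less_eq_div_iff_mult_less_eq)
    have q1: "p * q \<delta> \<le> kap \<delta> - L \<delta>" unfolding q_def by simp
    have q2: "kap \<delta> - L \<delta> < p * q \<delta> + p"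
      unfolding q_def using p(1) by (metis add.commute dividend_less_times_div mult_Suc_right)
    have e: "p * q \<delta> = p * (q \<delta> - 1) + p" using q4 by (cases "q \<delta>") auto
    have "L \<delta> \<le> kap \<delta>" using Lb[OF that] by (simp add: kap_def)
    moreover define X where "X = p * (q \<delta> - 1)"
    ultimately have "L \<delta> + p \<le> kap \<delta> - X" "kap \<delta> - X < L \<delta> + 2 * p" "kap \<delta> - X + X = kap \<delta>"
      "kap \<delta> - X - p + (X + p) = kap \<delta>"
      using q1 q2 unfolding e X_def[symmetric] by linarith+
    then show ?thesis unfolding lam_def e X_def[symmetric] using q4 by simp
  qed
  have lamk: "lam \<delta> \<le> kap \<delta>" if "\<delta> \<in> J" for \<delta> using lam[OF that] by linarith
  have Wlam: "W (lam \<delta> + i) = U i \<and> W (lam \<delta> - p + i) = U i" if d: "\<delta> \<in> J" and i: "i < p" for \<delta> i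
  proof -
    have hp: "has_period (\<lambda>i. W (lam \<delta> - p + i)) (p * q \<delta> + p) p"
      unfolding has_period_def using run[OF d, of "lam \<delta> - p + i" for i] lam[OF d] by (auto simp: add.assoc)
    have "W (lam \<delta> - p + (i + p * q \<delta>)) = W (lam \<delta> - p + i)"
      using has_period_mult[OF hp, of i "q \<delta>"] i by simp
    moreover have "lam \<delta> - p + (i + p * q \<delta>) = b \<delta> + (m + i)"
      using lam[OF d] unfolding kap_def by linarith
    moreover have "W (b \<delta> + (m + i)) = U i" using W\<sigma>[OF d, of "m + i"] U[OF i] m i by simp
    ultimately have A: "W (lam \<delta> - p + i) = U i" by simp
    have "W (lam \<delta> - p + (i + p)) = W (lam \<delta> - p + i)"
      using hp[unfolded has_period_def, rule_format, of i] i lam[OF d]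
      by (cases "q \<delta>") auto
    moreover have "lam \<delta> - p + (i + p) = lam \<delta> + i" using lam[OF d] by linarith
    ultimately show ?thesis using A by simp
  qed
  have kapB: "kap \<delta> + D + p < B" if "\<delta> \<in> J" for \<delta> using b[OF that] m by (simp add: kap_def)
  have BK: "B \<le> K" using K by simp
  \<comment> \<open>If \<open>lam\<close> were injective, then by \<open>distinct\<close> the runs
    that start at a break would have different pairs of edges at \<open>lam\<close>, while each
    component of such a pair takes few values.\<close>
  have not_inj: "\<not> inj_on lam J"
  proof
    assume inj: "inj_on lam J"
    define J1 where "J1 = {\<delta> \<in> J. 0 < L \<delta>}"
    \<comment> \<open>Two runs that start at time 0 have \<open>lam\<close> in the same window of
      length \<open>p\<close>, and the two places differ by a multiple of \<open>p\<close>.\<close>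
    have zero: "\<delta> = \<delta>'" if "\<delta> \<in> J" "\<delta>' \<in> J" "L \<delta> = 0" "L \<delta>' = 0" for \<delta> \<delta>'
    proof -
      have *: "lam \<delta> = lam \<delta>'" if d: "\<delta> \<in> J" "\<delta>' \<in> J" "L \<delta> = 0" "L \<delta>' = 0" "lam \<delta> \<le> lam \<delta>'" for \<delta> \<delta>'
      proof -
        have "p dvd lam \<delta>' - lam \<delta>"
        proof (rule unbordered_occurrence[OF unb p(1), of "\<lambda>i. W (lam \<delta> + i)"])
          show "W (lam \<delta> + i) = U i" if "i < p" for i using Wlam[OF d(1) that] by simp
          show "W (lam \<delta> + (i + p)) = W (lam \<delta> + i)" if "i < lam \<delta>' - lam \<delta>" for i
            using run[OF d(2), of "lam \<delta> + i"] that d lamk[OF d(2)] by (simp add: add.assoc)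
          show "W (lam \<delta> + (lam \<delta>' - lam \<delta> + i)) = U i" if "i < p" for i
            using Wlam[OF d(2) that] d by (simp add: add.assoc[symmetric])
        qed
        moreover have "lam \<delta>' - lam \<delta> < p" using lam[OF d(1)] lam[OF d(2)] d by linarith
        ultimately have "lam \<delta>' - lam \<delta> = 0" using nat_dvd_not_less by blast
        then show ?thesis using d by simp
      qed
      show ?thesis
      proof (rule inj_onD[OF inj])
        show "lam \<delta> = lam \<delta>'"
        proof (cases "lam \<delta> \<le> lam \<delta>'")
          case True
          from *[OF that True] show ?thesis .
        next
          case False
          then show ?thesis using *[OF that(2,1,4,3)] by simp
        qed
      qed (use that in simp_all)
    qed
    have "card (J - J1) \<le> 1"
      using zero finJ by (intro card_le_Suc0_iff_eq[THEN iffD2, unfolded One_nat_def[symmetric]]) (auto simp: J1_def)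
    moreover have "card J = card J1 + card (J - J1)"
      using finJ by (simp add: J1_def card_Diff_subset card_mono)
    ultimately have big: "card J \<le> card J1 + 1" by simp
    have f1: "finite J1" using finJ by (simp add: J1_def)
    have J1J: "\<delta> \<in> J" "0 < L \<delta>" if "\<delta> \<in> J1" for \<delta> using that by (auto simp: J1_def)
    have Lf: "0 < L \<delta> \<and> L \<delta> + p \<le> lam \<delta> \<and> lam \<delta> < L \<delta> + 2 * p \<and> lam \<delta> \<le> kap \<delta> \<and> kap \<delta> + p < K" if "\<delta> \<in> J1" for \<delta>
      using lam[OF J1J(1)[OF that]] lamk[OF J1J(1)[OF that]] J1J[OF that] kapB[OF J1J(1)[OF that]] BK by simp
    have run1: "W (k + p) = W k" if "\<delta> \<in> J1" "L \<delta> \<le> k" "k < kap \<delta>" for \<delta> k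
      using run J1J that by blast
    have brk1: "W (L \<delta> - 1 + p) \<noteq> W (L \<delta> - 1)" if "\<delta> \<in> J1" for \<delta>
      using brk J1J that by blast
    have Wlam1: "W (lam \<delta> + i) = U i \<and> W (lam \<delta> - p + i) = U i" if "\<delta> \<in> J1" "i < p" for \<delta> i
      using Wlam J1J that by blast
    have cx: "card (e ` lam ` J1) \<le> 3 * (card S + 1)"
    proof (rule x.few_run_starts[where L = L and kap = kap and U = U and g = g and M = "al + m", OF f1 finS(1) p(1) Lf run1 brk1 Wlam1 unb])
      show "x.seg (kap \<delta>) = g \<and> x.pos (kap \<delta>) \<le> al + m" if "\<delta> \<in> J1" for \<delta>
        using bx[OF J1J(1)[OF that], of m] m by (simp add: kap_def)
      fix \<delta> k k' assume A: "\<delta> \<in> J1" "k < K" "k' < K" "x.seg k = g" "x.seg k' = g"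
        "x.pos k' = x.pos k + p" "x.pos (kap \<delta>) \<le> x.pos k" "x.pos k \<le> al + m"
      note dJ = J1J(1)[OF A(1)]
      have mN: "m < N" "m + p < N" using m by simp_all
      have "x.pos k = al + m" using A bx[OF dJ mN(1)] by (simp add: kap_def)
      then have "W k = W (b \<delta> + m)" "W k' = W (b \<delta> + (m + p))"
        using x.coord_lab[of k "b \<delta> + m"] x.coord_lab[of k' "b \<delta> + (m + p)"]
          bx[OF dJ mN(1)] bx[OF dJ mN(2)] A bK(2)[OF dJ] mN by simp_all
      then show "W k' = W k" using core[OF dJ, of "b \<delta> + m"] mN by (simp add: add.assoc)
    qed
    \<comment> \<open>Along \<open>h\<close> the position of \<open>kap \<delta>\<close> depends on
      the offset, so the largest one is taken; the others are at most \<open>D\<close> below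
      it.\<close>
    define M where "M = Max ((\<lambda>\<delta>. y.pos (kap \<delta>)) ` J)"
    have M: "y.pos (kap \<delta>) \<le> M" if "\<delta> \<in> J" for \<delta> unfolding M_def using finJ that by (intro Max_ge) auto
    have "M \<in> (\<lambda>\<delta>. y.pos (kap \<delta>)) ` J" unfolding M_def using finJ d01 by (intro Max_in) auto
    then obtain \<delta>M where dM: "\<delta>M \<in> J" "M = y.pos (kap \<delta>M)" by auto
    have mN: "m < N" using m by simp
    have cy: "card (f ` lam ` J1) \<le> 3 * (card S' + 1)"
    proof (rule y.few_run_starts[where L = L and kap = kap and U = U and g = h and M = M, OF f1 finS(2) p(1) Lf run1 brk1 Wlam1 unb])
      show "y.seg (kap \<delta>) = h \<and> y.pos (kap \<delta>) \<le> M" if "\<delta> \<in> J1" for \<delta>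
        using byy[OF J1J(1)[OF that] mN] M J1J that by (simp add: kap_def)
      fix \<delta> k k' assume A: "\<delta> \<in> J1" "k < K" "k' < K" "y.seg k = h" "y.seg k' = h"
        "y.pos k' = y.pos k + p" "y.pos (kap \<delta>) \<le> y.pos k" "y.pos k \<le> M"
      note dJ = J1J(1)[OF A(1)]
      define r where "r = y.pos k - y.pos (kap \<delta>)"
      have "int M \<le> int (y.pos (kap \<delta>)) + int D"
        using byy[OF dJ mN] byy[OF dM(1) mN] close[OF dJ dM(1)] dM(2) by (simp add: kap_def)
      then have r: "r \<le> D" "y.pos k = y.pos (kap \<delta>) + r" using A by (auto simp: r_def)
      have rN: "m + r + p < N" "m + r < N" using m r by simp_all
      have "W k = \<sigma> (m + r)"
        by (rule W\<sigma>y[OF dJ rN(2)]) (use A r byy[OF dJ mN] in \<open>simp_all add: kap_def\<close>)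
      moreover have "W k' = \<sigma> (m + r + p)"
        by (rule W\<sigma>y[OF dJ rN(1)]) (use A r byy[OF dJ mN] in \<open>simp_all add: kap_def\<close>)
      ultimately show "W k' = W k" using per[OF rN(1)] by simp
    qed
    have "card J1 = card (lam ` J1)"
      using inj by (intro card_image[symmetric]) (auto simp: J1_def inj_on_def)
    also have "\<dots> = card ((\<lambda>k. (e k, f k)) ` lam ` J1)"
      using distinct lamk kapB J1J
      by (intro card_image[symmetric] inj_on_subset[OF distinct]) fastforce
    also have "\<dots> \<le> card ((e ` lam ` J1) \<times> (f ` lam ` J1))"
      using f1 by (intro card_mono) auto
    also have "\<dots> \<le> (3 * (card S + 1)) * (3 * (card S' + 1))"
      unfolding card_cartesian_product by (intro mult_le_mono cx cy)
    also have "\<dots> = 9 * (card S + 1) * (card S' + 1)" by (simp add: algebra_simps)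
    finally show False using big large by linarith
  qed
  then obtain \<delta> \<delta>' where dd: "\<delta> \<in> J" "\<delta>' \<in> J" "\<delta> \<noteq> \<delta>'" "lam \<delta> = lam \<delta>'" "kap \<delta> \<le> kap \<delta>'"
    unfolding inj_on_def by (metis linorder_linear)
  have mN: "m < N" using m by simp
  have "kap \<delta> \<noteq> kap \<delta>'"
  proof
    assume eq: "kap \<delta> = kap \<delta>'"
    have "int (y.pos (kap \<delta>)) = int al + int m - \<delta>" "int (y.pos (kap \<delta>')) = int al + int m - \<delta>'"
      using byy[OF dd(1) mN] byy[OF dd(2) mN] unfolding kap_def by blast+
    then show False using dd(3) unfolding eq by linarith
  qed
  then have lt: "kap \<delta> < kap \<delta>'" using dd by simp
  define d where "d = nat \<bar>\<delta> - \<delta>'\<bar>"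
  have dD: "d \<le> D" "0 < d" using close[OF dd(1,2)] dd(3) by (auto simp: d_def)
  have pdd: "p dvd d"
    using pd[OF dd(1,2)] pd[OF dd(2,1)] by (cases "\<delta> \<le> \<delta>'") (simp_all add: d_def abs_if)
  have pz: "p dvd kap \<delta>' - kap \<delta>"
  proof -
    have "kap \<delta>' - kap \<delta> = p * (q \<delta>' - 1) - p * (q \<delta> - 1)" using lam[OF dd(1)] lam[OF dd(2)] dd(4) by linarith
    then show ?thesis by (simp add: diff_mult_distrib2[symmetric])
  qed
  \<comment> \<open>At \<open>kap \<delta>\<close> and \<open>kap \<delta>'\<close> the edges of
    \<open>e\<close> agree, but those of \<open>f\<close> are \<open>d\<close> apart on
    \<open>h\<close>. The passage with the smaller position is advanced by \<open>d\<close>, so that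
    \<open>f a1 = f a2\<close>.\<close>
  define a1 where "a1 = (if \<delta>' < \<delta> then kap \<delta> + d else kap \<delta>)"
  define a2 where "a2 = (if \<delta>' < \<delta> then kap \<delta>' else kap \<delta>' + d)"
  \<comment> \<open>Otherwise \<open>kap \<delta>'\<close> would belong to the passage of
    \<open>\<delta>\<close> through \<open>g\<close>, at a position other than its own.\<close>
  have far: "kap \<delta> + d < kap \<delta>'"
  proof (rule ccontr)
    assume "\<not> ?thesis"
    then obtain r where r: "kap \<delta>' = b \<delta> + (m + r)" "0 < r" "r \<le> D"
      using lt dD by (metis kap_def add.assoc less_imp_add_positive nat_add_left_cancel_le not_less order.trans)
    then have "x.pos (kap \<delta>') = al + (m + r)" using bx[OF dd(1), of "m + r"] m by simp
    then show False using bx[OF dd(2) mN] r by (simp add: kap_def)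
  qed
  have a12: "kap \<delta> \<le> a1" "a1 < a2" "a2 \<le> kap \<delta>' + d" "p dvd a2 - a1"
  proof -
    show "p dvd a2 - a1"
    proof (cases "\<delta>' < \<delta>")
      case True
      then have "a2 - a1 = kap \<delta>' - kap \<delta> - d" by (simp add: a1_def a2_def)
      then show ?thesis using dvd_diff_nat[OF pz pdd] by (simp only:)
    next
      case False
      then have "a2 - a1 = kap \<delta>' - kap \<delta> + d" using lt by (simp add: a1_def a2_def)
      then show ?thesis using pz pdd by simp
    qed
  qed (use far lt in \<open>auto simp: a1_def a2_def\<close>)
  define s where "s = a1 - b \<delta>"
  have s: "a1 = b \<delta> + s" "m \<le> s" "s \<le> m + D" "s + p < N" "s < N"
    using dD m by (auto simp: s_def a1_def kap_def)
  have \<sigma>s: "\<sigma> (s + i) = U i" if "i < p" for i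
  proof (cases "\<delta>' < \<delta>")
    case True
    then have "s + i = m + i + d" by (simp add: s_def a1_def kap_def)
    moreover obtain t where t: "d = p * t" using pdd by auto
    moreover have "\<sigma> (m + i + p * t) = \<sigma> (m + i)"
      using m dD that t by (intro has_period_mult[OF p(2)]) simp
    ultimately show ?thesis using U[OF that] by (simp only:)
  next
    case False
    then show ?thesis using U[OF that] by (simp add: s_def a1_def kap_def)
  qed
  have ybnd: "kap \<delta>' + d + p < b \<delta>' + N" using m dD by (simp add: kap_def)
  have f12: "f a2 = f a1"
  proof (rule y.coord_edge)
    show "a2 < K" "a1 < K" using a12 ybnd bK(2)[OF dd(2)] by linarith+
    have "int (y.pos a1) = int al + int s - \<delta>" "y.seg a1 = h"
      using byy[OF dd(1) s(5)] s(1) by simp_all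
    moreover have "int (y.pos a2) = int al + int (a2 - b \<delta>') - \<delta>'" "y.seg a2 = h"
      using byy[OF dd(2), of "a2 - b \<delta>'"] a12 ybnd by (auto simp: a2_def kap_def)
    moreover have "int (a2 - b \<delta>') - \<delta>' = int s - \<delta>"
      by (auto simp: a2_def kap_def s_def a1_def d_def)
    ultimately show "y.seg a2 = y.seg a1" "y.pos a2 = y.pos a1" by simp_all
  qed
  have e12: "e (kap \<delta>') = e (kap \<delta>)"
    using x.coord_edge[of "kap \<delta>'" "kap \<delta>"] bx[OF dd(1) mN] bx[OF dd(2) mN] kapB[OF dd(1)] kapB[OF dd(2)] BK
    by (simp add: kap_def)
  \<comment> \<open>As long as the labels are periodic, \<open>e\<close> repeats after
    \<open>z\<close> and \<open>f\<close> after \<open>z'\<close>, both multiples of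
    \<open>p\<close>. So at time \<open>k + p\<close> both components can read the letter that
    continues the period, and by \<open>unbranched\<close> no other letter can be read
    jointly.\<close>
  have forever: "W (k + p) = W k" if "kap \<delta> \<le> k" "k + p < K" for k
    using that
  proof (induction k rule: less_induct)
    case (less k)
    show ?case
    proof (cases "k \<le> a2")
      case True
      show ?thesis
      proof (cases "k < kap \<delta>'")
        case True
        then show ?thesis using run[OF dd(2), of k] less.prems lam[OF dd(2)] dd(4) lamk[OF dd(1)] by simp
      next
        case False
        then show ?thesis using core[OF dd(2), of k] True a12 ybnd by (simp add: kap_def)
      qed
    next
      case False
      define E where "E = k + p"
      have hp: "has_period (\<lambda>i. W (kap \<delta> + i)) (E - kap \<delta>) p"
        unfolding has_period_def E_def using less.IH[of "kap \<delta> + i" for i] less.prems by (auto simp: add.assoc)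
      have eqW: "W u = W v" if u: "kap \<delta> \<le> u" "u \<le> v" "v < E" "p dvd v - u" for u v
      proof -
        obtain t where t: "v - u = p * t" using u(4) by auto
        have "W (kap \<delta> + (u - kap \<delta> + p * t)) = W (kap \<delta> + (u - kap \<delta>))"
          using has_period_mult[OF hp, of "u - kap \<delta>" t] u t by simp
        moreover have "kap \<delta> + (u - kap \<delta> + p * t) = v" "kap \<delta> + (u - kap \<delta>) = u" using u t by simp_all
        ultimately show ?thesis by simp
      qed
      define z where "z = kap \<delta>' - kap \<delta>"
      define z' where "z' = a2 - a1"
      have Es: "a2 + p < E" "E < K" using False less.prems by (auto simp: E_def)
      have k2: "kap \<delta>' \<le> a2" by (simp add: a2_def)
      have "e (kap \<delta> + (E - 1 - kap \<delta>')) = e (kap \<delta>' + (E - 1 - kap \<delta>'))"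
        using Es k2 lt pz
        by (intro x.same_labels[OF e12[symmetric]] eqW) (auto simp: add.commute)
      moreover have "kap \<delta> + (E - 1 - kap \<delta>') = E - 1 - z" "kap \<delta>' + (E - 1 - kap \<delta>') = E - 1"
        using Es k2 lt unfolding z_def by linarith+
      ultimately have ee: "e (E - 1 - z) = e (E - 1)" by (simp only:)
      have "f (a1 + (E - 1 - a2)) = f (a2 + (E - 1 - a2))"
        using Es a12
        by (intro y.same_labels[OF f12[symmetric]] eqW) auto
      moreover have "a1 + (E - 1 - a2) = E - 1 - z'" "a2 + (E - 1 - a2) = E - 1"
        using Es a12 unfolding z'_def by linarith+
      ultimately have ff: "f (E - 1 - z') = f (E - 1)" by (simp only:)
      have zz: "z + kap \<delta> \<le> kap \<delta>'" "0 < z" "z' + a1 \<le> a2" "0 < z'" using lt a12 by (auto simp: z_def z'_def)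
      have b1: "kap \<delta> \<le> E - z" "kap \<delta> \<le> E - z'" "Suc (E - 1 - z) = E - z" "Suc (E - 1 - z') = E - z'" "Suc (E - 1) = E"
        "E - z < E" "E - z' < E" "kap \<delta> \<le> E - p" "E - p < E"
        using zz Es k2 a12 p(1) less.prems(1) by (auto simp: E_def)
      have pzz: "p dvd z" "p dvd z'" using pz a12 by (auto simp: z_def z'_def)
      have any: "W u = W v" if u: "kap \<delta> \<le> u" "kap \<delta> \<le> v" "u < E" "v < E" "p dvd E - u" "p dvd E - v" for u v
      proof -
        have c: "W u = W v" if "kap \<delta> \<le> u" "u \<le> v" "v < E" "p dvd E - u" "p dvd E - v" for u v
        proof (rule eqW[OF that(1-3)])
          have "v - u = (E - u) - (E - v)" using that by linarith
          then show "p dvd v - u" using dvd_diff_nat[OF that(4,5)] by (simp only:)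
        qed
        show ?thesis
        proof (cases "u \<le> v")
          case True
          from c[OF u(1) True u(4-6)] show ?thesis .
        next
          case False
          then have "v \<le> u" by simp
          from c[OF u(2) this u(3,6,5)] show ?thesis by (rule sym)
        qed
      qed
      have dv: "p dvd E - (E - z)" "p dvd E - (E - z')" "p dvd E - (E - p)"
        using pzz b1 Es zz k2 a12 by (auto simp: diff_diff_cancel E_def)
      have "W (Suc (E - 1 - z)) = W (Suc (E - 1))"
      proof (rule unbranched[OF _ _ _ ee ff])
        show "W (Suc (E - 1 - z)) = W (Suc (E - 1 - z'))"
          unfolding b1 by (rule any) (use b1 dv in auto)
      qed (use b1 Es in auto)
      moreover have "W (E - z) = W (E - p)" by (rule any) (use b1 dv in auto)
      moreover have "E - p = k" by (simp add: E_def)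
      ultimately show ?thesis unfolding b1 by (simp add: E_def)
    qed
  qed
  \<comment> \<open>The clock: every visit to the chosen edge is followed by \<open>U\<close>, so
    return times are multiples of \<open>p\<close>.\<close>
  have visit: "p dvd k - a" if a: "kap \<delta> \<le> a" "a \<le> k" "k \<le> B" "\<And>i. i < p \<Longrightarrow> W (a + i) = U i"
    "\<And>i. i < p \<Longrightarrow> W (k + i) = U i" for k a
  proof (rule unbordered_occurrence[OF unb p(1), of "\<lambda>i. W (a + i)"])
    show "W (a + (i + p)) = W (a + i)" if "i < k - a" for i
      using forever[of "a + i"] a that K kapB[OF dd(1)] by (simp add: add.assoc)
    show "W (a + (k - a + i)) = U i" if "i < p" for i using a that by (simp add: add.assoc[symmetric])
  qed (use a in auto)
  have WU: "W (kap \<delta> + i) = U i" if "i < p" for i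
    using W\<sigma>[OF dd(1), of "m + i"] U[OF that] m that by (simp add: kap_def add.assoc)
  have WUs: "W (a1 + i) = U i" if "i < p" for i
    using W\<sigma>[OF dd(1), of "s + i"] \<sigma>s[OF that] s that by (simp add: add.assoc)
  have B2: "B + p < K" using kapB[OF dd(1)] K by simp
  have ox: "once_periodic e S p B K"
  proof (rule x.once_periodicI[OF p(1) forever _ lt e12 _ K])
    show "e (kap \<delta>) \<notin> S" using bx[OF dd(1) mN] m p(1) by (simp add: kap_def x.pos_0_iff[symmetric])
    show "kap \<delta>' \<le> B" using kapB[OF dd(2)] by simp
    fix k assume k: "kap \<delta> \<le> k" "k \<le> B" "e k = e (kap \<delta>)"
    show "p dvd k - kap \<delta>"
    proof (rule visit[OF order_refl k(1,2) WU])
      fix i assume i: "i < p"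
      have "W (k + i) = W (kap \<delta> + i)"
        using bx[OF dd(1), of "m + i"] bx[OF dd(1) mN] m i B2 k bK(2)[OF dd(1)]
        by (intro x.copy_labels) (auto simp: kap_def add.assoc)
      then show "W (k + i) = U i" using WU[OF i] by simp
    qed
  qed
  have oy: "once_periodic f S' p B K"
  proof (rule y.once_periodicI[OF p(1) _ _ a12(2) f12 _ K])
    show "W (k + p) = W k" if "a1 \<le> k" "k + p < K" for k using forever[of k] that a12 by simp
    have "int (y.pos a1) = int al + int s - \<delta>" using byy[OF dd(1) s(5)] s by simp
    moreover have "0 \<le> int al - \<delta>" using byy[OF dd(1), of 0] m by simp
    ultimately have "0 < y.pos a1" using s m p(1) by linarith
    then show "f a1 \<notin> S'" by (simp add: y.pos_0_iff[symmetric])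
    show "a2 \<le> B" using kapB[OF dd(2)] a12 dD by simp
    fix k assume k: "a1 \<le> k" "k \<le> B" "f k = f a1"
    show "p dvd k - a1"
    proof (rule visit[OF a12(1) k(1,2) WUs])
      fix i assume i: "i < p"
      have "y.pos (b \<delta> + (s + i)) = y.pos (b \<delta> + s) + i \<and> y.seg (b \<delta> + (s + i)) = y.seg (b \<delta> + s)"
        using byy[OF dd(1), of "s + i"] byy[OF dd(1) s(5)] s i by auto
      then have "W (k + i) = W (a1 + i)"
        using s i B2 k bK(2)[OF dd(1)]
        by (intro y.copy_labels) (auto simp: add.assoc)
      then show "W (k + i) = U i" using WUs[OF i] by simp
    qed
  qed
  have "W (k + p) = W k" if "B \<le> k" "k + p < K" for k
    using forever[of k] that kapB[OF dd(1)] by simp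
  with ox oy p(1) show ?thesis by blast
qed

end

text \<open>Each offset owns an interval to its right whose length is about a fraction
  1/\<open>M\<close> of its diagonal; all of them lie in a set of \<open>3 * n\<close> integers. By
  double counting, some integer lies in more than \<open>R\<close> intervals, and the owners of
  these are close to each other.\<close>

lemma cluster_offsets:
  fixes \<Delta> :: "int set" and len :: "int \<Rightarrow> nat"
  assumes \<Delta>: "\<Delta> \<subseteq> {- int n<..<int n}" and len: "\<And>\<delta>. \<delta> \<in> \<Delta> \<Longrightarrow> len \<delta> \<le> n"
    and M: "0 < M" and large: "M * (R * (3 * n)) < (\<Sum>\<delta>\<in>\<Delta>. len \<delta>)"
  obtains J \<delta>0 where "J \<subseteq> \<Delta>" "R < card J" "\<delta>0 \<in> J" "\<And>\<delta>. \<delta> \<in> J \<Longrightarrow> len \<delta> \<le> len \<delta>0"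
    "\<And>\<delta> \<delta>'. \<delta> \<in> J \<Longrightarrow> \<delta>' \<in> J \<Longrightarrow> \<bar>\<delta> - \<delta>'\<bar> \<le> int (len \<delta>0 div M)"
proof -
  have fin: "finite \<Delta>" using \<Delta> by (rule finite_subset) simp
  define h where "h \<delta> = len \<delta> div M + 1" for \<delta>
  define Z where "Z = {- int n..<2 * int n}"
  have h: "len \<delta> \<le> M * h \<delta>" for \<delta>
    using M by (simp add: h_def) (metis add.commute dividend_less_times_div less_or_eq_imp_le)
  have hn: "h \<delta> \<le> n + 1" if "\<delta> \<in> \<Delta>" for \<delta>
    using order.trans[OF div_le_dividend len[OF that]] by (simp add: h_def)
  have "\<exists>z\<in>Z. R < card {\<delta> \<in> \<Delta>. \<delta> \<le> z \<and> z < \<delta> + int (h \<delta>)}"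
  proof (rule ccontr)
    assume "\<not> ?thesis"
    then have le: "card {\<delta> \<in> \<Delta>. \<delta> \<le> z \<and> z < \<delta> + int (h \<delta>)} \<le> R" if "z \<in> Z" for z using that by force
    have "(\<Sum>\<delta>\<in>\<Delta>. h \<delta>) = (\<Sum>\<delta>\<in>\<Delta>. card {z \<in> Z. \<delta> \<le> z \<and> z < \<delta> + int (h \<delta>)})"
    proof (rule sum.cong[OF refl])
      fix \<delta> assume d: "\<delta> \<in> \<Delta>"
      have "{z \<in> Z. \<delta> \<le> z \<and> z < \<delta> + int (h \<delta>)} = {\<delta>..<\<delta> + int (h \<delta>)}"
        using \<Delta> d hn[OF d] by (fastforce simp: Z_def)
      then show "h \<delta> = card {z \<in> Z. \<delta> \<le> z \<and> z < \<delta> + int (h \<delta>)}" by simp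
    qed
    also have "\<dots> = (\<Sum>\<delta>\<in>\<Delta>. \<Sum>z\<in>Z. if \<delta> \<le> z \<and> z < \<delta> + int (h \<delta>) then 1 else 0)"
      by (simp add: Z_def sum.If_cases Int_def)
    also have "\<dots> = (\<Sum>z\<in>Z. \<Sum>\<delta>\<in>\<Delta>. if \<delta> \<le> z \<and> z < \<delta> + int (h \<delta>) then 1 else 0)"
      by (rule sum.swap)
    also have "\<dots> = (\<Sum>z\<in>Z. card {\<delta> \<in> \<Delta>. \<delta> \<le> z \<and> z < \<delta> + int (h \<delta>)})"
      using fin by (simp add: sum.If_cases Int_def)
    also have "\<dots> \<le> of_nat (card Z) * R" using le by (intro sum_bounded_above) simp
    also have "\<dots> = R * (3 * n)"
    proof -
      have "card Z = 3 * n" unfolding Z_def card_atLeastLessThan_int by linarith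
      then show ?thesis by simp
    qed
    finally have "(\<Sum>\<delta>\<in>\<Delta>. h \<delta>) \<le> R * (3 * n)" .
    moreover have "(\<Sum>\<delta>\<in>\<Delta>. len \<delta>) \<le> M * (\<Sum>\<delta>\<in>\<Delta>. h \<delta>)"
      using h by (simp add: sum_distrib_left sum_mono)
    ultimately have "(\<Sum>\<delta>\<in>\<Delta>. len \<delta>) \<le> M * (R * (3 * n))" using mult_le_mono2 order.trans by blast
    with large show False by simp
  qed
  then obtain z where z: "R < card {\<delta> \<in> \<Delta>. \<delta> \<le> z \<and> z < \<delta> + int (h \<delta>)}" by blast
  define J where "J = {\<delta> \<in> \<Delta>. \<delta> \<le> z \<and> z < \<delta> + int (h \<delta>)}"
  have zJ: "R < card J" using z by (simp only: J_def)
  then have J: "finite J" "J \<noteq> {}" using fin by (auto simp: J_def[symmetric] intro: card_ge_0_finite)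
  have "Max (len ` J) \<in> len ` J" using J by (intro Max_in) auto
  then obtain \<delta>0 where d0: "\<delta>0 \<in> J" "len \<delta>0 = Max (len ` J)" by auto
  have mx: "len \<delta> \<le> len \<delta>0" if "\<delta> \<in> J" for \<delta> unfolding d0(2) using J that by (intro Max_ge) auto
  have close: "\<bar>\<delta> - \<delta>'\<bar> \<le> int (len \<delta>0 div M)" if "\<delta> \<in> J" "\<delta>' \<in> J" for \<delta> \<delta>'
    using that div_le_mono[OF mx[OF that(1)], of M] div_le_mono[OF mx[OF that(2)], of M]
    by (auto simp: J_def h_def)
  show ?thesis
  proof (rule that[of J \<delta>0])
    show "J \<subseteq> \<Delta>" by (auto simp: J_def)
    show "R < card J" by (fact zJ)
  qed (fact d0(1) mx close)+
qed

context two_tracks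
begin

definition offset :: "nat \<Rightarrow> int" where "offset k = int (x.pos k) - int (y.pos k)"

text \<open>A visit extends in both directions along its diagonal: backwards inside the two
  segments, forwards as far as the visits \<open>i1\<close> and \<open>j1\<close> witness that the
  segments reach.\<close>

lemma diagonal:
  assumes k: "k < K" "i1 < K" "x.seg i1 = x.seg k" "i \<le> x.pos i1"
    and j: "j1 < K" "y.seg j1 = y.seg k" "int i - offset k \<le> int (y.pos j1)" "0 \<le> int i - offset k"
    and K: "int k + int i < int K"
  obtains t where "t < K" "int t = int k + int i - int (x.pos k)"
    "x.seg t = x.seg k" "x.pos t = i" "y.seg t = y.seg k" "int (y.pos t) = int i - offset k"
proof (cases "i \<le> x.pos k")
  case True
  define d where "d = x.pos k - i"
  have d: "d \<le> x.pos k" "d \<le> y.pos k" using True j by (auto simp: d_def offset_def)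
  show ?thesis
  proof (rule that[of "k - d"])
    show "k - d < K" "x.seg (k - d) = x.seg k" "y.seg (k - d) = y.seg k"
      using k x.backward[OF d(1)] y.backward[OF d(2)] by simp_all
    show "int (k - d) = int k + int i - int (x.pos k)" "x.pos (k - d) = i"
      using x.backward[OF d(1)] True unfolding d_def by linarith+
    have "y.pos (k - d) = y.pos k - d" using y.backward[OF d(2)] by simp
    then show "int (y.pos (k - d)) = int i - offset k"
      using d True unfolding offset_def d_def by linarith
  qed
next
  case False
  define d where "d = i - x.pos k"
  define i2 where "i2 = i1 - (x.pos i1 - i)"
  define j2 where "j2 = j1 - (y.pos j1 - (y.pos k + d))"
  have dy: "y.pos k + d \<le> y.pos j1" using j False by (simp add: d_def offset_def)
  have i2: "x.seg i2 = x.seg k" "x.pos i2 = x.pos k + d" "i2 < K"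
    using x.backward[of "x.pos i1 - i" i1] k False by (simp_all add: i2_def d_def)
  have j2: "y.seg j2 = y.seg k" "y.pos j2 = y.pos k + d" "j2 < K"
    using y.backward[of "y.pos j1 - (y.pos k + d)" j1] j dy by (simp_all add: j2_def)
  have kd: "k + d < K" using K by (simp add: d_def)
  have "x.seg (k + d) = x.seg k \<and> x.pos (k + d) = x.pos k + d"
    using x.forward[OF i2(1)[symmetric] i2(2) kd i2(3)] by simp
  moreover have "y.seg (k + d) = y.seg k \<and> y.pos (k + d) = y.pos k + d"
    using y.forward[OF j2(1)[symmetric] j2(2) kd j2(3)] by simp
  ultimately have co: "x.seg (k + d) = x.seg k" "x.pos (k + d) = x.pos k + d"
    "y.seg (k + d) = y.seg k" "y.pos (k + d) = y.pos k + d" by simp_all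
  have id: "x.pos k + d = i" using False by (simp add: d_def)
  show ?thesis
    by (rule that[of "k + d", OF kd _ co(1) _ co(3)]) (use co id in \<open>simp_all add: offset_def\<close>)
qed

text \<open>At most \<open>c * c\<close> rectangles share the visits, so one of them gets more than
  \<open>60 * R * n\<close>, where \<open>R = 9 * (c + 1) * (c + 1) + 1\<close> is the size required
  of a cluster. The 60 is 20 * 3: the 3 comes from the \<open>3 * n\<close> integers of
  \<open>cluster_offsets\<close>, and the 20 keeps offsets within a twentieth of the longest
  diagonal of the cluster.\<close>

lemma long_trajectory:
  assumes fin: "finite S" "finite S'" and c: "card S \<le> c" "card S' \<le> c"
    and n: "\<And>k. k < K \<Longrightarrow> x.pos k < n" "\<And>k. k < K \<Longrightarrow> y.pos k < n"
    and B: "c * c * (60 * (9 * (c + 1) * (c + 1) + 1) * n) + 4 * n + 1 \<le> B" and K: "3 * B \<le> K"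
    and distinct: "inj_on (\<lambda>k. (e k, f k)) {..<B}"
  shows "\<exists>p>0. (\<forall>k\<ge>B. k + p < K \<longrightarrow> W (k + p) = W k) \<and> once_periodic e S p B K \<and> once_periodic f S' p B K"
proof -
  define R where "R = 9 * (c + 1) * (c + 1) + 1"
  define K0 where "K0 = c * c * (60 * R * n) + 1"
  have BK0: "K0 + 4 * n \<le> B" using B by (simp add: K0_def R_def)
  have K0K: "k < K" if "k < K0" for k using that BK0 K by simp
  define cell where "cell k = (x.seg k, y.seg k)" for k
  have "\<exists>v\<in>S \<times> S'. 60 * R * n < card {k \<in> {..<K0}. cell k = v}"
  proof (rule ccontr)
    assume "\<not> ?thesis"
    then have le: "card {k \<in> {..<K0}. cell k = v} \<le> 60 * R * n" if "v \<in> S \<times> S'" for v using that by force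
    have "{..<K0} \<subseteq> (\<Union>v\<in>S \<times> S'. {k \<in> {..<K0}. cell k = v})"
      using x.seg_in y.seg_in by (auto simp: cell_def)
    then have "K0 \<le> card (\<Union>v\<in>S \<times> S'. {k \<in> {..<K0}. cell k = v})"
      using fin card_mono[of "\<Union>v\<in>S \<times> S'. {k \<in> {..<K0}. cell k = v}" "{..<K0}"] by simp
    also have "\<dots> \<le> (\<Sum>v\<in>S \<times> S'. card {k \<in> {..<K0}. cell k = v})" using fin by (intro card_UN_le) simp
    also have "\<dots> \<le> of_nat (card (S \<times> S')) * (60 * R * n)" using le by (intro sum_bounded_above) simp
    also have "\<dots> \<le> c * c * (60 * R * n)"
      using c by (simp add: card_cartesian_product mult_le_mono)
    finally show False by (simp add: K0_def)
  qed
  then obtain g h where gh: "60 * R * n < card {k \<in> {..<K0}. cell k = (g, h)}" by auto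
  define T where "T = {k \<in> {..<K0}. cell k = (g, h)}"
  have T: "k < K0" "k < K" "x.seg k = g" "y.seg k = h" if "k \<in> T" for k
    using that K0K by (auto simp: T_def cell_def)
  have finT: "finite T" by (simp add: T_def)
  define Px where "Px = {x.pos k | k. k < K \<and> x.seg k = g}"
  define Py where "Py = {y.pos k | k. k < K \<and> y.seg k = h}"
  have finP: "finite Px" "finite Py" by (auto simp: Px_def Py_def)
  obtain k0 where k0: "k0 \<in> T" using gh by (metis T_def card.empty equals0I not_less0)
  have neP: "Px \<noteq> {}" "Py \<noteq> {}" using T[OF k0] by (auto simp: Px_def Py_def)
  obtain i1 where i1: "i1 < K" "x.seg i1 = g" "x.pos i1 = Max Px" using Max_in[OF finP(1) neP(1)] by (auto simp: Px_def)
  obtain j1 where j1: "j1 < K" "y.seg j1 = h" "y.pos j1 = Max Py" using Max_in[OF finP(2) neP(2)] by (auto simp: Py_def)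
  have mx: "x.pos k \<le> x.pos i1" "y.pos k \<le> y.pos j1" if "k \<in> T" for k
  proof -
    have "x.pos k \<in> Px" "y.pos k \<in> Py" using T(2-4)[OF that] by (auto simp: Px_def Py_def)
    then show "x.pos k \<le> x.pos i1" "y.pos k \<le> y.pos j1" unfolding i1 j1 using finP by simp_all
  qed
  \<comment> \<open>The diagonal of offset \<open>\<delta>\<close> has first coordinates in
    \<open>{lo \<delta>..<hi \<delta>}\<close>. The rectangle is taken as large as the visits before
    time \<open>K\<close> show it to be.\<close>
  define lo where "lo \<delta> = max 0 \<delta>" for \<delta> :: int
  define hi where "hi \<delta> = min (int (x.pos i1)) (int (y.pos j1) + \<delta>) + 1" for \<delta> :: int
  define len where "len \<delta> = nat (hi \<delta> - lo \<delta>)" for \<delta>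
  have in_range: "lo (offset k) \<le> int (x.pos k)" "int (x.pos k) < hi (offset k)" if "k \<in> T" for k
    using mx[OF that] by (auto simp: lo_def hi_def offset_def)
  have n0: "x.pos i1 < n" "y.pos j1 < n" by (rule n(1)[OF i1(1)], rule n(2)[OF j1(1)])
  define \<Delta> where "\<Delta> = offset ` T"
  have \<Delta>n: "\<Delta> \<subseteq> {- int n<..<int n}"
  proof
    fix \<delta> assume "\<delta> \<in> \<Delta>"
    then obtain k where "k \<in> T" "\<delta> = offset k" by (auto simp: \<Delta>_def)
    then show "\<delta> \<in> {- int n<..<int n}" using n(1)[of k] n(2)[of k] T(2)[of k] by (simp add: offset_def)
  qed
  have len_n: "len \<delta> \<le> n" for \<delta>
    unfolding len_def hi_def lo_def using n0 by linarith
  \<comment> \<open>On one diagonal the first coordinate determines the pair of edges, and pairs do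
    not repeat before time \<open>B\<close>.\<close>
  have fibre: "card {k \<in> T. offset k = \<delta>} \<le> len \<delta>" for \<delta>
  proof -
    have "inj_on (\<lambda>k. int (x.pos k)) {k \<in> T. offset k = \<delta>}"
    proof (rule inj_onI)
      fix k k' assume A: "k \<in> {k \<in> T. offset k = \<delta>}" "k' \<in> {k \<in> T. offset k = \<delta>}" "int (x.pos k) = int (x.pos k')"
      then have t: "k \<in> T" "k' \<in> T" and pos: "x.pos k = x.pos k'" "y.pos k = y.pos k'" by (auto simp: offset_def)
      have "e k = e k'" "f k = f k'"
        using x.coord_edge[of k k'] y.coord_edge[of k k'] T[OF t(1)] T[OF t(2)] pos by simp_all
      then show "k = k'" using inj_onD[OF distinct, of k k'] T[OF t(1)] T[OF t(2)] BK0 by simp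
    qed
    then have "card {k \<in> T. offset k = \<delta>} = card ((\<lambda>k. int (x.pos k)) ` {k \<in> T. offset k = \<delta>})"
      by (rule card_image[symmetric])
    also have "\<dots> \<le> card {lo \<delta>..<hi \<delta>}" using in_range by (intro card_mono) auto
    finally show ?thesis by (simp add: len_def)
  qed
  have "20 * (R * (3 * n)) < (\<Sum>\<delta>\<in>\<Delta>. len \<delta>)"
  proof -
    have "T \<subseteq> (\<Union>\<delta>\<in>\<Delta>. {k \<in> T. offset k = \<delta>})" by (auto simp: \<Delta>_def)
    then have "card T \<le> card (\<Union>\<delta>\<in>\<Delta>. {k \<in> T. offset k = \<delta>})"
      using finT by (intro card_mono) (auto simp: \<Delta>_def)
    also have "\<dots> \<le> (\<Sum>\<delta>\<in>\<Delta>. card {k \<in> T. offset k = \<delta>})" using finT by (intro card_UN_le) (simp add: \<Delta>_def)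
    also have "\<dots> \<le> (\<Sum>\<delta>\<in>\<Delta>. len \<delta>)" using fibre by (intro sum_mono) simp
    finally show ?thesis using gh by (simp add: T_def ac_simps)
  qed
  from cluster_offsets[OF \<Delta>n len_n _ this]
  obtain J \<delta>0 where J: "J \<subseteq> \<Delta>" "R < card J" "\<delta>0 \<in> J" "\<And>\<delta>. \<delta> \<in> J \<Longrightarrow> len \<delta> \<le> len \<delta>0"
    "\<And>\<delta> \<delta>'. \<delta> \<in> J \<Longrightarrow> \<delta>' \<in> J \<Longrightarrow> \<bar>\<delta> - \<delta>'\<bar> \<le> int (len \<delta>0 div 20)" by auto
  define D where "D = len \<delta>0 div 20"
  have finJ: "finite J" using J(2) by (metis card.infinite not_less0)
  have neJ: "J \<noteq> {}" using J(3) by auto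
  have D1: "1 \<le> D"
  proof (rule ccontr)
    assume "\<not> ?thesis"
    then have "\<delta> = \<delta>0" if "\<delta> \<in> J" for \<delta> using J(5)[OF that J(3)] by (simp add: D_def)
    then have "J \<subseteq> {\<delta>0}" by auto
    then have "card J \<le> 1" using card_mono[of "{\<delta>0}" J] by simp
    then show False using J(2) by (simp add: R_def)
  qed
  \<comment> \<open>The extent common to all diagonals of the cluster. Compared with the longest
    diagonal, either end moves by at most \<open>D\<close>, so at least \<open>18 * D\<close> points
    remain.\<close>
  define al where "al = nat (lo (Max J))"
  define N where "N = nat (hi (Min J) - lo (Max J))"
  have ext: "Min J \<le> \<delta>" "\<delta> \<le> Max J" if "\<delta> \<in> J" for \<delta> using finJ that by simp_all
  have MJ: "Min J \<in> J" "Max J \<in> J" using finJ neJ by simp_all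
  have lohi: "lo \<delta> \<le> int al" "int al + int N \<le> hi \<delta> \<or> N = 0" if "\<delta> \<in> J" for \<delta>
    using ext[OF that] by (auto simp: lo_def hi_def al_def N_def)
  have N: "12 * D \<le> N"
  proof -
    have "\<bar>Max J - \<delta>0\<bar> \<le> int D" "\<bar>Min J - \<delta>0\<bar> \<le> int D" using J(5) J(3) MJ by (simp_all add: D_def)
    then have "hi \<delta>0 - int D \<le> hi (Min J)" "lo (Max J) \<le> lo \<delta>0 + int D" by (auto simp: hi_def lo_def)
    moreover have "20 * D \<le> len \<delta>0" by (simp add: D_def)
    then have "20 * int D \<le> hi \<delta>0 - lo \<delta>0" using D1 by (simp add: len_def)
    ultimately show ?thesis unfolding N_def by linarith
  qed
  have "\<forall>\<delta>\<in>J. \<exists>k. k \<in> T \<and> offset k = \<delta>" using J(1) by (auto simp: \<Delta>_def)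
  then obtain kk where kk: "\<And>\<delta>. \<delta> \<in> J \<Longrightarrow> kk \<delta> \<in> T \<and> offset (kk \<delta>) = \<delta>" by metis
  define b where "b \<delta> = nat (int (kk \<delta>) + int al - int (x.pos (kk \<delta>)))" for \<delta>
  have along: "x.seg (b \<delta> + r) = g \<and> x.pos (b \<delta> + r) = al + r \<and> y.seg (b \<delta> + r) = h \<and>
      int (y.pos (b \<delta> + r)) = int al + int r - \<delta> \<and> int (b \<delta>) = int (kk \<delta>) + int al - int (x.pos (kk \<delta>))"
    if d: "\<delta> \<in> J" and r: "r < N" for \<delta> r
  proof -
    have k: "kk \<delta> \<in> T" "offset (kk \<delta>) = \<delta>" using kk[OF d] by simp_all
    have tt: "\<exists>t<K. int t = int (kk \<delta>) + int (al + r) - int (x.pos (kk \<delta>)) \<and>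
      x.seg t = g \<and> x.pos t = al + r \<and> y.seg t = h \<and> int (y.pos t) = int (al + r) - \<delta>" if r: "r < N" for r
    proof -
      have hi: "int (al + r) < hi \<delta>" using lohi(2)[OF d] r by simp
      have lo: "lo \<delta> \<le> int (al + r)" using lohi(1)[OF d] by simp
      have i1x: "x.seg i1 = x.seg (kk \<delta>)" "y.seg j1 = y.seg (kk \<delta>)" using T[OF k(1)] i1 j1 by simp_all
      have "al + r < n" using hi n0 by (simp add: hi_def)
      then have lt: "int (kk \<delta>) + int (al + r) < int K" using T(1)[OF k(1)] BK0 K by simp
      show ?thesis
        by (rule diagonal[OF T(2)[OF k(1)] i1(1) i1x(1) _ j1(1) i1x(2) _ _ lt])
          (use hi lo k T[OF k(1)] in \<open>auto simp: hi_def lo_def\<close>)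
    qed
    have "0 < N" using r by simp
    with tt[of 0] have b0: "int (b \<delta>) = int (kk \<delta>) + int al - int (x.pos (kk \<delta>))"
      by (auto simp: b_def)
    from tt[OF r] obtain t where t: "int t = int (kk \<delta>) + int (al + r) - int (x.pos (kk \<delta>))"
      "x.seg t = g" "x.pos t = al + r" "y.seg t = h" "int (y.pos t) = int (al + r) - \<delta>" by blast
    have "b \<delta> + r = t" using b0 t(1) by simp
    then show ?thesis using t b0 by (simp only: of_nat_add simp_thms)
  qed
  have "cluster e S f S' W K J b al N D B g h"
  proof unfold_locales
    show "finite J" "finite S" "finite S'" "1 \<le> D" "12 * D \<le> N" "3 * B \<le> K"
      "inj_on (\<lambda>k. (e k, f k)) {..<B}"
      using finJ fin D1 N K distinct by simp_all
    show "\<bar>\<delta> - \<delta>'\<bar> \<le> int D" if "\<delta> \<in> J" "\<delta>' \<in> J" for \<delta> \<delta>' using J(5)[OF that] by (simp add: D_def)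
    show "x.seg (b \<delta> + r) = g \<and> x.pos (b \<delta> + r) = al + r" if "\<delta> \<in> J" "r < N" for \<delta> r
      using along[OF that] by simp
    show "y.seg (b \<delta> + r) = h \<and> int (y.pos (b \<delta> + r)) = int al + int r - \<delta>" if "\<delta> \<in> J" "r < N" for \<delta> r
      using along[OF that] by simp
    show "b \<delta> + N + D \<le> B" if "\<delta> \<in> J" for \<delta>
    proof -
      have "0 < N" using N D1 by simp
      then have "int (b \<delta>) \<le> int (kk \<delta>) + int al" "int al + int N \<le> int n"
        using along[OF that, of 0] lohi(2)[OF that] n0 by (auto simp: hi_def)
      moreover have "kk \<delta> < K0" using kk[OF that] T by blast
      moreover have "D \<le> n" using len_n[of \<delta>0] by (simp add: D_def)
      ultimately show ?thesis using BK0 by linarith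
    qed
    have "9 * (card S + 1) * (card S' + 1) \<le> 9 * (c + 1) * (c + 1)" using c by (intro mult_le_mono) auto
    then show "9 * (card S + 1) * (card S' + 1) + 1 < card J" using J(2) by (simp add: R_def)
  qed
  then show ?thesis by (rule cluster.regime)
qed

end

section \<open>Branching vertices and the first Betti number\<close>

interpretation rat_fun: vector_space chain_scale
  by (rule vector_space_chain_scale)

text \<open>One vector with nonzero value completes a basis of the kernel to a spanning set.\<close>

lemma dim_functional_kernel:
  fixes \<phi> :: "('e \<Rightarrow> rat) \<Rightarrow> rat"
  assumes X: "rat_fun.subspace X" "X \<subseteq> rat_fun.span F" "finite F"
    and \<phi>: "\<And>x y. \<phi> (x + y) = \<phi> x + \<phi> y" "\<And>r x. \<phi> (chain_scale r x) = r * \<phi> x"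
  shows "rat_fun.dim X \<le> rat_fun.dim {x \<in> X. \<phi> x = 0} + 1"
proof -
  define Z where "Z = {x \<in> X. \<phi> x = 0}"
  obtain B where B: "B \<subseteq> Z" "rat_fun.independent B" "Z \<subseteq> rat_fun.span B" "card B = rat_fun.dim Z"
    using rat_fun.basis_exists[of Z] by blast
  have "B \<subseteq> rat_fun.span F" using B(1) X(2) by (auto simp: Z_def)
  then have fB: "finite B" using rat_fun.independent_span_bound[OF X(3) B(2)] by simp
  show ?thesis
  proof (cases "\<exists>b\<in>X. \<phi> b \<noteq> 0")
    case False
    then have "X = Z" by (auto simp: Z_def)
    then show ?thesis by (simp add: Z_def)
  next
    case True
    then obtain b where b: "b \<in> X" "\<phi> b \<noteq> 0" by blast
    have "X \<subseteq> rat_fun.span (insert b B)"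
    proof
      fix x assume x: "x \<in> X"
      define r where "r = \<phi> x / \<phi> b"
      have eq: "x = chain_scale r b + (x + chain_scale (- r) b)"
        by (auto simp: chain_scale_def fun_eq_iff)
      have "x + chain_scale (- r) b \<in> X"
        using X(1) x b(1) by (simp add: rat_fun.subspace_diff rat_fun.subspace_scale)
      moreover have "\<phi> (x + chain_scale (- r) b) = 0" unfolding \<phi> using b(2) by (simp add: r_def)
      ultimately have "x + chain_scale (- r) b \<in> rat_fun.span B" using B(3) by (auto simp: Z_def)
      then have "x + chain_scale (- r) b \<in> rat_fun.span (insert b B)"
        using rat_fun.span_mono[of B "insert b B"] by blast
      moreover have "chain_scale r b \<in> rat_fun.span (insert b B)"
        by (intro rat_fun.span_scale rat_fun.span_base) simp
      ultimately show "x \<in> rat_fun.span (insert b B)" by (subst eq) (rule rat_fun.span_add)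
    qed
    then have "rat_fun.dim X \<le> card (insert b B)" using fB by (intro rat_fun.dim_le_card) auto
    also have "\<dots> \<le> rat_fun.dim Z + 1" using B(4) fB by (simp add: card_insert_if)
    finally show ?thesis by (simp add: Z_def)
  qed
qed

lemma dim_functionals_kernel:
  fixes \<phi> :: "'v \<Rightarrow> ('e \<Rightarrow> rat) \<Rightarrow> rat"
  assumes X: "rat_fun.subspace X" "X \<subseteq> rat_fun.span F" "finite F"
    and \<phi>: "\<And>v x y. \<phi> v (x + y) = \<phi> v x + \<phi> v y" "\<And>v r x. \<phi> v (chain_scale r x) = r * \<phi> v x"
    and A: "finite A"
  shows "rat_fun.dim X \<le> rat_fun.dim {x \<in> X. \<forall>v\<in>A. \<phi> v x = 0} + card A"
  using A
proof (induction A rule: finite_induct)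
  case (insert v A)
  define Y where "Y = {x \<in> X. \<forall>v\<in>A. \<phi> v x = 0}"
  have zero: "\<phi> u 0 = 0" for u using \<phi>(2)[of u 0 0] by simp
  have "rat_fun.subspace Y"
    using X(1) unfolding rat_fun.subspace_def Y_def by (auto simp: \<phi> zero)
  moreover have "Y \<subseteq> rat_fun.span F" using X(2) by (auto simp: Y_def)
  ultimately have "rat_fun.dim Y \<le> rat_fun.dim {x \<in> Y. \<phi> v x = 0} + 1"
    using X(3) \<phi> by (intro dim_functional_kernel)
  moreover have "{x \<in> Y. \<phi> v x = 0} = {x \<in> X. \<forall>u\<in>insert v A. \<phi> u x = 0}" by (auto simp: Y_def)
  ultimately show ?case using insert by (simp add: Y_def)
qed simp

context fin_digraph
begin

lemma sum_out_arcs: "(\<Sum>v\<in>verts G. \<Sum>e\<in>out_arcs G v. c e) = (\<Sum>e\<in>arcs G. c e)"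
  unfolding out_arcs_def by (rule sum.group) auto

lemma sum_in_arcs: "(\<Sum>v\<in>verts G. \<Sum>e\<in>in_arcs G v. c e) = (\<Sum>e\<in>arcs G. c e)"
  unfolding in_arcs_def by (rule sum.group) auto

lemma sum_out_degree: "(\<Sum>v\<in>verts G. out_degree G v) = card (arcs G)"
  using sum_out_arcs[of "\<lambda>_. 1 :: nat"] by (simp add: out_degree_def)

lemma sum_in_degree: "(\<Sum>v\<in>verts G. in_degree G v) = card (arcs G)"
  using sum_in_arcs[of "\<lambda>_. 1 :: nat"] by (simp add: in_degree_def)

text \<open>The cycle space is cut out of all chains by the boundary conditions at all vertices but
  one, because the boundary of a chain sums to zero; each condition lowers the dimension by at most
  one.\<close>

lemma arcs_le_betti1:
  assumes "verts G \<noteq> {}"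
  shows "card (arcs G) + 1 \<le> betti1 G + card (verts G)"
proof -
  obtain v0 where v0: "v0 \<in> verts G" using assms by blast
  define unit :: "'b \<Rightarrow> 'b \<Rightarrow> rat" where "unit e = (\<lambda>e'. if e' = e then 1 else 0)" for e
  define X where "X = {c :: 'b \<Rightarrow> rat. \<forall>e. e \<notin> arcs G \<longrightarrow> c e = 0}"
  have sub: "rat_fun.subspace X"
    unfolding rat_fun.subspace_def X_def by (auto simp: chain_scale_def)
  have inj: "inj_on unit (arcs G)"
  proof (rule inj_onI)
    fix x y assume "unit x = unit y"
    then have "unit x x = unit y x" by simp
    then show "x = y" by (simp add: unit_def split: if_splits)
  qed
  have comb: "(\<Sum>e\<in>arcs G. chain_scale (c e) (unit e)) = (\<lambda>e. if e \<in> arcs G then c e else 0)" for c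
  proof
    fix e'
    have "(\<Sum>e\<in>arcs G. chain_scale (c e) (unit e)) e' = (\<Sum>e\<in>arcs G. chain_scale (c e) (unit e) e')"
      by (induction rule: infinite_finite_induct) auto
    also have "\<dots> = (\<Sum>e\<in>arcs G. if e = e' then c e else 0)"
      by (intro sum.cong) (auto simp: chain_scale_def unit_def)
    finally show "(\<Sum>e\<in>arcs G. chain_scale (c e) (unit e)) e' = (if e' \<in> arcs G then c e' else 0)" by simp
  qed
  have span: "X \<subseteq> rat_fun.span (unit ` arcs G)"
  proof
    fix c assume "c \<in> X"
    then have "c = (\<Sum>e\<in>arcs G. chain_scale (c e) (unit e))" unfolding comb by (auto simp: X_def)
    also have "\<dots> \<in> rat_fun.span (unit ` arcs G)"
      by (intro rat_fun.span_sum rat_fun.span_scale rat_fun.span_base) auto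
    finally show "c \<in> rat_fun.span (unit ` arcs G)" .
  qed
  have indep: "rat_fun.independent (unit ` arcs G)"
    unfolding rat_fun.independent_explicit_finite_subsets
  proof (intro allI impI ballI)
    fix S u v assume S: "S \<subseteq> unit ` arcs G" "finite S" "(\<Sum>v\<in>S. chain_scale (u v) v) = 0" "v \<in> S"
    define c where "c e = (if unit e \<in> S then u (unit e) else 0)" for e
    have "(\<Sum>e\<in>arcs G. chain_scale (c e) (unit e)) = (\<Sum>w\<in>unit ` arcs G. chain_scale (if w \<in> S then u w else 0) w)"
      by (simp add: sum.reindex[OF inj] c_def)
    also have "\<dots> = (\<Sum>w\<in>S. chain_scale (u w) w)"
      using S(1) by (intro sum.mono_neutral_cong_right) (auto simp: chain_scale_def)
    finally have "(\<lambda>e. if e \<in> arcs G then c e else 0) = (0 :: 'b \<Rightarrow> rat)" using S(3) comb by simp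
    then have c0: "c e = 0" if "e \<in> arcs G" for e using that by (auto dest!: fun_cong[of _ _ e])
    obtain e where e: "e \<in> arcs G" "v = unit e" using S by auto
    then have "c e = u v" using S(4) by (simp add: c_def)
    then show "u v = 0" using c0[OF e(1)] by simp
  qed
  have "unit ` arcs G \<subseteq> X" by (auto simp: X_def unit_def)
  then have "rat_fun.dim X = card (unit ` arcs G)"
    using rat_fun.dim_unique[OF _ span indep refl] by simp
  then have "card (arcs G) = rat_fun.dim X" using inj by (simp add: card_image)
  also have "\<dots> \<le> rat_fun.dim {c \<in> X. \<forall>v\<in>verts G - {v0}. boundary_map G c v = 0} + card (verts G - {v0})"
  proof (rule dim_functionals_kernel[OF sub span])
    show "boundary_map G (x + y) v = boundary_map G x v + boundary_map G y v" for x y v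
      by (simp add: boundary_map_def sum.distrib)
    show "boundary_map G (chain_scale r x) v = r * boundary_map G x v" for r x v
      by (simp add: boundary_map_def chain_scale_def sum_distrib_left right_diff_distrib)
  qed auto
  also have "{c \<in> X. \<forall>v\<in>verts G - {v0}. boundary_map G c v = 0} = cycle_space G"
  proof -
    have "boundary_map G c v0 = 0" if "\<forall>v\<in>verts G - {v0}. boundary_map G c v = 0" for c
    proof -
      have "(\<Sum>v\<in>verts G. boundary_map G c v) = 0"
        unfolding boundary_map_def by (simp add: sum_subtractf sum_in_arcs sum_out_arcs)
      moreover have "(\<Sum>v\<in>verts G. boundary_map G c v) = boundary_map G c v0 + (\<Sum>v\<in>verts G - {v0}. boundary_map G c v)"
        using v0 by (intro sum.remove) auto
      ultimately show ?thesis using that by simp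
    qed
    then show ?thesis unfolding cycle_space_def X_def by blast
  qed
  also have "card (verts G - {v0}) = card (verts G) - 1" using v0 by simp
  finally show ?thesis using v0 card_gt_0_iff[of "verts G"] by (auto simp: betti1_def)
qed

text \<open>Bounds at once the number of vertices that are not plain and the number of edges leaving
  them.\<close>

definition branching :: nat where
  "branching = (\<Sum>v\<in>verts G. if out_degree G v = 1 \<and> in_degree G v = 1 then 0 else out_degree G v + 1)"

text \<open>The second inequality lets additive constants be absorbed into multiples of
  \<open>m\<close>.\<close>

lemma branching_le:
  assumes "verts G \<noteq> {}"
  shows "branching \<le> 6 * (betti1 G + card (boundary G))" "1 \<le> betti1 G + card (boundary G)"
proof -
  have bd: "int (card (boundary G)) = (\<Sum>v\<in>verts G. if in_degree G v = 0 \<or> out_degree G v = 0 then 1 else 0)"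
    unfolding boundary_def by (simp add: sum.If_cases Int_def)
  \<comment> \<open>Vertex by vertex: a plain vertex gives 0 on both sides, any other vertex with
    positive degrees has degree sum at least 3, and the 6 makes up for a vanishing degree. The two
    degree sums equal the number of edges.\<close>
  have "int branching \<le> (\<Sum>v\<in>verts G. 3 * (int (out_degree G v) - 1) + 2 * (int (in_degree G v) - 1)
      + 6 * (if in_degree G v = 0 \<or> out_degree G v = 0 then 1 else 0))"
    unfolding branching_def of_nat_sum by (intro sum_mono) auto
  also have "\<dots> = 5 * (int (card (arcs G)) - int (card (verts G))) + 6 * int (card (boundary G))"
    unfolding bd
    using sum_in_degree sum_out_degree
    by (simp add: sum.distrib sum_subtractf sum_distrib_left[symmetric] of_nat_sum[symmetric] del: of_nat_sum)
  finally have *: "int branching \<le> 5 * (int (card (arcs G)) - int (card (verts G))) + 6 * int (card (boundary G))" .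
  have "int (card (arcs G)) + 1 \<le> int (betti1 G) + int (card (verts G))"
    using arcs_le_betti1[OF assms] by linarith
  with * have **: "int branching + 5 \<le> 5 * int (betti1 G) + 6 * int (card (boundary G))"
    by (simp add: algebra_simps)
  show "branching \<le> 6 * (betti1 G + card (boundary G))" using ** by simp
  show "1 \<le> betti1 G + card (boundary G)" using ** by simp
qed

end

section \<open>Running times of programs\<close>

primrec writes :: "program \<Rightarrow> nat set" where
  "writes Skip = {}"
| "writes (Write a x y) = {a}"
| "writes (Seq P Q) = writes P \<union> writes Q"
| "writes (IfLess x y P Q) = writes P \<union> writes Q"
| "writes (WhileLess x y P) = writes P"

lemma run_frame: "run P s t s' \<Longrightarrow> a \<notin> writes P \<Longrightarrow> s' a = s a"
  by (induction rule: run.induct) auto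

text \<open>A Hoare triple for total correctness with a time bound; as runs are deterministic, the
  existence of one suffices.\<close>

definition exec :: "program \<Rightarrow> memory \<Rightarrow> nat \<Rightarrow> (memory \<Rightarrow> bool) \<Rightarrow> bool" where
  "exec P s T Q \<longleftrightarrow> (\<exists>t s'. run P s t s' \<and> t \<le> T \<and> Q s')"

lemma exec_frame:
  assumes "exec P s T Q" "\<And>s'. Q s' \<Longrightarrow> (\<And>a. a \<notin> writes P \<Longrightarrow> s' a = s a) \<Longrightarrow> R s'" "T \<le> T'"
  shows "exec P s T' R"
  using assms unfolding exec_def by (meson order_trans run_frame)

lemma exec_weaken: "exec P s T Q \<Longrightarrow> (\<And>s'. Q s' \<Longrightarrow> R s') \<Longrightarrow> T \<le> T' \<Longrightarrow> exec P s T' R"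
  by (erule exec_frame)

lemma exec_le: "exec P s T Q \<Longrightarrow> T \<le> T' \<Longrightarrow> exec P s T' Q"
  by (erule exec_weaken)

lemma exec_Skip: "Q s \<Longrightarrow> exec Skip s 1 Q"
  unfolding exec_def using run.Skip by blast

lemma exec_Write:
  "Q (s(a := (s a)(expr_val x s := expr_val y s))) \<Longrightarrow> exec (Write a x y) s (expr_steps x + expr_steps y + 1) Q"
  unfolding exec_def using run.Write by blast

lemma exec_Seq:
  assumes "exec P s T R" "\<And>s'. R s' \<Longrightarrow> (\<And>a. a \<notin> writes P \<Longrightarrow> s' a = s a) \<Longrightarrow> exec Q s' U G"
  shows "exec (Seq P Q) s (T + U) G"
proof -
  from assms(1) obtain t s' where 1: "run P s t s'" "t \<le> T" "R s'" unfolding exec_def by blast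
  from assms(2)[OF 1(3) run_frame[OF 1(1)]] obtain u s'' where "run Q s' u s''" "u \<le> U" "G s''"
    unfolding exec_def by blast
  then show ?thesis using run.Seq[OF 1(1)] 1(2) unfolding exec_def by (meson add_mono)
qed

lemma exec_Seq_Write:
  "exec Q (s(a := (s a)(expr_val x s := expr_val y s))) U G \<Longrightarrow>
    exec (Seq (Write a x y) Q) s (expr_steps x + expr_steps y + 1 + U) G"
  by (rule exec_Seq[OF exec_Write[where Q = "\<lambda>s'. s' = s(a := (s a)(expr_val x s := expr_val y s))"]]) auto

lemma exec_IfLess:
  assumes "expr_val x s < expr_val y s \<Longrightarrow> exec P s T G"
    and "\<not> expr_val x s < expr_val y s \<Longrightarrow> exec Q s U G"
  shows "exec (IfLess x y P Q) s (expr_steps x + expr_steps y + 1 + max T U) G"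
proof (cases "expr_val x s < expr_val y s")
  case True
  with assms(1) obtain t s' where "run P s t s'" "t \<le> T" "G s'" unfolding exec_def by blast
  with run.IfTrue[OF True] show ?thesis unfolding exec_def by (meson add_left_mono le_max_iff_disj)
next
  case False
  with assms(2) obtain t s' where "run Q s t s'" "t \<le> U" "G s'" unfolding exec_def by blast
  with run.IfFalse[OF False] show ?thesis unfolding exec_def by (meson add_left_mono le_max_iff_disj)
qed

text \<open>The initial measure bounds the number of rounds, each costing \<open>T\<close>. The
  frame premise lets the invariant omit all arrays that the body does not write.\<close>

lemma exec_WhileLess:
  fixes \<mu> :: "memory \<Rightarrow> nat"
  assumes "I s" "\<mu> s \<le> m"
    and "\<And>t. I t \<Longrightarrow> (\<And>a. a \<notin> writes P \<Longrightarrow> t a = s a) \<Longrightarrow> expr_val x t < expr_val y t \<Longrightarrow>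
      exec P t T (\<lambda>t'. I t' \<and> \<mu> t' < \<mu> t)"
  shows "exec (WhileLess x y P) s (m * (T + expr_steps x + expr_steps y + 1) + (expr_steps x + expr_steps y + 1))
    (\<lambda>t. I t \<and> \<not> expr_val x t < expr_val y t)"
proof -
  have "exec (WhileLess x y P) t (m * (T + expr_steps x + expr_steps y + 1) + (expr_steps x + expr_steps y + 1))
      (\<lambda>t. I t \<and> \<not> expr_val x t < expr_val y t)"
    if "I t" "\<mu> t \<le> m" "\<And>a. a \<notin> writes P \<Longrightarrow> t a = s a" for t m
    using that
  proof (induction "\<mu> t" arbitrary: t m rule: less_induct)
    case less
    show ?case
    proof (cases "expr_val x t < expr_val y t")
      case False
      then show ?thesis using run.WhileFalse[OF False] less.prems unfolding exec_def
        by (metis (no_types, lifting) le_add2)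
    next
      case True
      from assms(3)[OF less.prems(1,3) True] obtain u t' where
        1: "run P t u t'" "u \<le> T" "I t'" "\<mu> t' < \<mu> t" unfolding exec_def by blast
      have fr: "t' a = s a" if "a \<notin> writes P" for a using run_frame[OF 1(1) that] less.prems(3)[OF that] by simp
      have "\<mu> t' \<le> m - 1" using 1(4) less.prems(2) by simp
      from less.hyps[OF 1(4,3) this fr] obtain w t'' where
        2: "run (WhileLess x y P) t' w t''" "w \<le> (m - 1) * (T + expr_steps x + expr_steps y + 1) + (expr_steps x + expr_steps y + 1)"
          "I t''" "\<not> expr_val x t'' < expr_val y t''" unfolding exec_def by blast
      have "0 < m" using 1(4) less.prems(2) by simp
      then obtain m' where m': "m = Suc m'" by (cases m) auto
      have "expr_steps x + expr_steps y + 1 + u + w \<le> m * (T + expr_steps x + expr_steps y + 1) + (expr_steps x + expr_steps y + 1)"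
        using 1(2) 2(2) by (simp add: m')
      with run.WhileTrue[OF True 1(1) 2(1)] 2(3,4) show ?thesis unfolding exec_def by blast
    qed
  qed
  then show ?thesis using assms(1,2) by blast
qed

section \<open>Programs without loops, and counting loops\<close>

primrec loop_free :: "program \<Rightarrow> bool" where
  "loop_free Skip = True"
| "loop_free (Write a x y) = True"
| "loop_free (Seq P Q) = (loop_free P \<and> loop_free Q)"
| "loop_free (IfLess x y P Q) = (loop_free P \<and> loop_free Q)"
| "loop_free (WhileLess x y P) = False"

primrec cost :: "program \<Rightarrow> nat" where
  "cost Skip = 1"
| "cost (Write a x y) = expr_steps x + expr_steps y + 1"
| "cost (Seq P Q) = cost P + cost Q"
| "cost (IfLess x y P Q) = expr_steps x + expr_steps y + 1 + max (cost P) (cost Q)"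
| "cost (WhileLess x y P) = 0"

text \<open>Symbolic execution: without loops, the final memory and a time bound are found by
  rewriting. The values of \<open>effect\<close> and \<open>cost\<close> at loops are dummies,
  excluded by \<open>loop_free\<close>.\<close>

primrec effect :: "program \<Rightarrow> memory \<Rightarrow> memory" where
  "effect Skip s = s"
| "effect (Write a x y) s = s(a := (s a)(expr_val x s := expr_val y s))"
| "effect (Seq P Q) s = effect Q (effect P s)"
| "effect (IfLess x y P Q) s = (if expr_val x s < expr_val y s then effect P s else effect Q s)"
| "effect (WhileLess x y P) s = s"

lemma exec_effect: "loop_free P \<Longrightarrow> exec P s (cost P) (\<lambda>t. t = effect P s)"
proof (induction P arbitrary: s)
  case Skip
  then show ?case unfolding effect.simps cost.simps by (intro exec_Skip refl)
next
  case (Write a x y)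
  then show ?case unfolding effect.simps cost.simps by (intro exec_Write refl)
next
  case (Seq P Q)
  then have "exec P s (cost P) (\<lambda>t. t = effect P s)" by simp
  from exec_Seq[OF this] show ?case using Seq by simp
next
  case (IfLess x y P Q)
  show ?case unfolding cost.simps
    by (rule exec_IfLess) (use IfLess in simp_all)
qed simp

lemma exec_loop_free: "loop_free P \<Longrightarrow> Q (effect P s) \<Longrightarrow> cost P \<le> T \<Longrightarrow> exec P s T Q"
  by (rule exec_weaken[OF exec_effect]) auto

abbreviation Var :: "nat \<Rightarrow> expr" where "Var a \<equiv> Read a (Const 0)"
abbreviation Assign :: "nat \<Rightarrow> expr \<Rightarrow> program" where "Assign a x \<equiv> Write a (Const 0) x"

definition For :: "nat \<Rightarrow> expr \<Rightarrow> program \<Rightarrow> program" where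
  "For i n P = Seq (Assign i (Const 0)) (WhileLess (Var i) n (Seq P (Assign i (Plus (Var i) (Const 1)))))"

lemma writes_For [simp]: "writes (For i n P) = insert i (writes P)"
  by (auto simp: For_def)

text \<open>The invariant is demanded for the memory whose counter is already advanced, because that
  is the memory in which the next round starts. The limit is evaluated anew in every round, hence
  the premise \<open>bound\<close>.\<close>

lemma exec_For:
  assumes start: "I 0 (s(i := (s i)(0 := 0)))"
    and step: "\<And>k t. \<lbrakk>k < m; I k t; t i 0 = k; \<And>a. a \<notin> insert i (writes P) \<Longrightarrow> t a = s a\<rbrakk> \<Longrightarrow>
      exec P t T (\<lambda>t'. I (Suc k) (t'(i := (t' i)(0 := Suc k))))"
    and bound: "\<And>k t. \<lbrakk>I k t; \<And>a. a \<notin> insert i (writes P) \<Longrightarrow> t a = s a\<rbrakk> \<Longrightarrow> expr_val n t = m"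
    and i: "i \<notin> writes P"
  shows "exec (For i n P) s (m * (T + expr_steps n + 9) + expr_steps n + 6) (\<lambda>t. I m t \<and> t i 0 = m)"
proof -
  let ?s = "s(i := (s i)(0 := 0))"
  let ?J = "\<lambda>t. t i 0 \<le> m \<and> I (t i 0) t"
  have "exec (WhileLess (Var i) n (Seq P (Assign i (Plus (Var i) (Const 1))))) ?s
      (m * (T + 6 + expr_steps (Var i) + expr_steps n + 1) + (expr_steps (Var i) + expr_steps n + 1))
      (\<lambda>t. ?J t \<and> \<not> expr_val (Var i) t < expr_val n t)"
  proof (rule exec_WhileLess[where \<mu> = "\<lambda>t. m - t i 0"])
    show "?J ?s" using start by simp
    fix t assume t: "?J t" "\<And>a. a \<notin> writes (Seq P (Assign i (Plus (Var i) (Const 1)))) \<Longrightarrow> t a = ?s a"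
      "expr_val (Var i) t < expr_val n t"
    have fr: "t a = s a" if "a \<notin> insert i (writes P)" for a using t(2)[of a] that by auto
    have lt: "t i 0 < m" using t(1,3) bound[of "t i 0" t] fr by auto
    have "exec P t T (\<lambda>t'. I (Suc (t i 0)) (t'(i := (t' i)(0 := Suc (t i 0)))))"
      using step[of "t i 0" t] lt t(1) fr by auto
    then have "exec (Seq P (Assign i (Plus (Var i) (Const 1)))) t (T + 6) (\<lambda>t'. ?J t' \<and> m - t' i 0 < m - t i 0)"
    proof (rule exec_Seq)
      fix t' assume t': "I (Suc (t i 0)) (t'(i := (t' i)(0 := Suc (t i 0))))" "\<And>a. a \<notin> writes P \<Longrightarrow> t' a = t a"
      have "exec (Assign i (Plus (Var i) (Const 1))) t'
        (expr_steps (Const 0) + expr_steps (Plus (Var i) (Const 1)) + 1) (\<lambda>t'. ?J t' \<and> m - t' i 0 < m - t i 0)"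
        by (rule exec_Write) (use t' t'(2)[OF i] lt in simp)
      then show "exec (Assign i (Plus (Var i) (Const 1))) t' 6 (\<lambda>t'. ?J t' \<and> m - t' i 0 < m - t i 0)"
        by (rule exec_weaken) simp_all
    qed
    then show "exec (Seq P (Assign i (Plus (Var i) (Const 1)))) t (T + 6) (\<lambda>t'. ?J t' \<and> m - t' i 0 < m - t i 0)" .
  qed simp
  then have "exec (For i n P) s (expr_steps (Const 0) + expr_steps (Const 0) + 1 +
      (m * (T + 6 + expr_steps (Var i) + expr_steps n + 1) + (expr_steps (Var i) + expr_steps n + 1)))
      (\<lambda>t. ?J t \<and> \<not> expr_val (Var i) t < expr_val n t)"
    unfolding For_def by (intro exec_Seq_Write) simp
  then show ?thesis
  proof (rule exec_frame)
    fix s' assume s': "?J s' \<and> \<not> expr_val (Var i) s' < expr_val n s'" "\<And>a. a \<notin> writes (For i n P) \<Longrightarrow> s' a = s a"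
    then have "expr_val n s' = m" using bound[of "s' i 0" s'] by auto
    with s' have "s' i 0 = m" by simp
    with s' show "I m s' \<and> s' i 0 = m" by auto
  qed (simp add: algebra_simps)
qed

section \<open>Simulation of the product automaton\<close>

text \<open>
  Use of the memory, where \<open>v\<close> is a vertex of the first and second automaton, respectively: arrays
  0--6 and 7--13 are the input, 20 holds the multiples of the row length \<open>N\<close>, 21/31 and 22/32 the out-
  and indegree of \<open>v\<close>, 23/33 the edges leaving \<open>v\<close> (from index \<open>v * N\<close> on), and 24/34 the
  vertices with more than one outgoing edge, 35/36 of them. Array 40 marks the pairs found so far
  whose components both branch, 41/42 is the queue of the pairs where trajectories start, 43/44 is
  the current trajectory, and 45/46 the time of the last visit to \<open>v\<close> (plus one).

  The other arrays are used as variables, among them 25--29 for \<open>N\<close>, \<open>c\<close>, \<open>B\<close>, \<open>4 * B\<close> and \<open>3 * B\<close>,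
  50 and 51 for the head and the length of the queue, 52/53 for the current pair, 54 for the time,
  61 for the answer, 62 for the flag that a trajectory has reached length \<open>4 * B\<close>, 63/64 for the two
  periods and 65 for their greatest common divisor.
\<close>

definition enum_body :: program where
  "enum_body =
      (Seq (Assign 59 (Read 23 (Plus (Read 20 (Var 52)) (Var 57))))
      (Seq (Assign 60 (Read 33 (Plus (Read 20 (Var 53)) (Var 58))))
      (IfLess (Read 6 (Var 59)) (Read 13 (Var 60)) Skip
      (IfLess (Read 13 (Var 60)) (Read 6 (Var 59)) Skip
        (Seq (Write 41 (Plus (Var 51) (Var 56)) (Read 5 (Var 59)))
        (Seq (Write 42 (Plus (Var 51) (Var 56)) (Read 12 (Var 60)))
             (Assign 56 (Plus (Var 56) (Const 1)))))))))"

text \<open>Candidates are written behind the end of the queue and counted in 56, without being part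
  of it yet. Where the components do not both branch, the first candidate is simply the next pair;
  only \<open>mark_prog\<close> commits candidates to the queue.\<close>

definition enum_prog :: program where
  "enum_prog = Seq (Assign 56 (Const 0)) (For 57 (Read 21 (Var 52)) (For 58 (Read 31 (Var 53)) enum_body))"

text \<open>Array 40 has a cell for each of quadratically many pairs but is never cleared: outside
  the input the memory is 0 initially, so only touched cells cost time.\<close>

definition mark_prog :: program where
  "mark_prog = IfLess (Const 0) (Read 40 (Plus (Read 20 (Var 52)) (Var 53))) Skip
    (Seq (Write 40 (Plus (Read 20 (Var 52)) (Var 53)) (Const 1))
         (Assign 51 (Plus (Var 51) (Var 56))))"

definition visit_prog :: program where "visit_prog = Seq enum_prog mark_prog"

lemma writes_visit: "writes enum_body = {56, 59, 60, 41, 42}" "writes enum_prog = {56, 57, 58, 59, 60, 41, 42}" "writes mark_prog = {40, 51}"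
  "writes visit_prog = {56, 57, 58, 59, 60, 41, 42, 40, 51}"
  by (auto simp: enum_body_def enum_prog_def mark_prog_def visit_prog_def)

definition qlist :: "memory \<Rightarrow> nat \<Rightarrow> (nat \<times> nat) list" where
  "qlist t n = map (\<lambda>i. (t 41 i, t 42 i)) [0..<n]"

lemma map_upd_beyond:
  "map (\<lambda>x. (if x = n then a else g x, if x = n then b else h x)) [0..<n] = map (\<lambda>x. (g x, h x)) [0..<n]"
  by (intro map_cong) auto

locale tables =
  fixes s0 :: memory and N0 :: nat
  assumes mul: "u < N0 \<Longrightarrow> s0 20 u = u * N0"
begin

text \<open>Phrased with the tables and not with the graphs, so that the program can be verified
  independently of what the tables mean. The order is that of the two nested loops.\<close>

definition row :: "nat \<times> nat \<Rightarrow> nat \<Rightarrow> nat \<Rightarrow> (nat \<times> nat) list" where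
  "row p i j = concat (map (\<lambda>j. let e = s0 23 (s0 20 (fst p) + i); f = s0 33 (s0 20 (snd p) + j)
     in if s0 6 e = s0 13 f then [(s0 5 e, s0 12 f)] else []) [0..<j])"

definition succs :: "nat \<times> nat \<Rightarrow> (nat \<times> nat) list" where
  "succs p = concat (map (\<lambda>i. row p i (s0 31 (snd p))) [0..<s0 21 (fst p)])"

definition agree :: "memory \<Rightarrow> bool" where "agree t \<longleftrightarrow> (\<forall>a<40. t a = s0 a)"

lemma agreeD: "agree t \<Longrightarrow> a < 40 \<Longrightarrow> t a = s0 a"
  by (simp add: agree_def)

lemma agree_upd: "agree t \<Longrightarrow> 40 \<le> a \<Longrightarrow> agree (t(a := f))"
  by (simp add: agree_def)

lemma agree_frame: "agree s \<Longrightarrow> (\<And>a. a < 40 \<Longrightarrow> t a = s a) \<Longrightarrow> agree t"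
  by (simp add: agree_def)

lemma enum_spec:
  assumes s: "agree s" and p: "p = (s 52 0, s 53 0)" and q: "q = s 51 0"
  shows "exec enum_prog s (s0 21 (fst p) * (s0 31 (snd p) * 80 + 40) + 40)
    (\<lambda>t. t 56 0 = length (succs p) \<and> qlist t (q + length (succs p)) = qlist s q @ succs p)"
proof -
  define d1 where "d1 = s0 21 (fst p)"
  define d2 where "d2 = s0 31 (snd p)"
  \<comment> \<open>The output after \<open>i\<close> complete rows and \<open>j\<close> entries of
    the next; \<open>pre_row\<close> joins the end of a row to the start of its successor.\<close>
  define pre where "pre i j = concat (map (\<lambda>i. row p i d2) [0..<i]) @ row p i j" for i j
  define I where "I l t \<longleftrightarrow> t 56 0 = length l \<and> qlist t (q + length l) = qlist s q @ l" for l t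
  have I_upd: "I l (t(a := f)) \<longleftrightarrow> I l t" if "a \<notin> {41, 42, 56}" for a f t l
    using that by (simp add: I_def qlist_def)
  have pre_Suc: "pre i (Suc j) = pre i j @ (let e = s0 23 (s0 20 (fst p) + i); f = s0 33 (s0 20 (snd p) + j)
     in if s0 6 e = s0 13 f then [(s0 5 e, s0 12 f)] else [])" for i j
    by (simp add: pre_def row_def)
  have pre_row: "pre i d2 = pre (Suc i) 0" for i
    by (simp add: pre_def row_def)
  have body: "exec enum_body t 60 (I (pre i (Suc j)))"
    if t: "agree t" "t 52 = s 52" "t 53 = s 53" "t 51 = s 51" "I (pre i j) t" "t 57 0 = i" "t 58 0 = j" for t i j
  proof -
    define e where "e = s0 23 (s0 20 (fst p) + i)"
    define f where "f = s0 33 (s0 20 (snd p) + j)"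
    define l where "l = pre i j"
    have l: "pre i (Suc j) = l @ (if s0 6 e = s0 13 f then [(s0 5 e, s0 12 f)] else [])"
      unfolding pre_Suc l_def e_def f_def Let_def ..
    have I0: "t 56 0 = length l" "qlist t (q + length l) = qlist s q @ l" using t(5) by (auto simp: I_def l_def)
    have vals: "t 23 (t 20 (t 52 0) + t 57 0) = e" "t 33 (t 20 (t 53 0) + t 58 0) = f"
      using t p by (simp_all add: agreeD e_def f_def)
    show ?thesis
      unfolding l
      using t(1,4) I0 vals
      by (intro exec_loop_free) (auto simp: enum_body_def agreeD I_def qlist_def q map_upd_beyond)
  qed
  have inner: "exec (For 58 (Read 31 (Var 53)) enum_body) t (d2 * 80 + 20) (I (pre i d2))"
    if t: "agree t" "t 52 = s 52" "t 53 = s 53" "t 51 = s 51" "I (pre i 0) t" "t 57 0 = i" for t i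
  proof (rule exec_weaken[OF exec_For[where I = "\<lambda>j. I (pre i j)" and m = d2 and T = 60 and i = 58 and P = enum_body and s = t and n = "Read 31 (Var 53)"]])
    show "I (pre i 0) (t(58 := (t 58)(0 := 0)))" using t by (simp add: I_upd)
    fix j u assume u: "j < d2" "I (pre i j) u" "u 58 0 = j" "\<And>a. a \<notin> insert 58 (writes enum_body) \<Longrightarrow> u a = t a"
    have "exec enum_body u 60 (I (pre i (Suc j)))"
    proof (rule body)
      show "agree u" by (rule agree_frame[OF t(1)], rule u(4)) (auto simp: writes_visit)
    qed (use u t in \<open>simp_all add: writes_visit\<close>)
    then show "exec enum_body u 60 (\<lambda>t'. I (pre i (Suc j)) (t'(58 := (t' 58)(0 := Suc j))))"
      by (simp add: I_upd)
  next
    fix j u assume "I (pre i j) u" and u: "\<And>a. a \<notin> insert 58 (writes enum_body) \<Longrightarrow> u a = t a"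
    show "expr_val (Read 31 (Var 53)) u = d2" using u[of 31] u[of 53] t p by (simp add: d2_def agreeD writes_visit)
  qed (auto simp: writes_visit)
  have "exec (For 57 (Read 21 (Var 52)) (For 58 (Read 31 (Var 53)) enum_body)) (s(56 := (s 56)(0 := 0)))
    (d1 * (d2 * 80 + 20 + 3 + 9) + 3 + 6) (\<lambda>t. I (pre d1 0) t \<and> t 57 0 = d1)"
  proof (rule exec_weaken[OF exec_For[where I = "\<lambda>i. I (pre i 0)" and m = d1 and T = "d2 * 80 + 20" and i = 57
      and P = "For 58 (Read 31 (Var 53)) enum_body" and s = "s(56 := (s 56)(0 := 0))" and n = "Read 21 (Var 52)"]])
    show "I (pre 0 0) ((s(56 := (s 56)(0 := 0)))(57 := ((s(56 := (s 56)(0 := 0))) 57)(0 := 0)))"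
      by (simp add: I_def pre_def row_def qlist_def)
    fix i u assume u: "i < d1" "I (pre i 0) u" "u 57 0 = i"
      "\<And>a. a \<notin> insert 57 (writes (For 58 (Read 31 (Var 53)) enum_body)) \<Longrightarrow> u a = (s(56 := (s 56)(0 := 0))) a"
    have "exec (For 58 (Read 31 (Var 53)) enum_body) u (d2 * 80 + 20) (I (pre i d2))"
    proof (rule inner)
      show "agree u" by (rule agree_frame[OF s]) (use u(4) in \<open>auto simp: writes_visit\<close>)
    qed (use u s in \<open>simp_all add: writes_visit\<close>)
    then show "exec (For 58 (Read 31 (Var 53)) enum_body) u (d2 * 80 + 20)
        (\<lambda>t'. I (pre (Suc i) 0) (t'(57 := (t' 57)(0 := Suc i))))"
      by (simp add: I_upd pre_row)
  next
    fix i u assume "I (pre i 0) u"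
      and u: "\<And>a. a \<notin> insert 57 (writes (For 58 (Read 31 (Var 53)) enum_body)) \<Longrightarrow> u a = (s(56 := (s 56)(0 := 0))) a"
    show "expr_val (Read 21 (Var 52)) u = d1" using u[of 21] u[of 52] s p by (simp add: d1_def agreeD writes_visit)
  qed (auto simp: writes_visit)
  then have "exec enum_prog s (expr_steps (Const 0) + expr_steps (Const 0) + 1 +
      (d1 * (d2 * 80 + 20 + 3 + 9) + 3 + 6)) (\<lambda>t. I (pre d1 0) t \<and> t 57 0 = d1)"
    unfolding enum_prog_def by (intro exec_Seq_Write) simp
  then show ?thesis
  proof (rule exec_weaken)
    fix t assume "I (pre d1 0) t \<and> t 57 0 = d1"
    moreover have "pre d1 0 = succs p" by (simp add: pre_def row_def succs_def d1_def d2_def)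
    ultimately show "t 56 0 = length (succs p) \<and> qlist t (q + length (succs p)) = qlist s q @ succs p"
      by (simp add: I_def)
  next
    show "expr_steps (Const 0) + expr_steps (Const 0) + 1 + (d1 * (d2 * 80 + 20 + 3 + 9) + 3 + 6) \<le> s0 21 (fst p) * (s0 31 (snd p) * 80 + 40) + 40"
      unfolding d1_def d2_def by (simp add: add_mult_distrib2)
  qed
qed

definition marks :: "(nat \<times> nat) set \<Rightarrow> nat \<Rightarrow> nat" where
  "marks M i = (if \<exists>u w. (u, w) \<in> M \<and> i = u * N0 + w then 1 else 0)"

lemma mul_inj:
  assumes "w < N0" "w' < N0" "u * N0 + w = u' * N0 + w'"
  shows "u = u' \<and> w = (w'::nat)"
proof -
  have "(u * N0 + w) div N0 = u" "(u * N0 + w) mod N0 = w" "(u' * N0 + w') div N0 = u'" "(u' * N0 + w') mod N0 = w'"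
    using assms(1,2) by simp_all
  with assms(3) show ?thesis by metis
qed

lemma marks_iff:
  assumes "M \<subseteq> {..<N0} \<times> {..<N0}" "w < N0"
  shows "0 < marks M (u * N0 + w) \<longleftrightarrow> (u, w) \<in> M"
proof -
  have "(u, w) \<in> M" if "(u', w') \<in> M" "u * N0 + w = u' * N0 + w'" for u' w'
  proof -
    have "w' < N0" using that(1) assms(1) by auto
    from mul_inj[OF assms(2) this that(2)] that(1) show ?thesis by simp
  qed
  then show ?thesis by (auto simp: marks_def)
qed

lemma marks_insert: "(marks M)(u * N0 + w := 1) = marks (insert (u, w) M)"
  by (rule ext) (auto simp: marks_def)

definition rep :: "memory \<Rightarrow> (nat \<times> nat) set \<Rightarrow> (nat \<times> nat) list \<Rightarrow> bool \<Rightarrow> bool" where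
  "rep t M Q ans \<longleftrightarrow> agree t \<and> t 51 0 = length Q \<and> qlist t (length Q) = Q \<and> t 40 = marks M \<and>
     M \<subseteq> {..<N0} \<times> {..<N0} \<and> t 61 0 = (if ans then 1 else 0)"

lemma rep_upd: "rep t M Q ans \<Longrightarrow> a \<notin> {40, 41, 42, 51, 61} \<Longrightarrow> 40 \<le> a \<Longrightarrow> rep (t(a := f)) M Q ans"
  by (simp add: rep_def agree_upd qlist_def)

lemma rep_frame:
  assumes "rep s M Q ans" "\<And>a. a < 40 \<or> a \<in> {40, 41, 42, 51, 61} \<Longrightarrow> t a = s a"
  shows "rep t M Q ans"
proof -
  have "agree s" using assms(1) by (simp add: rep_def)
  then have "agree t" by (rule agree_frame) (rule assms(2), simp)
  moreover have "t 40 = s 40" "t 41 = s 41" "t 42 = s 42" "t 51 = s 51" "t 61 = s 61"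
    by (rule assms(2), simp)+
  ultimately show ?thesis using assms(1) by (simp add: rep_def qlist_def)
qed

lemma enum_rep:
  assumes s: "rep s M Q ans" and p: "p = (s 52 0, s 53 0)"
  shows "exec enum_prog s (s0 21 (fst p) * (s0 31 (snd p) * 80 + 40) + 40)
    (\<lambda>t. rep t M Q ans \<and> t 56 0 = length (succs p) \<and> qlist t (length Q + length (succs p)) = Q @ succs p)"
proof -
  have "agree s" using s by (simp add: rep_def)
  from enum_spec[OF this p refl] show ?thesis
  proof (rule exec_frame)
  fix t assume t: "t 56 0 = length (succs p) \<and> qlist t (s 51 0 + length (succs p)) = qlist s (s 51 0) @ succs p"
    "\<And>a. a \<notin> writes enum_prog \<Longrightarrow> t a = s a"
  have ag: "agree t"
    by (rule agree_frame[of s]) (use s t(2) in \<open>auto simp: rep_def writes_visit\<close>)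
  have q: "qlist t (length Q + length (succs p)) = Q @ succs p" using t(1) s by (simp add: rep_def)
  then have "take (length Q) (qlist t (length Q + length (succs p))) = Q" by simp
  then have "qlist t (length Q) = Q" by (simp add: qlist_def take_map)
  then show "rep t M Q ans \<and> t 56 0 = length (succs p) \<and> qlist t (length Q + length (succs p)) = Q @ succs p"
    using ag q t s by (simp add: rep_def writes_visit)
  qed simp
qed

lemma mark_rep:
  assumes s: "rep s M Q ans" and p: "p = (s 52 0, s 53 0)" "fst p < N0" "snd p < N0"
    and q: "s 56 0 = length l" "qlist s (length Q + length l) = Q @ l"
    and rep': "rep' = (\<lambda>t. rep t (insert p M) (if p \<in> M then Q else Q @ l) ans)"
  shows "exec mark_prog s 30 rep'"
proof -
  have m: "s 20 (fst p) = fst p * N0" "s 53 0 = snd p" "s 52 0 = fst p"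
    using s p mul by (auto simp: rep_def agreeD)
  have M: "M \<subseteq> {..<N0} \<times> {..<N0}" "s 40 = marks M" using s by (auto simp: rep_def)
  have iff: "0 < marks M (fst p * N0 + snd p) \<longleftrightarrow> p \<in> M"
    using marks_iff[OF M(1) p(3), of "fst p"] by simp
  have ins: "(s 40)(fst p * N0 + snd p := Suc 0) = marks (insert p M)"
    using marks_insert[of M "fst p" "snd p"] M(2) by simp
  have len: "s 51 0 = length Q" using s by (simp add: rep_def)
  have "effect mark_prog s =
      (if p \<in> M then s else s(40 := marks (insert p M), 51 := (s 51)(0 := length Q + length l)))"
    using iff unfolding M(2)[symmetric] by (simp add: mark_prog_def m ins len q(1))
  moreover have "rep' (s(40 := marks (insert p M), 51 := (s 51)(0 := length Q + length l)))" if "p \<notin> M"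
    using s q(2) M(1) p(2,3) that unfolding rep' rep_def
    by (auto simp: agree_upd qlist_def mem_Times_iff)
  moreover have "rep' s" if "p \<in> M" using s that unfolding rep' by (simp add: insert_absorb)
  ultimately have "rep' (effect mark_prog s)" by simp
  then show ?thesis by (rule exec_loop_free[rotated]) (simp_all add: mark_prog_def)
qed

lemma visit_rep:
  assumes s: "rep s M Q ans" and p: "p = (s 52 0, s 53 0)" "fst p < N0" "snd p < N0"
  shows "exec visit_prog s (s0 21 (fst p) * (s0 31 (snd p) * 80 + 40) + 70)
    (\<lambda>t. rep t (insert p M) (if p \<in> M then Q else Q @ succs p) ans)"
proof -
  have "exec visit_prog s (s0 21 (fst p) * (s0 31 (snd p) * 80 + 40) + 40 + 30)
    (\<lambda>t. rep t (insert p M) (if p \<in> M then Q else Q @ succs p) ans)"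
    unfolding visit_prog_def
  proof (rule exec_Seq[OF enum_rep[OF s p(1)]])
    fix t assume t: "rep t M Q ans \<and> t 56 0 = length (succs p) \<and> qlist t (length Q + length (succs p)) = Q @ succs p"
      "\<And>a. a \<notin> writes enum_prog \<Longrightarrow> t a = s a"
    show "exec mark_prog t 30 (\<lambda>t. rep t (insert p M) (if p \<in> M then Q else Q @ succs p) ans)"
      by (rule mark_rep[OF _ _ p(2,3) _ _ refl]) (use t p in \<open>simp_all add: writes_visit\<close>)
  qed
  then show ?thesis by (rule exec_le) simp
qed

end

section \<open>Following one trajectory\<close>

definition record_prog :: program where
  "record_prog =
    Seq (Write 43 (Var 54) (Var 52))
    (Seq (Write 44 (Var 54) (Var 53))
    (Seq (IfLess (Const 0) (Read 3 (Var 52)) (IfLess (Const 0) (Read 10 (Var 53)) (Assign 61 (Const 1)) Skip) Skip)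
    (Seq (Assign 71 (Const 0))
      (IfLess (Const 1) (Read 21 (Var 52)) (IfLess (Const 1) (Read 31 (Var 53)) (Assign 71 (Const 1)) Skip) Skip))))"

text \<open>The distance of two numbers by truncated subtraction; it is positive exactly if they
  differ.\<close>

definition differ :: "expr \<Rightarrow> expr \<Rightarrow> expr" where
  "differ x y = Plus (Minus x y) (Minus y x)"

text \<open>Comparing with the pair at time \<open>B\<close> alone takes constant time. This test
  comes second, so that a return exactly at time \<open>4 * B\<close> is not taken for a long
  trajectory.\<close>

definition check_prog :: program where
  "check_prog =
    Seq (IfLess (Var 54) (Var 28) Skip (Seq (Assign 55 (Const 0)) (Assign 62 (Const 1))))
      (IfLess (Var 27) (Var 54)
        (IfLess (Const 0) (Plus (differ (Var 52) (Read 43 (Var 27))) (differ (Var 53) (Read 44 (Var 27)))) Skip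
          (Seq (Assign 55 (Const 0)) (Assign 62 (Const 0)))) Skip)"

definition advance_prog :: program where
  "advance_prog =
    IfLess (Const 0) (Var 56)
      (Seq (Assign 52 (Read 41 (Var 51)))
      (Seq (Assign 53 (Read 42 (Var 51)))
      (Seq (Assign 54 (Plus (Var 54) (Const 1))) check_prog)))
      (Assign 55 (Const 0))"

definition traj_body :: program where
  "traj_body = Seq record_prog (Seq enum_prog
    (IfLess (Const 0) (Var 71) (Seq mark_prog (Assign 55 (Const 0))) advance_prog))"

lemma writes_traj: "writes record_prog = {43, 44, 61, 71}" "writes advance_prog = {52, 53, 54, 55, 62}"
  "writes traj_body = {43, 44, 61, 71, 52, 53, 54, 55, 62, 56, 57, 58, 59, 60, 41, 42, 40, 51}"
  by (auto simp: record_prog_def check_prog_def advance_prog_def traj_body_def writes_visit)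

locale machine = tables +
  fixes c B :: nat
  assumes degree: "x < N0 \<Longrightarrow> s0 21 x \<le> c" "y < N0 \<Longrightarrow> s0 31 y \<le> c"
    and heads: "s0 5 e < N0" "s0 12 f < N0"
    and params: "s0 27 0 = B" "s0 28 0 = 4 * B" "s0 29 0 = 3 * B" "0 < B"
begin

definition dfork :: "nat \<times> nat \<Rightarrow> bool" where
  "dfork p \<longleftrightarrow> 1 < s0 21 (fst p) \<and> 1 < s0 31 (snd p)"

definition final :: "nat \<times> nat \<Rightarrow> bool" where
  "final p \<longleftrightarrow> 0 < s0 3 (fst p) \<and> 0 < s0 10 (snd p)"

text \<open>At a dead end \<open>hd\<close> is unspecified; \<open>alive\<close> restricts attention
  to the times up to there.\<close>

primrec orbit :: "nat \<times> nat \<Rightarrow> nat \<Rightarrow> nat \<times> nat" where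
  "orbit a 0 = a"
| "orbit a (Suc k) = hd (succs (orbit a k))"

definition alive :: "nat \<times> nat \<Rightarrow> nat \<Rightarrow> bool" where
  "alive a k \<longleftrightarrow> (\<forall>i<k. \<not> dfork (orbit a i) \<and> succs (orbit a i) \<noteq> [])"

definition valid :: "nat \<times> nat \<Rightarrow> bool" where
  "valid p \<longleftrightarrow> fst p < N0 \<and> snd p < N0"

lemma succs_valid: "q \<in> set (succs p) \<Longrightarrow> valid q"
  using heads by (auto simp: succs_def row_def valid_def Let_def split: if_splits)

lemma orbit_valid: "valid a \<Longrightarrow> alive a k \<Longrightarrow> valid (orbit a k)"
  by (cases k) (auto simp: alive_def intro: succs_valid[OF hd_in_set])

definition found :: "nat \<times> nat \<Rightarrow> bool \<Rightarrow> nat \<Rightarrow> bool" where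
  "found a ans k \<longleftrightarrow> ans \<or> (\<exists>i<k. final (orbit a i))"

lemma found_Suc: "found a ans (Suc k) \<longleftrightarrow> found a ans k \<or> final (orbit a k)"
  by (auto simp: found_def less_Suc_eq)

text \<open>Since each pair of the orbit determines the next, a repetition among the first
  \<open>B\<close> pairs would bring back the pair at time \<open>B\<close> before
  \<open>2 * B\<close>. So for \<open>k = 4 * B\<close> the first \<open>B\<close> pairs are
  distinct, as \<open>long_trajectory\<close> requires.\<close>

definition fresh :: "nat \<times> nat \<Rightarrow> nat \<Rightarrow> bool" where
  "fresh a k \<longleftrightarrow> alive a k \<and> (\<forall>i. B < i \<longrightarrow> i \<le> k \<longrightarrow> orbit a i \<noteq> orbit a B)"

definition history :: "nat \<times> nat \<Rightarrow> nat \<Rightarrow> memory \<Rightarrow> bool" where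
  "history a k t \<longleftrightarrow> (\<forall>i<k. (t 43 i, t 44 i) = orbit a i)"

definition running :: "nat \<times> nat \<Rightarrow> (nat \<times> nat) set \<Rightarrow> (nat \<times> nat) list \<Rightarrow> bool \<Rightarrow> nat \<Rightarrow> memory \<Rightarrow> bool" where
  "running a M Q ans k t \<longleftrightarrow> rep t M Q (found a ans k) \<and> t 54 0 = k \<and> (t 52 0, t 53 0) = orbit a k \<and>
     t 55 0 = 1 \<and> t 62 0 = 0 \<and> history a k t \<and> fresh a k \<and> k < 4 * B"

text \<open>The cases are a pair where both components branch, a dead end, a return to the pair at
  time \<open>B\<close>, and length \<open>4 * B\<close>; only the last raises flag 62 and calls for
  an analysis of the periods.\<close>

definition stopped :: "nat \<times> nat \<Rightarrow> (nat \<times> nat) set \<Rightarrow> (nat \<times> nat) list \<Rightarrow> bool \<Rightarrow> memory \<Rightarrow> bool" where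
  "stopped a M Q ans t \<longleftrightarrow> t 55 0 = 0 \<and> (\<exists>k. fresh a k \<and>
     (dfork (orbit a k) \<and> t 62 0 = 0 \<and>
        rep t (insert (orbit a k) M) (if orbit a k \<in> M then Q else Q @ succs (orbit a k)) (found a ans (Suc k)) \<or>
      \<not> dfork (orbit a k) \<and> succs (orbit a k) = [] \<and> t 62 0 = 0 \<and> rep t M Q (found a ans (Suc k)) \<or>
      alive a (Suc k) \<and> B < Suc k \<and> orbit a (Suc k) = orbit a B \<and> t 62 0 = 0 \<and> rep t M Q (found a ans (Suc k)) \<or>
      fresh a (Suc k) \<and> Suc k = 4 * B \<and> t 62 0 = 1 \<and> rep t M Q (found a ans (Suc k)) \<and> history a (4 * B) t))"

lemma stopped_dfork: "\<lbrakk>t 55 0 = 0; t 62 0 = 0; fresh a k; dfork (orbit a k);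
    rep t (insert (orbit a k) M) (if orbit a k \<in> M then Q else Q @ succs (orbit a k)) (found a ans (Suc k))\<rbrakk> \<Longrightarrow> stopped a M Q ans t"
  unfolding stopped_def by blast

lemma stopped_dead: "\<lbrakk>t 55 0 = 0; t 62 0 = 0; fresh a k; \<not> dfork (orbit a k); succs (orbit a k) = [];
    rep t M Q (found a ans (Suc k))\<rbrakk> \<Longrightarrow> stopped a M Q ans t"
  unfolding stopped_def by blast

lemma stopped_repeat: "\<lbrakk>t 55 0 = 0; t 62 0 = 0; fresh a k; alive a (Suc k); B < Suc k; orbit a (Suc k) = orbit a B;
    rep t M Q (found a ans (Suc k))\<rbrakk> \<Longrightarrow> stopped a M Q ans t"
  unfolding stopped_def by blast

lemma stopped_long: "\<lbrakk>t 55 0 = 0; t 62 0 = 1; fresh a k; fresh a (Suc k); Suc k = 4 * B; history a (4 * B) t;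
    rep t M Q (found a ans (Suc k))\<rbrakk> \<Longrightarrow> stopped a M Q ans t"
  unfolding stopped_def by blast

definition step_time :: nat where "step_time = c * (c * 80 + 40) + 300"

lemma traj_step:
  assumes s: "running a M Q ans k s" and a: "valid a"
  shows "exec traj_body s step_time (\<lambda>t. running a M Q ans (Suc k) t \<or> stopped a M Q ans t)"
proof -
  define p where "p = orbit a k"
  have p: "p = (s 52 0, s 53 0)" and k: "s 54 0 = k" "k < 4 * B" and R: "rep s M Q (found a ans k)"
    and run: "s 55 0 = 1" "s 62 0 = 0" and hist: "history a k s" and fr: "fresh a k"
    using s by (auto simp: running_def p_def)
  have al: "alive a k" using fr by (simp add: fresh_def)
  have pv: "fst p < N0" "snd p < N0" using orbit_valid[OF a al] by (auto simp: valid_def p_def)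
  have ag: "agree s" using R by (simp add: rep_def)
  have st: "s 3 = s0 3" "s 10 = s0 10" "s 21 = s0 21" "s 31 = s0 31" by (simp_all add: agreeD[OF ag])
  have p': "s 52 0 = fst p" "s 53 0 = snd p" using p by simp_all
  define s1 where "s1 = effect record_prog s"
  have s1_61: "s1 61 0 = (if found a ans (Suc k) then 1 else 0)"
    using R by (simp add: s1_def record_prog_def rep_def found_Suc final_def p' st p_def[symmetric])
  have s1_71: "s1 71 0 = (if dfork p then 1 else 0)"
    by (simp add: s1_def record_prog_def dfork_def p' st)
  have s1_h: "s1 43 = (s 43)(k := fst p)" "s1 44 = (s 44)(k := snd p)"
    using k by (simp_all add: s1_def record_prog_def p')
  have s1_same: "s1 b = s b" if "b \<notin> {43, 44, 61, 71}" for b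
    using that by (simp add: s1_def record_prog_def)
  have R1: "rep s1 M Q (found a ans (Suc k))"
  proof -
    have "agree s1" by (rule agree_frame[OF ag]) (simp add: s1_same)
    then show ?thesis using R s1_61 by (simp add: rep_def s1_same qlist_def)
  qed
  have hist1: "history a (Suc k) s1"
    using hist by (auto simp: history_def s1_h p_def[symmetric] less_Suc_eq)
  have e1: "exec record_prog s 60 (\<lambda>t. t = s1)"
    by (rule exec_loop_free) (simp_all add: s1_def record_prog_def)
  have p1: "p = (s1 52 0, s1 53 0)" using p by (simp add: s1_same)
  define tail where "tail = IfLess (Const 0) (Var 71) (Seq mark_prog (Assign 55 (Const 0))) advance_prog"
  let ?post = "\<lambda>t. running a M Q ans (Suc k) t \<or> stopped a M Q ans t"
  have e3: "exec tail t 100 ?post"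
    if t: "rep t M Q (found a ans (Suc k))" "t 56 0 = length (succs p)" "qlist t (length Q + length (succs p)) = Q @ succs p"
      and same: "\<And>b. b \<notin> writes enum_prog \<Longrightarrow> t b = s1 b" for t
  proof -
    have agt: "agree t" using t(1) by (simp add: rep_def)
    have t_eqs: "t 71 0 = (if dfork p then 1 else 0)" "t 54 0 = k" "t 55 0 = 1" "t 62 0 = 0" "t 27 0 = B" "t 28 0 = 4 * B"
      "t 51 0 = length Q" "t 43 = s1 43" "t 44 = s1 44"
      using same[of 71] same[of 54] same[of 55] same[of 62] same[of 43] same[of 44] s1_71 k run params t(1)
      by (simp_all add: writes_visit s1_same agreeD[OF agt] rep_def)
    have ht: "history a (Suc k) t" using hist1 by (simp add: history_def t_eqs)
    have pt: "p = (t 52 0, t 53 0)" using p1 same[of 52] same[of 53] by (simp add: writes_visit)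
    show ?thesis
    proof (cases "dfork p")
      case True
      have "exec (Seq mark_prog (Assign 55 (Const 0))) t (30 + 5) ?post"
      proof (rule exec_Seq[OF mark_rep[OF t(1) pt pv t(2,3) refl]])
        fix u assume u: "rep u (insert p M) (if p \<in> M then Q else Q @ succs p) (found a ans (Suc k))"
          "\<And>b. b \<notin> writes mark_prog \<Longrightarrow> u b = t b"
        have "stopped a M Q ans (u(55 := (u 55)(0 := 0)))"
        proof (rule stopped_dfork[OF _ _ fr])
          show "rep (u(55 := (u 55)(0 := 0))) (insert (orbit a k) M)
              (if orbit a k \<in> M then Q else Q @ succs (orbit a k)) (found a ans (Suc k))"
            using u(1) unfolding p_def by (rule rep_upd) simp_all
        qed (use True u(2)[of 62] t_eqs(4) in \<open>simp_all add: writes_visit p_def[symmetric]\<close>)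
        then show "exec (Assign 55 (Const 0)) u 5 ?post" by (intro exec_loop_free) simp_all
      qed
      then show ?thesis unfolding tail_def
        by (intro exec_le[OF exec_IfLess[where T = 35 and U = 35]]) (simp_all add: t_eqs True)
    next
      case False
      have "?post (effect advance_prog t)"
      proof (cases "succs p")
        case Nil
        then have eff: "effect advance_prog t = t(55 := (t 55)(0 := 0))"
          using t(2) by (simp add: advance_prog_def)
        have "stopped a M Q ans (t(55 := (t 55)(0 := 0)))"
        proof (rule stopped_dead[OF _ _ fr])
          show "rep (t(55 := (t 55)(0 := 0))) M Q (found a ans (Suc k))"
            using t(1) by (rule rep_upd) simp_all
        qed (use False Nil t_eqs(4) in \<open>simp_all add: p_def[symmetric]\<close>)
        then show ?thesis unfolding eff by simp
      next
        case (Cons q qs)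
        have q: "(t 41 (length Q), t 42 (length Q)) = q"
        proof -
          have "qlist t (length Q + length (succs p)) ! length Q = (Q @ succs p) ! length Q" using t(3) by (simp only:)
          moreover have "qlist t (length Q + length (succs p)) ! length Q = (t 41 (length Q), t 42 (length Q))"
            unfolding qlist_def using Cons by (subst nth_map_upt) simp_all
          ultimately show ?thesis using Cons by (simp only: nth_append_length)
        qed
        have oq: "orbit a (Suc k) = q" using Cons by (simp add: p_def)
        have al': "alive a (Suc k)" using al False Cons by (auto simp: alive_def less_Suc_eq p_def)
        define u where "u = t(52 := (t 52)(0 := fst q), 53 := (t 53)(0 := snd q), 54 := (t 54)(0 := Suc k))"
        have Ru: "rep u M Q (found a ans (Suc k))" unfolding u_def by (intro rep_upd t(1)) auto
        have u_eqs: "(u 52 0, u 53 0) = q" "u 54 0 = Suc k" "u 55 0 = 1" "u 62 0 = 0" "history a (Suc k) u" "u 27 0 = B" "u 28 0 = 4 * B" "u 43 = t 43" "u 44 = t 44"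
          using t_eqs ht by (auto simp: u_def history_def)
        define rep_B where "rep_B \<longleftrightarrow> B < Suc k \<and> q = orbit a B"
        have hB: "B < Suc k \<Longrightarrow> (t 43 B, t 44 B) = orbit a B" using ht by (auto simp: history_def)
        have eff: "effect advance_prog t = (if rep_B then u(55 := (u 55)(0 := 0), 62 := (u 62)(0 := 0))
            else if Suc k < 4 * B then u else u(55 := (u 55)(0 := 0), 62 := (u 62)(0 := 1)))"
        proof -
          have d: "0 < fst q - t 43 B + (t 43 B - fst q) + (snd q - t 44 B + (t 44 B - snd q)) \<longleftrightarrow> q \<noteq> orbit a B" if "B < Suc k"
            using hB[OF that] by (cases q; cases "orbit a B") auto
          have "t 56 0 > 0" using t(2) Cons by simp
          moreover have "t 41 (length Q) = fst q" "t 42 (length Q) = snd q" using q by auto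
          ultimately have "effect advance_prog t = effect check_prog u"
            by (simp add: advance_prog_def u_def t_eqs(2,7))
          also have "\<dots> = (if rep_B then u(55 := (u 55)(0 := 0), 62 := (u 62)(0 := 0))
            else if Suc k < 4 * B then u else u(55 := (u 55)(0 := 0), 62 := (u 62)(0 := 1)))"
          proof -
            have v: "u 52 0 = fst q" "u 53 0 = snd q" using u_eqs(1) by auto
            have le: "Suc k < 4 * B \<or> B < Suc k" using params(4) by linarith
            show ?thesis
            proof (cases "B < Suc k")
              case True
              then show ?thesis using d[OF True] u_eqs(3)
                by (auto simp: check_prog_def differ_def rep_B_def v u_eqs(2,6-) fun_upd_idem fun_upd_twist)
            next
              case False
              then show ?thesis using le by (simp add: check_prog_def rep_B_def u_eqs(2,6-))
            qed
          qed
          finally show ?thesis .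
        qed
        have fr': "fresh a (Suc k)" if "\<not> rep_B"
          using fr al' that oq by (auto simp: fresh_def rep_B_def le_Suc_eq)
        show ?thesis
        proof (cases rep_B)
          case True
          then have eff: "effect advance_prog t = u(55 := (u 55)(0 := 0), 62 := (u 62)(0 := 0))" using eff by simp
          have "rep (u(55 := (u 55)(0 := 0), 62 := (u 62)(0 := 0))) M Q (found a ans (Suc k))"
            by (intro rep_upd Ru) auto
          then have "stopped a M Q ans (u(55 := (u 55)(0 := 0), 62 := (u 62)(0 := 0)))"
            by (rule stopped_repeat[OF _ _ fr al', rotated -1]) (use True oq in \<open>simp_all add: rep_B_def\<close>)
          then show ?thesis unfolding eff by simp
        next
          case nr: False
          show ?thesis
          proof (cases "Suc k < 4 * B")
            case True
            then have "running a M Q ans (Suc k) u"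
              unfolding running_def using Ru u_eqs fr'[OF nr] oq by simp
            then show ?thesis using eff nr True by simp
          next
            case last: False
            then have last': "Suc k = 4 * B" using k by simp
            have eff: "effect advance_prog t = u(55 := (u 55)(0 := 0), 62 := (u 62)(0 := 1))" using eff nr last by simp
            have "rep (u(55 := (u 55)(0 := 0), 62 := (u 62)(0 := 1))) M Q (found a ans (Suc k))"
              by (intro rep_upd Ru) auto
            moreover have "history a (4 * B) (u(55 := (u 55)(0 := 0), 62 := (u 62)(0 := 1)))"
              using u_eqs last' by (simp add: history_def)
            ultimately have "stopped a M Q ans (u(55 := (u 55)(0 := 0), 62 := (u 62)(0 := 1)))"
              by (intro stopped_long[OF _ _ fr fr'[OF nr] last']) simp_all
            then show ?thesis unfolding eff by simp
          qed
        qed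
      qed
      then have "exec advance_prog t 90 ?post"
        by (rule exec_loop_free[rotated]) (simp_all add: advance_prog_def check_prog_def differ_def)
      then show ?thesis unfolding tail_def
        by (intro exec_le[OF exec_IfLess[where T = 90 and U = 90]]) (simp_all add: t_eqs False)
    qed
  qed
  have "exec traj_body s (60 + (s0 21 (fst p) * (s0 31 (snd p) * 80 + 40) + 40 + 100)) ?post"
    unfolding traj_body_def tail_def[symmetric]
  proof (rule exec_Seq[OF e1])
    fix t assume "t = s1"
    have "exec (Seq enum_prog tail) s1 (s0 21 (fst p) * (s0 31 (snd p) * 80 + 40) + 40 + 100) ?post"
    proof (rule exec_Seq[OF enum_rep[OF R1 p1]])
      fix u assume u: "rep u M Q (found a ans (Suc k)) \<and> u 56 0 = length (succs p) \<and>
          qlist u (length Q + length (succs p)) = Q @ succs p" "\<And>b. b \<notin> writes enum_prog \<Longrightarrow> u b = s1 b"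
      then show "exec tail u 100 ?post" by (intro e3) auto
    qed
    then show "exec (Seq enum_prog tail) t (s0 21 (fst p) * (s0 31 (snd p) * 80 + 40) + 40 + 100) ?post"
      using \<open>t = s1\<close> by simp
  qed
  then show ?thesis
  proof (rule exec_le)
    have "s0 21 (fst p) * (s0 31 (snd p) * 80 + 40) \<le> c * (c * 80 + 40)"
      using degree pv by (intro mult_le_mono add_mono) auto
    then show "60 + (s0 21 (fst p) * (s0 31 (snd p) * 80 + 40) + 40 + 100) \<le> step_time"
      by (simp add: step_time_def)
  qed
qed

lemma traj_spec:
  assumes s: "running a M Q ans 0 s" and a: "valid a"
  shows "exec (WhileLess (Const 0) (Var 55) traj_body) s (4 * B * (step_time + 4) + 4) (stopped a M Q ans)"
proof -
  let ?I = "\<lambda>t. (\<exists>k. running a M Q ans k t) \<or> stopped a M Q ans t"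
  have "exec (WhileLess (Const 0) (Var 55) traj_body) s
    (4 * B * (step_time + expr_steps (Const 0) + expr_steps (Var 55) + 1) + (expr_steps (Const 0) + expr_steps (Var 55) + 1))
    (\<lambda>t. ?I t \<and> \<not> expr_val (Const 0) t < expr_val (Var 55) t)"
  \<comment> \<open>\<open>stopped\<close> says nothing about the time in cell 54, so the measure is
    set to 0 once flag 55 is cleared.\<close>
  proof (rule exec_WhileLess[where \<mu> = "\<lambda>t. if t 55 0 = 0 then 0 else 4 * B - t 54 0"])
    fix t assume t: "?I t" "expr_val (Const 0) t < expr_val (Var 55) t"
    from t(2) have "\<not> stopped a M Q ans t" unfolding stopped_def by simp
    with t(1) obtain k where k: "running a M Q ans k t" by blast
    have kk: "t 55 0 = 1" "t 54 0 = k" "k < 4 * B" using k unfolding running_def by blast+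
    show "exec traj_body t step_time
      (\<lambda>t'. ?I t' \<and> (if t' 55 0 = 0 then 0 else 4 * B - t' 54 0) < (if t 55 0 = 0 then 0 else 4 * B - t 54 0))"
    proof (rule exec_weaken[OF traj_step[OF k a]])
      fix u assume "running a M Q ans (Suc k) u \<or> stopped a M Q ans u"
      then show "?I u \<and> (if u 55 0 = 0 then 0 else 4 * B - u 54 0) < (if t 55 0 = 0 then 0 else 4 * B - t 54 0)"
      proof
        assume r: "running a M Q ans (Suc k) u"
        then have "u 54 0 = Suc k" unfolding running_def by blast
        with r kk show ?thesis by auto
      next
        assume r: "stopped a M Q ans u"
        then have "u 55 0 = 0" unfolding stopped_def by blast
        with r kk show ?thesis by simp
      qed
    qed simp
  next
    show "?I s" using s by blast
    show "(if s 55 0 = 0 then 0 else 4 * B - s 54 0) \<le> 4 * B" by simp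
  qed
  then show ?thesis
  proof (rule exec_weaken)
    fix t assume t: "?I t \<and> \<not> expr_val (Const 0) t < expr_val (Var 55) t"
    then have "t 55 0 = 0" by simp
    then have "\<not> running a M Q ans k t" for k unfolding running_def by simp
    with t show "stopped a M Q ans t" by blast
  qed (simp add: algebra_simps)
qed

end

section \<open>Periodic trajectories\<close>

text \<open>Times are shifted by one, so that 0 means that the point has not been visited.\<close>

primrec last_visit :: "(nat \<Rightarrow> nat) \<Rightarrow> nat \<Rightarrow> nat \<Rightarrow> nat" where
  "last_visit v 0 = (\<lambda>x. 0)"
| "last_visit v (Suc i) = (last_visit v i)(v i := Suc i)"

text \<open>
  The longest time between successive visits to the same point. It is the period of a periodic
  sequence that visits some point only once per period.
\<close>

primrec max_gap :: "(nat \<Rightarrow> nat) \<Rightarrow> nat \<Rightarrow> nat" where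
  "max_gap v 0 = 0"
| "max_gap v (Suc i) = (if 0 < last_visit v i (v i) then max (max_gap v i) (Suc i - last_visit v i (v i)) else max_gap v i)"

lemma last_visit_pos:
  "0 < last_visit v i x \<Longrightarrow> last_visit v i x \<le> i \<and> v (last_visit v i x - 1) = x \<and> (\<forall>j. last_visit v i x \<le> j \<longrightarrow> j < i \<longrightarrow> v j \<noteq> x)"
  by (induction i) (auto simp: less_Suc_eq split: if_splits)

lemma last_visit_ge: "j < i \<Longrightarrow> v j = x \<Longrightarrow> Suc j \<le> last_visit v i x"
  by (induction i) (auto simp: less_Suc_eq)

lemma max_gap_le: "max_gap v i \<le> i"
  by (induction i) auto

lemma max_gap_mono: "i \<le> j \<Longrightarrow> max_gap v i \<le> max_gap v j"
  by (induction j) (auto simp: le_Suc_eq)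

text \<open>By periodicity no gap exceeds \<open>z\<close>, and the point \<open>v k\<close>, absent
  strictly between \<open>k\<close> and \<open>k + z\<close>, has a gap of exactly
  \<open>z\<close>.\<close>

lemma max_gap_eq:
  assumes per: "\<And>i. i + z < N \<Longrightarrow> v (i + z) = v i" and z: "0 < z"
    and k: "k + z < N" "\<And>k'. k < k' \<Longrightarrow> k' < k + z \<Longrightarrow> v k' \<noteq> v k"
  shows "max_gap v N = z"
proof -
  have "max_gap v n \<le> z" if "n \<le> N" for n
    using that
  proof (induction n)
    case (Suc i)
    have "Suc i - last_visit v i (v i) \<le> z" if pos: "0 < last_visit v i (v i)"
    proof (cases "z \<le> i")
      case True
      have "v (i - z + z) = v (i - z)" using Suc.prems True by (intro per) simp
      then have "v (i - z) = v i" using True by simp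
      then have "Suc (i - z) \<le> last_visit v i (v i)" using z True by (intro last_visit_ge) simp_all
      then show ?thesis by linarith
    next
      case False
      then show ?thesis by simp
    qed
    then show ?case using Suc by simp
  qed simp
  then have le: "max_gap v N \<le> z" by simp
  have vk: "v (k + z) = v k" using per k(1) by simp
  have lk: "Suc k \<le> last_visit v (k + z) (v k)" using z by (intro last_visit_ge) simp_all
  have "last_visit v (k + z) (v k) \<le> Suc k"
  proof (rule ccontr)
    assume "\<not> ?thesis"
    then have "v (last_visit v (k + z) (v k) - 1) \<noteq> v k"
      using last_visit_pos[of v "k + z" "v k"] by (intro k(2)) auto
    then show False using last_visit_pos[of v "k + z" "v k"] lk by simp
  qed
  with lk have "last_visit v (k + z) (v (k + z)) = Suc k" by (simp add: vk)
  then have "z \<le> max_gap v (Suc (k + z))" by simp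
  also have "\<dots> \<le> max_gap v N" using k(1) by (intro max_gap_mono) simp
  finally show ?thesis using le by simp
qed

definition gap_body :: "nat \<Rightarrow> nat \<Rightarrow> nat \<Rightarrow> program" where
  "gap_body h pr g = Seq (Assign 72 (Read h (Plus (Var 27) (Var 57))))
    (Seq (IfLess (Const 0) (Read pr (Var 72))
        (IfLess (Var g) (Minus (Plus (Var 57) (Const 1)) (Read pr (Var 72)))
          (Assign g (Minus (Plus (Var 57) (Const 1)) (Read pr (Var 72)))) Skip) Skip)
      (Write pr (Var 72) (Plus (Var 57) (Const 1))))"

text \<open>The first loop clears only the cells that the second one uses, so that the time depends
  on the length of the sequence and not on the number of vertices.\<close>

definition gap_prog :: "nat \<Rightarrow> nat \<Rightarrow> nat \<Rightarrow> program" where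
  "gap_prog h pr g =
    Seq (For 57 (Var 29) (Write pr (Read h (Plus (Var 27) (Var 57))) (Const 0)))
    (Seq (Assign g (Const 0)) (For 57 (Var 29) (gap_body h pr g)))"

text \<open>Euclid's algorithm by subtraction. Every round lowers the sum of the two numbers, hence
  the time is linear in the periods.\<close>

definition gcd_prog :: program where
  "gcd_prog = Seq (Assign 65 (Var 63)) (Seq (Assign 66 (Var 64))
    (WhileLess (Const 0) (differ (Var 65) (Var 66))
      (IfLess (Var 65) (Var 66) (Assign 66 (Minus (Var 66) (Var 65))) (Assign 65 (Minus (Var 65) (Var 66))))))"

definition next_prog :: program where
  "next_prog = Seq (Assign 67 (Plus (Var 67) (Const 1))) (IfLess (Var 67) (Var 65) Skip (Assign 67 (Const 0)))"

text \<open>Ticking residues in array 47 decides with one pass over each sequence whether a position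
  with property \<open>x\<close> and one with property \<open>y\<close> share a residue. The residue
  of the loop counter is kept in 67 by \<open>next_prog\<close>, without division.\<close>

definition scan_prog :: "expr \<Rightarrow> expr \<Rightarrow> program" where
  "scan_prog x y =
    Seq (For 57 (Var 65) (Write 47 (Var 57) (Const 0)))
    (Seq (Assign 67 (Const 0))
    (Seq (For 57 (Var 63) (Seq (IfLess (Const 0) x (Write 47 (Var 67) (Const 1)) Skip) next_prog))
    (Seq (Assign 68 (Const 0))
    (Seq (Assign 67 (Const 0))
      (For 57 (Var 64) (Seq (IfLess (Const 0) y (IfLess (Const 0) (Read 47 (Var 67)) (Assign 68 (Const 1)) Skip) Skip) next_prog))))))"

lemma writes_scan: "writes (gap_body h pr g) = {72, g, pr}" "writes (gap_prog h pr g) = {57, 72, g, pr}"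
  "writes gcd_prog = {65, 66}" "writes next_prog = {67}" "writes (scan_prog x y) = {57, 47, 67, 68}"
  by (auto simp: gap_body_def gap_prog_def gcd_prog_def next_prog_def scan_prog_def)

lemma gap_spec:
  assumes d: "distinct [h, pr, g, 27, 29, 57, 72]" and B: "s 27 0 = B" "s 29 0 = n"
  defines "v \<equiv> \<lambda>i. s h (B + i)"
  shows "exec (gap_prog h pr g) s (n * 100 + 40) (\<lambda>t. t g 0 = max_gap v n)"
proof -
  have "exec (For 57 (Var 29) (Write pr (Read h (Plus (Var 27) (Var 57))) (Const 0))) s (n * (10 + expr_steps (Var 29) + 9) + expr_steps (Var 29) + 6)
      (\<lambda>t. (\<forall>j<n. t pr (v j) = 0) \<and> t 57 0 = n)"
  proof (rule exec_For[where I = "\<lambda>i t. \<forall>j<i. t pr (v j) = 0"])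
    fix k :: nat and t :: memory assume t: "k < n" "\<forall>j<k. t pr (v j) = 0" "t 57 0 = k"
      and fr: "\<And>a. a \<notin> insert 57 (writes (Write pr (Read h (Plus (Var 27) (Var 57))) (Const 0))) \<Longrightarrow> t a = s a"
    have "t 27 = s 27" "t h = s h" using d by (intro fr; auto)+
    then show "exec (Write pr (Read h (Plus (Var 27) (Var 57))) (Const 0)) t 10
        (\<lambda>t'. \<forall>j<Suc k. (t'(57 := (t' 57)(0 := Suc k))) pr (v j) = 0)"
      using t d B by (intro exec_loop_free) (auto simp: v_def less_Suc_eq)
  next
    fix k :: nat and t :: memory assume fr: "\<And>a. a \<notin> insert 57 (writes (Write pr (Read h (Plus (Var 27) (Var 57))) (Const 0))) \<Longrightarrow> t a = s a"
    have "t 29 = s 29" using d by (intro fr; auto)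
    then show "expr_val (Var 29) t = n" using B by simp
  qed (use d in auto)
  then have "exec (gap_prog h pr g) s (n * (10 + expr_steps (Var 29) + 9) + expr_steps (Var 29) + 6 +
    (expr_steps (Const 0) + expr_steps (Const 0) + 1 + (n * (50 + expr_steps (Var 29) + 9) + expr_steps (Var 29) + 6)))
      (\<lambda>t. t g 0 = max_gap v n)"
    unfolding gap_prog_def
  proof (rule exec_Seq)
    fix t :: memory assume t: "(\<forall>j<n. t pr (v j) = 0) \<and> t 57 0 = n"
      and fr: "\<And>a. a \<notin> writes (For 57 (Var 29) (Write pr (Read h (Plus (Var 27) (Var 57))) (Const 0))) \<Longrightarrow> t a = s a"
    have same: "t 27 = s 27" "t h = s h" "t 29 = s 29" using d by (intro fr; auto)+
    let ?t = "t(g := (t g)(0 := 0))"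
    have "exec (For 57 (Var 29) (gap_body h pr g)) ?t (n * (50 + expr_steps (Var 29) + 9) + expr_steps (Var 29) + 6)
      (\<lambda>t. ((\<forall>j<n. t pr (v j) = last_visit v n (v j)) \<and> t g 0 = max_gap v n) \<and> t 57 0 = n)"
    proof (rule exec_For[where I = "\<lambda>i t. (\<forall>j<n. t pr (v j) = last_visit v i (v j)) \<and> t g 0 = max_gap v i"])
      fix k :: nat and u :: memory assume u: "k < n" "(\<forall>j<n. u pr (v j) = last_visit v k (v j)) \<and> u g 0 = max_gap v k" "u 57 0 = k"
        and fr': "\<And>a. a \<notin> insert 57 (writes (gap_body h pr g)) \<Longrightarrow> u a = ?t a"
      have "u 27 = s 27" "u h = s h" using d same by (subst fr'; auto simp: writes_scan)+
      then have rd: "u h (u 27 0 + u 57 0) = v k" using u(3) B by (simp add: v_def)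
      have eff: "effect (gap_body h pr g) u = u(72 := (u 72)(0 := v k),
          g := (u g)(0 := max_gap v (Suc k)), pr := (u pr)(v k := Suc k))"
      proof
        fix b
        have idem: "(u g)(0 := max_gap v k) = u g" using u(2) by (simp add: fun_upd_idem_iff)
        show "effect (gap_body h pr g) u b = (u(72 := (u 72)(0 := v k),
          g := (u g)(0 := max_gap v (Suc k)), pr := (u pr)(v k := Suc k))) b"
          using d rd u by (auto simp: gap_body_def max_def idem)
      qed
      show "exec (gap_body h pr g) u 50 (\<lambda>t'. (\<forall>j<n. (t'(57 := (t' 57)(0 := Suc k))) pr (v j) = last_visit v (Suc k) (v j)) \<and>
          (t'(57 := (t' 57)(0 := Suc k))) g 0 = max_gap v (Suc k))"
      proof (rule exec_loop_free)
        show "(\<forall>j<n. ((effect (gap_body h pr g) u)(57 := (effect (gap_body h pr g) u 57)(0 := Suc k))) pr (v j) = last_visit v (Suc k) (v j)) \<and>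
          ((effect (gap_body h pr g) u)(57 := (effect (gap_body h pr g) u 57)(0 := Suc k))) g 0 = max_gap v (Suc k)"
          unfolding eff using d u by (auto simp del: max_gap.simps)
      qed (simp_all add: gap_body_def)
    next
      fix k :: nat and u :: memory assume fr': "\<And>a. a \<notin> insert 57 (writes (gap_body h pr g)) \<Longrightarrow> u a = ?t a"
      have "u 29 = s 29" using d same by (subst fr'; auto simp: writes_scan)
      then show "expr_val (Var 29) u = n" using B by simp
    qed (use d t in \<open>auto simp: writes_scan\<close>)
    then show "exec (Seq (Assign g (Const 0)) (For 57 (Var 29) (gap_body h pr g))) t
      (expr_steps (Const 0) + expr_steps (Const 0) + 1 + (n * (50 + expr_steps (Var 29) + 9) + expr_steps (Var 29) + 6))
      (\<lambda>t. t g 0 = max_gap v n)"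
      by (intro exec_Seq_Write) (auto elim: exec_weaken)
  qed
  then show ?thesis by (rule exec_le) (simp add: algebra_simps)
qed

lemma gcd_spec:
  assumes "0 < s 63 0" "0 < s 64 0"
  shows "exec gcd_prog s ((s 63 0 + s 64 0) * 25 + 30) (\<lambda>t. t 65 0 = gcd (s 63 0) (s 64 0))"
proof -
  let ?I = "\<lambda>t. 0 < t 65 0 \<and> 0 < t 66 0 \<and> gcd (t 65 0) (t 66 0) = gcd (s 63 0) (s 64 0)"
  let ?s = "s(65 := (s 65)(0 := s 63 0), 66 := (s 66)(0 := s 64 0))"
  let ?body = "IfLess (Var 65) (Var 66) (Assign 66 (Minus (Var 66) (Var 65))) (Assign 65 (Minus (Var 65) (Var 66)))"
  have "exec (WhileLess (Const 0) (differ (Var 65) (Var 66)) ?body) ?s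
    ((s 63 0 + s 64 0) * (12 + expr_steps (Const 0) + expr_steps (differ (Var 65) (Var 66)) + 1)
       + (expr_steps (Const 0) + expr_steps (differ (Var 65) (Var 66)) + 1))
    (\<lambda>t. ?I t \<and> \<not> expr_val (Const 0) t < expr_val (differ (Var 65) (Var 66)) t)"
  proof (rule exec_WhileLess[where \<mu> = "\<lambda>t. t 65 0 + t 66 0"])
    fix t :: memory assume t: "?I t" "expr_val (Const 0) t < expr_val (differ (Var 65) (Var 66)) t"
    then have ne: "t 65 0 \<noteq> t 66 0" by (auto simp: differ_def)
    show "exec ?body t 12 (\<lambda>t'. ?I t' \<and> t' 65 0 + t' 66 0 < t 65 0 + t 66 0)"
    proof (rule exec_loop_free)
      show "?I (effect ?body t) \<and> effect ?body t 65 0 + effect ?body t 66 0 < t 65 0 + t 66 0"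
      proof (cases "t 65 0 < t 66 0")
        case True
        then have "gcd (t 65 0) (t 66 0 - t 65 0) = gcd (t 65 0) (t 66 0)"
          using gcd_diff1_nat[of "t 65 0" "t 66 0"] by (simp add: gcd.commute)
        then show ?thesis using t True by simp
      next
        case False
        then have "gcd (t 65 0 - t 66 0) (t 66 0) = gcd (t 65 0) (t 66 0)"
          using gcd_diff1_nat[of "t 66 0" "t 65 0"] by simp
        then show ?thesis using t False ne by simp
      qed
    qed simp_all
  qed (use assms in auto)
  then have "exec gcd_prog s (expr_steps (Const 0) + expr_steps (Var 63) + 1 + (expr_steps (Const 0) + expr_steps (Var 64) + 1 +
    ((s 63 0 + s 64 0) * (12 + expr_steps (Const 0) + expr_steps (differ (Var 65) (Var 66)) + 1)
       + (expr_steps (Const 0) + expr_steps (differ (Var 65) (Var 66)) + 1))))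
    (\<lambda>t. ?I t \<and> \<not> expr_val (Const 0) t < expr_val (differ (Var 65) (Var 66)) t)"
    unfolding gcd_prog_def by (intro exec_Seq_Write) simp
  then show ?thesis
    by (rule exec_weaken) (auto simp: differ_def algebra_simps)
qed

lemma mod_Suc_cases: "0 < g \<Longrightarrow> Suc k mod g = (if Suc (k mod g) < g then Suc (k mod g) else 0)"
  using mod_less_divisor[of g k] by (auto simp: mod_Suc simp del: mod_less_divisor)

lemma effect_next:
  assumes "u 67 0 = k mod g" "u 65 0 = g" "0 < g"
  shows "effect next_prog u = u(67 := (u 67)(0 := Suc k mod g))"
  using assms mod_Suc_cases[of g k] by (simp add: next_prog_def)

lemma scan_spec:
  assumes g: "0 < g" "s 65 0 = g" "s 63 0 = m" "s 64 0 = n"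
    and x: "\<And>u :: memory. (\<And>a. a \<notin> {57, 47, 67, 68} \<Longrightarrow> u a = s a) \<Longrightarrow> 0 < expr_val x u \<longleftrightarrow> P (u 57 0)"
    and y: "\<And>u :: memory. (\<And>a. a \<notin> {57, 47, 67, 68} \<Longrightarrow> u a = s a) \<Longrightarrow> 0 < expr_val y u \<longleftrightarrow> Q (u 57 0)"
    and steps: "expr_steps x \<le> 30" "expr_steps y \<le> 30"
  shows "exec (scan_prog x y) s ((g + m + n) * 80 + 60)
    (\<lambda>t. 0 < t 68 0 \<longleftrightarrow> (\<exists>i<m. \<exists>j<n. P i \<and> Q j \<and> i mod g = j mod g))"
proof -
  let ?B1 = "Write 47 (Var 57) (Const 0)"
  let ?B2 = "Seq (IfLess (Const 0) x (Write 47 (Var 67) (Const 1)) Skip) next_prog"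
  let ?B3 = "Seq (IfLess (Const 0) y (IfLess (Const 0) (Read 47 (Var 67)) (Assign 68 (Const 1)) Skip) Skip) next_prog"
  have 1: "exec (For 57 (Var 65) ?B1) s (g * (10 + expr_steps (Var 65) + 9) + expr_steps (Var 65) + 6)
     (\<lambda>t. (\<forall>r<g. t 47 r = 0) \<and> t 57 0 = g)"
  proof (rule exec_For[where I = "\<lambda>i t. \<forall>r<i. t 47 r = 0"])
    fix k :: nat and t :: memory assume t: "k < g" "\<forall>r<k. t 47 r = 0" "t 57 0 = k"
    then show "exec ?B1 t 10 (\<lambda>t'. \<forall>r<Suc k. (t'(57 := (t' 57)(0 := Suc k))) 47 r = 0)"
      by (intro exec_loop_free) (auto simp: less_Suc_eq)
  next
    fix k :: nat and t :: memory assume fr: "\<And>a. a \<notin> insert 57 (writes ?B1) \<Longrightarrow> t a = s a"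
    show "expr_val (Var 65) t = g" using fr[of 65] g by simp
  qed auto
  have 2: "exec (For 57 (Var 63) ?B2) t (m * (60 + expr_steps (Var 63) + 9) + expr_steps (Var 63) + 6)
     (\<lambda>t. (t 67 0 = m mod g \<and> (\<forall>r<g. 0 < t 47 r \<longleftrightarrow> (\<exists>i<m. P i \<and> i mod g = r))) \<and> t 57 0 = m)"
    if t0: "t 67 0 = 0" "\<forall>r<g. t 47 r = 0" and fr0: "\<And>a. a \<notin> {57, 47, 67, 68} \<Longrightarrow> t a = s a" for t :: memory
  proof (rule exec_For[where I = "\<lambda>k t. t 67 0 = k mod g \<and> (\<forall>r<g. 0 < t 47 r \<longleftrightarrow> (\<exists>i<k. P i \<and> i mod g = r))"])
    fix k :: nat and u :: memory assume u: "k < m" "u 67 0 = k mod g \<and> (\<forall>r<g. 0 < u 47 r \<longleftrightarrow> (\<exists>i<k. P i \<and> i mod g = r))" "u 57 0 = k"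
      and fr: "\<And>a. a \<notin> insert 57 (writes ?B2) \<Longrightarrow> u a = t a"
    have fr': "u a = s a" if "a \<notin> {57, 47, 67, 68}" for a using fr[of a] fr0[of a] that by (simp add: writes_scan)
    have x': "0 < expr_val x u \<longleftrightarrow> P k" using x[OF fr'] u(3) by simp
    have g': "u 65 0 = g" using fr'[of 65] g by simp
    have eff: "effect ?B2 u = (if P k then u(47 := (u 47)(k mod g := 1)) else u)(67 := (u 67)(0 := Suc k mod g))"
      using x' u(2) by (simp add: effect_next[of _ k g] g' g(1))
    show "exec ?B2 u 60 (\<lambda>t'. (t'(57 := (t' 57)(0 := Suc k))) 67 0 = Suc k mod g \<and>
       (\<forall>r<g. 0 < (t'(57 := (t' 57)(0 := Suc k))) 47 r \<longleftrightarrow> (\<exists>i<Suc k. P i \<and> i mod g = r)))"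
    proof (rule exec_loop_free)
      have "(\<exists>i<Suc k. P i \<and> i mod g = r) \<longleftrightarrow> (\<exists>i<k. P i \<and> i mod g = r) \<or> P k \<and> k mod g = r" for r
        unfolding less_Suc_eq by blast
      then show "((effect ?B2 u)(57 := (effect ?B2 u 57)(0 := Suc k))) 67 0 = Suc k mod g \<and>
       (\<forall>r<g. 0 < ((effect ?B2 u)(57 := (effect ?B2 u 57)(0 := Suc k))) 47 r \<longleftrightarrow> (\<exists>i<Suc k. P i \<and> i mod g = r))"
        unfolding eff using u(2) by simp
    qed (use steps in \<open>auto simp: next_prog_def\<close>)
  next
    fix k :: nat and u :: memory assume fr: "\<And>a. a \<notin> insert 57 (writes ?B2) \<Longrightarrow> u a = t a"
    show "expr_val (Var 63) u = m" using fr[of 63] fr0[of 63] g by (simp add: writes_scan)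
  qed (use t0 in \<open>auto simp: writes_scan\<close>)
  have 3: "exec (For 57 (Var 64) ?B3) t (n * (60 + expr_steps (Var 64) + 9) + expr_steps (Var 64) + 6)
     (\<lambda>t. (t 67 0 = n mod g \<and> (0 < t 68 0 \<longleftrightarrow> (\<exists>i<m. \<exists>j<n. P i \<and> Q j \<and> i mod g = j mod g))) \<and> t 57 0 = n)"
    if t0: "t 67 0 = 0" "t 68 0 = 0" "\<forall>r<g. 0 < t 47 r \<longleftrightarrow> (\<exists>i<m. P i \<and> i mod g = r)"
      and fr0: "\<And>a. a \<notin> {57, 47, 67, 68} \<Longrightarrow> t a = s a" for t :: memory
  proof (rule exec_For[where I = "\<lambda>k t. t 67 0 = k mod g \<and> (0 < t 68 0 \<longleftrightarrow> (\<exists>i<m. \<exists>j<k. P i \<and> Q j \<and> i mod g = j mod g))"])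
    fix k :: nat and u :: memory assume u: "k < n" "u 67 0 = k mod g \<and> (0 < u 68 0 \<longleftrightarrow> (\<exists>i<m. \<exists>j<k. P i \<and> Q j \<and> i mod g = j mod g))" "u 57 0 = k"
      and fr: "\<And>a. a \<notin> insert 57 (writes ?B3) \<Longrightarrow> u a = t a"
    have fr': "u a = s a" if "a \<notin> {57, 47, 67, 68}" for a using fr[of a] fr0[of a] that by (simp add: writes_scan)
    have y': "0 < expr_val y u \<longleftrightarrow> Q k" using y[OF fr'] u(3) by simp
    have g': "u 65 0 = g" using fr'[of 65] g by simp
    have st: "0 < u 47 (k mod g) \<longleftrightarrow> (\<exists>i<m. P i \<and> i mod g = k mod g)"
      using fr[of 47] t0(3) g(1) by (simp add: writes_scan)
    define hit where "hit \<longleftrightarrow> Q k \<and> (\<exists>i<m. P i \<and> i mod g = k mod g)"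
    have eff: "effect ?B3 u = (if hit then u(68 := (u 68)(0 := 1)) else u)(67 := (u 67)(0 := Suc k mod g))"
      unfolding hit_def st[symmetric]
      using y' u(2) by (simp add: effect_next[of _ k g] g' g(1))
    show "exec ?B3 u 60 (\<lambda>t'. (t'(57 := (t' 57)(0 := Suc k))) 67 0 = Suc k mod g \<and>
       (0 < (t'(57 := (t' 57)(0 := Suc k))) 68 0 \<longleftrightarrow> (\<exists>i<m. \<exists>j<Suc k. P i \<and> Q j \<and> i mod g = j mod g)))"
    proof (rule exec_loop_free)
      have "(\<exists>i<m. \<exists>j<Suc k. P i \<and> Q j \<and> i mod g = j mod g) \<longleftrightarrow> (\<exists>i<m. \<exists>j<k. P i \<and> Q j \<and> i mod g = j mod g) \<or> hit"
        unfolding hit_def less_Suc_eq by blast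
      then show "((effect ?B3 u)(57 := (effect ?B3 u 57)(0 := Suc k))) 67 0 = Suc k mod g \<and>
       (0 < ((effect ?B3 u)(57 := (effect ?B3 u 57)(0 := Suc k))) 68 0 \<longleftrightarrow> (\<exists>i<m. \<exists>j<Suc k. P i \<and> Q j \<and> i mod g = j mod g))"
        unfolding eff using u(2) by simp
    qed (use steps in \<open>auto simp: next_prog_def\<close>)
  next
    fix k :: nat and u :: memory assume fr: "\<And>a. a \<notin> insert 57 (writes ?B3) \<Longrightarrow> u a = t a"
    show "expr_val (Var 64) u = n" using fr[of 64] fr0[of 64] g by (simp add: writes_scan)
  qed (use t0 in \<open>auto simp: writes_scan\<close>)
  have "exec (scan_prog x y) s (g * (10 + expr_steps (Var 65) + 9) + expr_steps (Var 65) + 6 +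
    (expr_steps (Const 0) + expr_steps (Const 0) + 1 + (m * (60 + expr_steps (Var 63) + 9) + expr_steps (Var 63) + 6 +
    (expr_steps (Const 0) + expr_steps (Const 0) + 1 + (expr_steps (Const 0) + expr_steps (Const 0) + 1 +
      (n * (60 + expr_steps (Var 64) + 9) + expr_steps (Var 64) + 6))))))
    (\<lambda>t. (t 67 0 = n mod g \<and> (0 < t 68 0 \<longleftrightarrow> (\<exists>i<m. \<exists>j<n. P i \<and> Q j \<and> i mod g = j mod g))) \<and> t 57 0 = n)"
    unfolding scan_prog_def
  proof (rule exec_Seq[OF 1])
    fix t :: memory assume t: "(\<forall>r<g. t 47 r = 0) \<and> t 57 0 = g" "\<And>a. a \<notin> writes (For 57 (Var 65) ?B1) \<Longrightarrow> t a = s a"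
    let ?t = "t(67 := (t 67)(0 := 0))"
    have "exec (For 57 (Var 63) ?B2) ?t (m * (60 + expr_steps (Var 63) + 9) + expr_steps (Var 63) + 6)
     (\<lambda>t. (t 67 0 = m mod g \<and> (\<forall>r<g. 0 < t 47 r \<longleftrightarrow> (\<exists>i<m. P i \<and> i mod g = r))) \<and> t 57 0 = m)"
      by (rule 2) (use t in auto)
    then have "exec (Seq (For 57 (Var 63) ?B2) (Seq (Assign 68 (Const 0)) (Seq (Assign 67 (Const 0)) (For 57 (Var 64) ?B3)))) ?t
      (m * (60 + expr_steps (Var 63) + 9) + expr_steps (Var 63) + 6 +
      (expr_steps (Const 0) + expr_steps (Const 0) + 1 + (expr_steps (Const 0) + expr_steps (Const 0) + 1 +
      (n * (60 + expr_steps (Var 64) + 9) + expr_steps (Var 64) + 6))))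
      (\<lambda>t. (t 67 0 = n mod g \<and> (0 < t 68 0 \<longleftrightarrow> (\<exists>i<m. \<exists>j<n. P i \<and> Q j \<and> i mod g = j mod g))) \<and> t 57 0 = n)"
    proof (rule exec_Seq)
      fix u :: memory assume u: "(u 67 0 = m mod g \<and> (\<forall>r<g. 0 < u 47 r \<longleftrightarrow> (\<exists>i<m. P i \<and> i mod g = r))) \<and> u 57 0 = m"
        "\<And>a. a \<notin> writes (For 57 (Var 63) ?B2) \<Longrightarrow> u a = ?t a"
      have "exec (For 57 (Var 64) ?B3) (u(68 := (u 68)(0 := 0), 67 := (u 67)(0 := 0))) (n * (60 + expr_steps (Var 64) + 9) + expr_steps (Var 64) + 6)
       (\<lambda>t. (t 67 0 = n mod g \<and> (0 < t 68 0 \<longleftrightarrow> (\<exists>i<m. \<exists>j<n. P i \<and> Q j \<and> i mod g = j mod g))) \<and> t 57 0 = n)"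
      proof (rule 3)
        fix a :: nat assume a: "a \<notin> {57, 47, 67, 68}"
        then show "(u(68 := (u 68)(0 := 0), 67 := (u 67)(0 := 0))) a = s a"
          using u(2)[of a] t(2)[of a] by (simp add: writes_scan)
      qed (use u in simp_all)
      then show "exec (Seq (Assign 68 (Const 0)) (Seq (Assign 67 (Const 0)) (For 57 (Var 64) ?B3))) u
        (expr_steps (Const 0) + expr_steps (Const 0) + 1 + (expr_steps (Const 0) + expr_steps (Const 0) + 1 +
        (n * (60 + expr_steps (Var 64) + 9) + expr_steps (Var 64) + 6)))
        (\<lambda>t. (t 67 0 = n mod g \<and> (0 < t 68 0 \<longleftrightarrow> (\<exists>i<m. \<exists>j<n. P i \<and> Q j \<and> i mod g = j mod g))) \<and> t 57 0 = n)"
        by (intro exec_Seq_Write) simp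
    qed
    then show "exec (Seq (Assign 67 (Const 0)) (Seq (For 57 (Var 63) ?B2) (Seq (Assign 68 (Const 0)) (Seq (Assign 67 (Const 0)) (For 57 (Var 64) ?B3))))) t
      (expr_steps (Const 0) + expr_steps (Const 0) + 1 + (m * (60 + expr_steps (Var 63) + 9) + expr_steps (Var 63) + 6 +
      (expr_steps (Const 0) + expr_steps (Const 0) + 1 + (expr_steps (Const 0) + expr_steps (Const 0) + 1 +
      (n * (60 + expr_steps (Var 64) + 9) + expr_steps (Var 64) + 6)))))
      (\<lambda>t. (t 67 0 = n mod g \<and> (0 < t 68 0 \<longleftrightarrow> (\<exists>i<m. \<exists>j<n. P i \<and> Q j \<and> i mod g = j mod g))) \<and> t 57 0 = n)"
      by (intro exec_Seq_Write) simp
  qed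
  then show ?thesis by (rule exec_weaken) (auto simp: algebra_simps)
qed

text \<open>\<open>Minus (Const 1) (differ x y)\<close> is positive exactly if \<open>x\<close> and
  \<open>y\<close> are equal. Each pair of branching vertices gets a scan of its own, at most
  \<open>c * c\<close> scans in all, because listing the periodic part could take as many steps as
  the least common multiple of the periods.\<close>

definition fork_body :: program where
  "fork_body = Seq (scan_prog
      (Minus (Const 1) (differ (Read 43 (Plus (Var 27) (Var 57))) (Read 24 (Var 69))))
      (Minus (Const 1) (differ (Read 44 (Plus (Var 27) (Var 57))) (Read 34 (Var 70)))))
    (IfLess (Const 0) (Var 68)
      (Seq (Assign 52 (Read 24 (Var 69))) (Seq (Assign 53 (Read 34 (Var 70))) visit_prog)) Skip)"

definition regime_prog :: program where
  "regime_prog = Seq (gap_prog 43 45 63) (Seq (gap_prog 44 46 64) (Seq gcd_prog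
    (Seq (scan_prog (Read 3 (Read 43 (Plus (Var 27) (Var 57)))) (Read 10 (Read 44 (Plus (Var 27) (Var 57)))))
    (Seq (IfLess (Const 0) (Var 68) (Assign 61 (Const 1)) Skip)
      (For 69 (Var 35) (For 70 (Var 36) fork_body))))))"

lemma writes_regime: "writes fork_body = {57, 47, 67, 68, 52, 53, 56, 58, 59, 60, 41, 42, 40, 51}"
  "writes regime_prog = {57, 72, 45, 63, 46, 64, 65, 66, 47, 67, 68, 61, 69, 70, 52, 53, 56, 58, 59, 60, 41, 42, 40, 51}"
  by (auto simp: fork_body_def regime_prog_def writes_scan writes_visit)

lemma last_visit_cong: "(\<And>j. j < i \<Longrightarrow> v j = w j) \<Longrightarrow> last_visit v i = last_visit w i"
  by (induction i) auto

lemma max_gap_cong: "(\<And>j. j < i \<Longrightarrow> v j = w j) \<Longrightarrow> max_gap v i = max_gap w i"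
proof (induction i)
  case (Suc i)
  then have "last_visit v i = last_visit w i" by (intro last_visit_cong) simp
  with Suc show ?case by simp
qed simp

section \<open>Final and branching pairs in the periodic part of a trajectory\<close>

locale fork_lists = machine +
  fixes f1 f2 :: nat
  assumes f: "s0 35 0 = f1" "s0 36 0 = f2" "f1 \<le> c" "f2 \<le> c"
    and forks1: "s0 24 ` {..<f1} = {x. x < N0 \<and> 1 < s0 21 x}"
    and forks2: "s0 34 ` {..<f2} = {y. y < N0 \<and> 1 < s0 31 y}"
begin

text \<open>The second component of \<open>a0\<close> is a prefix that the queue must extend. It is
  empty in the main invariant, and it is the old queue while a periodic trajectory is analysed,
  which records that entries already treated do not move.\<close>

definition queue_of :: "(nat \<times> nat) \<times> (nat \<times> nat) list \<Rightarrow> (nat \<times> nat) set \<Rightarrow> (nat \<times> nat) list \<Rightarrow> bool" where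
  "queue_of a0 M Q \<longleftrightarrow> (\<exists>ps. distinct ps \<and> set ps = M \<and> Q = fst a0 # concat (map succs ps)) \<and>
     (\<exists>Q'. Q = snd a0 @ Q')"

lemma queue_of_visit:
  "queue_of a0 M Q \<Longrightarrow> queue_of a0 (insert p M) (if p \<in> M then Q else Q @ succs p)"
proof (cases "p \<in> M")
  case False
  assume "queue_of a0 M Q"
  then obtain ps Q' where "distinct ps" "set ps = M" "Q = fst a0 # concat (map succs ps)" and Q': "Q = snd a0 @ Q'"
    unfolding queue_of_def by blast
  then have "distinct (ps @ [p]) \<and> set (ps @ [p]) = insert p M \<and> Q @ succs p = fst a0 # concat (map succs (ps @ [p]))"
    using False by auto
  moreover have "Q @ succs p = snd a0 @ (Q' @ succs p)" using Q' by simp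
  ultimately have "queue_of a0 (insert p M) (Q @ succs p)" unfolding queue_of_def by blast
  then show ?thesis using False by simp
qed (simp add: insert_absorb)

definition regime_pairs :: "nat \<times> nat \<Rightarrow> (nat \<times> nat) set" where
  "regime_pairs a = (let m = max_gap (\<lambda>i. fst (orbit a (B + i))) (3 * B); n = max_gap (\<lambda>i. snd (orbit a (B + i))) (3 * B)
     in {(fst (orbit a (B + i)), snd (orbit a (B + j))) | i j. i < m \<and> j < n \<and> i mod gcd m n = j mod gcd m n})"

definition scan_time :: nat where "scan_time = 9 * B * 80 + 60"
definition regime_time :: nat where "regime_time = c * (c * (scan_time + step_time + 100) + 100) + 2000 * B + scan_time + 500"

context
  fixes a :: "nat \<times> nat" and a0 :: "(nat \<times> nat) \<times> (nat \<times> nat) list" and s :: memory and m n g :: nat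
  assumes a: "valid a" "alive a (4 * B)" and hist: "history a (4 * B) s" and s: "agree s"
    and m: "m = max_gap (\<lambda>i. fst (orbit a (B + i))) (3 * B)" "0 < m"
    and n: "n = max_gap (\<lambda>i. snd (orbit a (B + i))) (3 * B)" "0 < n"
    and g: "g = gcd m n"
begin

lemma hist_at: "i < 3 * B \<Longrightarrow> s 43 (B + i) = fst (orbit a (B + i)) \<and> s 44 (B + i) = snd (orbit a (B + i))"
proof -
  assume "i < 3 * B"
  then have "(s 43 (B + i), s 44 (B + i)) = orbit a (B + i)" using hist unfolding history_def by simp
  then show ?thesis by (metis fst_conv snd_conv)
qed

lemma mn_le: "m \<le> 3 * B" "n \<le> 3 * B" "g \<le> 3 * B" "0 < g"
proof -
  show "m \<le> 3 * B" "n \<le> 3 * B" using m n max_gap_le by blast+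
  moreover have "g \<le> m" using g m gcd_le1_nat[of m n] by simp
  ultimately show "g \<le> 3 * B" by linarith
  show "0 < g" using g m by simp
qed

lemma regime_pairs_eq: "regime_pairs a = {(s 43 (B + i), s 44 (B + j)) | i j. i < m \<and> j < n \<and> i mod g = j mod g}"
  unfolding regime_pairs_def Let_def m(1)[symmetric] n(1)[symmetric] g[symmetric]
proof -
  have "s 43 (B + i) = fst (orbit a (B + i))" "s 44 (B + j) = snd (orbit a (B + j))" if "i < m" "j < n" for i j
    using that mn_le hist_at[of i] hist_at[of j] by simp_all
  then show "{(fst (orbit a (B + i)), snd (orbit a (B + j))) | i j. i < m \<and> j < n \<and> i mod g = j mod g} =
      {(s 43 (B + i), s 44 (B + j)) | i j. i < m \<and> j < n \<and> i mod g = j mod g}"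
    by (intro Collect_cong) metis
qed

lemma fork_step:
  assumes t: "rep t M Q ans" "queue_of a0 M Q" "t 69 0 = i" "t 70 0 = j" "i < f1" "j < f2"
    and same: "t 43 = s 43" "t 44 = s 44" "t 63 0 = m" "t 64 0 = n" "t 65 0 = g"
  shows "exec fork_body t (scan_time + step_time + 50)
    (\<lambda>u. \<exists>Q'. rep u (M \<union> (regime_pairs a \<inter> {(s0 24 i, s0 34 j)})) Q' ans \<and>
       queue_of a0 (M \<union> (regime_pairs a \<inter> {(s0 24 i, s0 34 j)})) Q')"
proof -
  define p where "p = (s0 24 i, s0 34 j)"
  let ?x = "Minus (Const 1) (differ (Read 43 (Plus (Var 27) (Var 57))) (Read 24 (Var 69)))"
  let ?y = "Minus (Const 1) (differ (Read 44 (Plus (Var 27) (Var 57))) (Read 34 (Var 70)))"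
  let ?post = "\<lambda>u. \<exists>Q'. rep u (M \<union> (regime_pairs a \<inter> {p})) Q' ans \<and> queue_of a0 (M \<union> (regime_pairs a \<inter> {p})) Q'"
  have agt: "agree t" using t(1) by (simp add: rep_def)
  have st: "t 27 0 = B" "t 24 = s0 24" "t 34 = s0 34" using params by (simp_all add: agreeD[OF agt])
  have pin: "fst p < N0" "snd p < N0" using forks1 forks2 t(5,6) unfolding p_def by auto
  have "exec (scan_prog ?x ?y) t ((g + m + n) * 80 + 60)
    (\<lambda>u. 0 < u 68 0 \<longleftrightarrow> (\<exists>k<m. \<exists>l<n. s 43 (B + k) = fst p \<and> s 44 (B + l) = snd p \<and> k mod g = l mod g))"
  proof (rule scan_spec[where s = t and P = "\<lambda>k. s 43 (B + k) = fst p" and Q = "\<lambda>l. s 44 (B + l) = snd p", OF mn_le(4) same(5,3,4)])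
    fix u :: memory assume u: "\<And>b. b \<notin> {57, 47, 67, 68} \<Longrightarrow> u b = t b"
    have "u 43 = s 43" "u 44 = s 44" "u 27 0 = B" "u 24 = s0 24" "u 34 = s0 34" "u 69 0 = i" "u 70 0 = j"
      using u[of 43] u[of 44] u[of 27] u[of 24] u[of 34] u[of 69] u[of 70] same st t(3,4) by simp_all
    then show "0 < expr_val ?x u \<longleftrightarrow> s 43 (B + u 57 0) = fst p" "0 < expr_val ?y u \<longleftrightarrow> s 44 (B + u 57 0) = snd p"
      by (auto simp: differ_def p_def)
  qed (simp_all add: differ_def)
  then have scan: "exec (scan_prog ?x ?y) t scan_time (\<lambda>u. 0 < u 68 0 \<longleftrightarrow> p \<in> regime_pairs a)"
  proof (rule exec_weaken)
    fix u :: memory assume "0 < u 68 0 \<longleftrightarrow> (\<exists>k<m. \<exists>l<n. s 43 (B + k) = fst p \<and> s 44 (B + l) = snd p \<and> k mod g = l mod g)"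
    then show "0 < u 68 0 \<longleftrightarrow> p \<in> regime_pairs a"
      unfolding regime_pairs_eq by (cases p) auto
  qed (use mn_le in \<open>simp add: scan_time_def\<close>)
  have "exec fork_body t (scan_time + (step_time + 50)) ?post"
    unfolding fork_body_def
  proof (rule exec_Seq[OF scan])
    fix u assume u: "0 < u 68 0 \<longleftrightarrow> p \<in> regime_pairs a"
      "\<And>b. b \<notin> writes (scan_prog ?x ?y) \<Longrightarrow> u b = t b"
    have Ru: "rep u M Q ans" using t(1) by (rule rep_frame) (rule u(2), auto simp: writes_scan)
    have agu: "agree u" using Ru by (simp add: rep_def)
    have su: "u 24 = s0 24" "u 34 = s0 34" by (simp_all add: agreeD[OF agu])
    have iu: "u 69 0 = i" "u 70 0 = j" using u(2)[of 69] u(2)[of 70] t(3,4) by (simp_all add: writes_scan)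
    show "exec (IfLess (Const 0) (Var 68) (Seq (Assign 52 (Read 24 (Var 69))) (Seq (Assign 53 (Read 34 (Var 70))) visit_prog)) Skip) u
      (step_time + 50) ?post"
    proof (rule exec_le[OF exec_IfLess[where T = "expr_steps (Const 0) + expr_steps (Read 24 (Var 69)) + 1 +
        (expr_steps (Const 0) + expr_steps (Read 34 (Var 70)) + 1 + step_time)" and U = 1]])
      assume "expr_val (Const 0) u < expr_val (Var 68) u"
      then have pR: "p \<in> regime_pairs a" using u(1) by simp
      let ?u = "u(52 := (u 52)(0 := fst p), 53 := (u 53)(0 := snd p))"
      have Ru': "rep ?u M Q ans" by (intro rep_upd Ru) simp_all
      have "exec visit_prog ?u step_time (\<lambda>w. rep w (insert p M) (if p \<in> M then Q else Q @ succs p) ans)"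
      proof (rule exec_le[OF visit_rep[OF Ru' _ pin]])
        have "s0 21 (fst p) * (s0 31 (snd p) * 80 + 40) \<le> c * (c * 80 + 40)"
          using degree pin by (intro mult_le_mono add_mono) auto
        then show "s0 21 (fst p) * (s0 31 (snd p) * 80 + 40) + 70 \<le> step_time" by (simp add: step_time_def)
      qed simp
      then have "exec visit_prog ?u step_time ?post"
      proof (rule exec_weaken)
        fix w assume w: "rep w (insert p M) (if p \<in> M then Q else Q @ succs p) ans"
        have "M \<union> (regime_pairs a \<inter> {p}) = insert p M" using pR by auto
        then show "?post w" using w queue_of_visit[OF t(2), of p] by auto
      qed simp
      then show "exec (Seq (Assign 52 (Read 24 (Var 69))) (Seq (Assign 53 (Read 34 (Var 70))) visit_prog)) u
         (expr_steps (Const 0) + expr_steps (Read 24 (Var 69)) + 1 +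
        (expr_steps (Const 0) + expr_steps (Read 34 (Var 70)) + 1 + step_time)) ?post"
        by (intro exec_Seq_Write) (simp add: su iu p_def)
    next
      assume "\<not> expr_val (Const 0) u < expr_val (Var 68) u"
      then have "M \<union> (regime_pairs a \<inter> {p}) = M" using u(1) by auto
      then have "?post u" using Ru t(2) by auto
      then show "exec Skip u 1 ?post" by (rule exec_Skip[where Q = ?post])
    qed simp
  qed
  then show ?thesis unfolding p_def by (rule exec_le) simp
qed

lemma forks_spec:
  assumes t: "rep t M Q ans" "queue_of a0 M Q"
    and same: "t 43 = s 43" "t 44 = s 44" "t 63 0 = m" "t 64 0 = n" "t 65 0 = g"
  shows "exec (For 69 (Var 35) (For 70 (Var 36) fork_body)) t (c * (c * (scan_time + step_time + 100) + 100) + 100)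
    (\<lambda>u. \<exists>Q'. rep u (M \<union> {p \<in> regime_pairs a. dfork p}) Q' ans \<and> queue_of a0 (M \<union> {p \<in> regime_pairs a. dfork p}) Q')"
proof -
  \<comment> \<open>The part of the periodic pairs already treated, in the lexicographic order of
    the two nested loops.\<close>
  define D where "D i j = {p \<in> regime_pairs a. (\<exists>k<i. \<exists>l<f2. p = (s0 24 k, s0 34 l)) \<or> (\<exists>l<j. p = (s0 24 i, s0 34 l))}" for i j
  define I where "I i j u \<longleftrightarrow> (\<exists>Q'. rep u (M \<union> D i j) Q' ans \<and> queue_of a0 (M \<union> D i j) Q')" for i j u
  have D_Suc: "D i (Suc j) = D i j \<union> (regime_pairs a \<inter> {(s0 24 i, s0 34 j)})" for i j
    by (auto simp: D_def less_Suc_eq)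
  have D_row: "D i f2 = D (Suc i) 0" for i by (auto simp: D_def less_Suc_eq)
  have D_end: "D f1 0 = {p \<in> regime_pairs a. dfork p}"
  proof -
    have "p \<in> D f1 0 \<longleftrightarrow> p \<in> regime_pairs a \<and> fst p \<in> s0 24 ` {..<f1} \<and> snd p \<in> s0 34 ` {..<f2}" for p
      by (cases p) (auto simp: D_def)
    moreover have "fst p < N0 \<and> snd p < N0" if pR: "p \<in> regime_pairs a" for p
    proof -
      obtain i j where "i < m" "j < n" and p: "p = (fst (orbit a (B + i)), snd (orbit a (B + j)))"
        using pR[unfolded regime_pairs_def Let_def, folded m(1) n(1)] by blast
      then have "B + i \<le> 4 * B" "B + j \<le> 4 * B" using mn_le by simp_all
      then have "alive a (B + i)" "alive a (B + j)" using a(2) unfolding alive_def by auto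
      then show ?thesis using orbit_valid[OF a(1)] p by (auto simp: valid_def)
    qed
    ultimately show ?thesis unfolding forks1 forks2 dfork_def by blast
  qed
  have I_upd: "I i j (u(70 := h))" "I i j (u(69 := h))" if "I i j u" for i j u h
  proof -
    obtain Q' where Q': "rep u (M \<union> D i j) Q' ans" "queue_of a0 (M \<union> D i j) Q'"
      using \<open>I i j u\<close> unfolding I_def by blast
    have "rep (u(70 := h)) (M \<union> D i j) Q' ans" "rep (u(69 := h)) (M \<union> D i j) Q' ans"
      by (rule rep_upd[OF Q'(1)]; simp)+
    with Q'(2) show "I i j (u(70 := h))" "I i j (u(69 := h))" unfolding I_def by blast+
  qed
  have inner: "exec (For 70 (Var 36) fork_body) u (f2 * (scan_time + step_time + 50 + expr_steps (Var 36) + 9) + expr_steps (Var 36) + 6)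
      (\<lambda>u. I i f2 u \<and> u 70 0 = f2)"
    if u: "I i 0 u" "u 69 0 = i" "i < f1" "u 43 = s 43" "u 44 = s 44" "u 63 0 = m" "u 64 0 = n" "u 65 0 = g" "agree u" for u i
  proof (rule exec_For[where I = "\<lambda>j. I i j" and m = f2])
    show "I i 0 (u(70 := (u 70)(0 := 0)))" using I_upd u(1) by blast
    fix j :: nat and w :: memory assume w: "j < f2" "I i j w" "w 70 0 = j"
      and fr: "\<And>b. b \<notin> insert 70 (writes fork_body) \<Longrightarrow> w b = u b"
    from w(2) obtain Q' where Q': "rep w (M \<union> D i j) Q' ans" "queue_of a0 (M \<union> D i j) Q'" unfolding I_def by blast
    have "exec fork_body w (scan_time + step_time + 50)
      (\<lambda>w. \<exists>Q'. rep w (M \<union> D i j \<union> (regime_pairs a \<inter> {(s0 24 i, s0 34 j)})) Q' ans \<and>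
       queue_of a0 (M \<union> D i j \<union> (regime_pairs a \<inter> {(s0 24 i, s0 34 j)})) Q')"
      by (rule fork_step[OF Q' _ w(3) u(3) w(1)])
        (use u fr[of 69] fr[of 43] fr[of 44] fr[of 63] fr[of 64] fr[of 65] in \<open>simp_all add: writes_regime\<close>)
    then show "exec fork_body w (scan_time + step_time + 50) (\<lambda>w. I i (Suc j) (w(70 := (w 70)(0 := Suc j))))"
    proof (rule exec_weaken)
      fix w assume "\<exists>Q'. rep w (M \<union> D i j \<union> (regime_pairs a \<inter> {(s0 24 i, s0 34 j)})) Q' ans \<and>
       queue_of a0 (M \<union> D i j \<union> (regime_pairs a \<inter> {(s0 24 i, s0 34 j)})) Q'"
      then have "I i (Suc j) w" unfolding I_def D_Suc Un_assoc .
      then show "I i (Suc j) (w(70 := (w 70)(0 := Suc j)))" using I_upd by blast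
    qed simp
  next
    fix j :: nat and w :: memory assume fr: "\<And>b. b \<notin> insert 70 (writes fork_body) \<Longrightarrow> w b = u b"
    show "expr_val (Var 36) w = f2" using fr[of 36] f by (simp add: writes_regime agreeD[OF u(9)])
  qed (simp add: writes_regime)
  have agt: "agree t" using t(1) by (simp add: rep_def)
  have "exec (For 69 (Var 35) (For 70 (Var 36) fork_body)) t
    (f1 * (f2 * (scan_time + step_time + 50 + expr_steps (Var 36) + 9) + expr_steps (Var 36) + 6 + expr_steps (Var 35) + 9) + expr_steps (Var 35) + 6)
    (\<lambda>u. I f1 0 u \<and> u 69 0 = f1)"
  proof (rule exec_For[where I = "\<lambda>i. I i 0" and m = f1])
    have "D 0 0 = {}" by (simp add: D_def)
    then have "I 0 0 t" unfolding I_def using t by auto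
    then show "I 0 0 (t(69 := (t 69)(0 := 0)))" using I_upd by blast
    fix i :: nat and u :: memory assume u: "i < f1" "I i 0 u" "u 69 0 = i"
      and fr: "\<And>b. b \<notin> insert 69 (writes (For 70 (Var 36) fork_body)) \<Longrightarrow> u b = t b"
    have agu: "agree u" using u(2) by (auto simp: I_def rep_def)
    have "exec (For 70 (Var 36) fork_body) u (f2 * (scan_time + step_time + 50 + expr_steps (Var 36) + 9) + expr_steps (Var 36) + 6)
      (\<lambda>u. I i f2 u \<and> u 70 0 = f2)"
      by (rule inner[OF u(2,3,1)])
        (use same fr[of 43] fr[of 44] fr[of 63] fr[of 64] fr[of 65] agu in \<open>simp_all add: writes_regime\<close>)
    then show "exec (For 70 (Var 36) fork_body) u (f2 * (scan_time + step_time + 50 + expr_steps (Var 36) + 9) + expr_steps (Var 36) + 6)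
      (\<lambda>u. I (Suc i) 0 (u(69 := (u 69)(0 := Suc i))))"
    proof (rule exec_weaken)
      fix w assume "I i f2 w \<and> w 70 0 = f2"
      then have "I (Suc i) 0 w" unfolding I_def D_row by simp
      then show "I (Suc i) 0 (w(69 := (w 69)(0 := Suc i)))" using I_upd by blast
    qed simp
  next
    fix i :: nat and u :: memory assume fr: "\<And>b. b \<notin> insert 69 (writes (For 70 (Var 36) fork_body)) \<Longrightarrow> u b = t b"
    show "expr_val (Var 35) u = f1" using fr[of 35] f by (simp add: writes_regime agreeD[OF agt])
  qed (simp add: writes_regime)
  then show ?thesis
  proof (rule exec_weaken)
    fix u assume "I f1 0 u \<and> u 69 0 = f1"
    then show "\<exists>Q'. rep u (M \<union> {p \<in> regime_pairs a. dfork p}) Q' ans \<and> queue_of a0 (M \<union> {p \<in> regime_pairs a. dfork p}) Q'"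
      unfolding I_def D_end by blast
  next
    have "f2 * (scan_time + step_time + 50 + 2 + 9) \<le> c * (scan_time + step_time + 100)"
      using f by (intro mult_le_mono) auto
    then have "f1 * (f2 * (scan_time + step_time + 50 + 2 + 9) + 2 + 6 + 2 + 9) \<le> c * (c * (scan_time + step_time + 100) + 100)"
      using f by (intro mult_le_mono) auto
    moreover have "expr_steps (Var 36) = 2" "expr_steps (Var 35) = 2" by simp_all
    ultimately show "f1 * (f2 * (scan_time + step_time + 50 + expr_steps (Var 36) + 9) + expr_steps (Var 36) + 6 + expr_steps (Var 35) + 9) + expr_steps (Var 35) + 6
      \<le> c * (c * (scan_time + step_time + 100) + 100) + 100"
      by (simp only:)
  qed
qed

lemma regime_spec:
  assumes R: "rep s M Q ans" "queue_of a0 M Q"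
  shows "exec regime_prog s regime_time
    (\<lambda>u. \<exists>Q'. rep u (M \<union> {p \<in> regime_pairs a. dfork p}) Q' (ans \<or> (\<exists>p\<in>regime_pairs a. final p)) \<and>
       queue_of a0 (M \<union> {p \<in> regime_pairs a. dfork p}) Q')"
    (is "exec _ _ _ ?post")
proof -
  let ?x = "Read 3 (Read 43 (Plus (Var 27) (Var 57)))"
  let ?y = "Read 10 (Read 44 (Plus (Var 27) (Var 57)))"
  define ans' where "ans' \<longleftrightarrow> ans \<or> (\<exists>p\<in>regime_pairs a. final p)"
  let ?loops = "For 69 (Var 35) (For 70 (Var 36) fork_body)"
  let ?set = "IfLess (Const 0) (Var 68) (Assign 61 (Const 1)) Skip"
  have st: "s 27 0 = B" "s 29 0 = 3 * B" using params by (simp_all add: agreeD[OF s])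
  have gm: "max_gap (\<lambda>i. s 43 (B + i)) (3 * B) = m" "max_gap (\<lambda>i. s 44 (B + i)) (3 * B) = n"
    unfolding m(1) n(1) using hist_at by (auto intro!: max_gap_cong)
  have e1: "exec (gap_prog 43 45 63) s (3 * B * 100 + 40) (\<lambda>t. t 63 0 = m)"
    using gap_spec[of 43 45 63 s B "3 * B"] st gm by simp
  have e6: "exec ?loops t (c * (c * (scan_time + step_time + 100) + 100) + 100) ?post"
    if "rep t M Q ans'" "t 43 = s 43" "t 44 = s 44" "t 63 0 = m" "t 64 0 = n" "t 65 0 = g" for t
    unfolding ans'_def[symmetric] using that R(2) by (intro forks_spec)
  have e5: "exec (Seq ?set ?loops) t (20 + (c * (c * (scan_time + step_time + 100) + 100) + 100)) ?post"
    if t: "rep t M Q ans" "t 43 = s 43" "t 44 = s 44" "t 63 0 = m" "t 64 0 = n" "t 65 0 = g"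
      "0 < t 68 0 \<longleftrightarrow> (\<exists>p\<in>regime_pairs a. final p)" for t
  proof -
    have "rep (effect ?set t) M Q ans'"
    proof (cases "0 < t 68 0")
      case True
      then show ?thesis using t(1,7) by (auto simp: rep_def ans'_def agree_upd qlist_def)
    next
      case False
      then show ?thesis using t(1,7) by (simp add: ans'_def)
    qed
    then have "exec ?set t 20 (\<lambda>u. rep u M Q ans')" by (intro exec_loop_free) simp_all
    then show ?thesis
    proof (rule exec_Seq)
      fix u assume u: "rep u M Q ans'" "\<And>b. b \<notin> writes ?set \<Longrightarrow> u b = t b"
      show "exec ?loops u (c * (c * (scan_time + step_time + 100) + 100) + 100) ?post"
        by (rule e6[OF u(1)]) (use u(2)[of 43] u(2)[of 44] u(2)[of 63] u(2)[of 64] u(2)[of 65] t in simp_all)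
    qed
  qed
  have e4: "exec (Seq (scan_prog ?x ?y) (Seq ?set ?loops)) t (scan_time + (20 + (c * (c * (scan_time + step_time + 100) + 100) + 100))) ?post"
    if t: "rep t M Q ans" "t 43 = s 43" "t 44 = s 44" "t 63 0 = m" "t 64 0 = n" "t 65 0 = g" for t
  proof -
    have agt: "agree t" using t(1) by (simp add: rep_def)
    have "exec (scan_prog ?x ?y) t ((g + m + n) * 80 + 60)
      (\<lambda>u. 0 < u 68 0 \<longleftrightarrow> (\<exists>k<m. \<exists>l<n. 0 < s0 3 (s 43 (B + k)) \<and> 0 < s0 10 (s 44 (B + l)) \<and> k mod g = l mod g))"
    proof (rule scan_spec[where s = t and P = "\<lambda>k. 0 < s0 3 (s 43 (B + k))" and Q = "\<lambda>l. 0 < s0 10 (s 44 (B + l))", OF mn_le(4) t(6,4,5)])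
      fix u :: memory assume u: "\<And>b. b \<notin> {57, 47, 67, 68} \<Longrightarrow> u b = t b"
      have "u 43 = s 43" "u 44 = s 44" "u 27 0 = B" "u 3 = s0 3" "u 10 = s0 10"
        using u[of 43] u[of 44] u[of 27] u[of 3] u[of 10] t(2,3) params by (simp_all add: agreeD[OF agt])
      then show "0 < expr_val ?x u \<longleftrightarrow> 0 < s0 3 (s 43 (B + u 57 0))" "0 < expr_val ?y u \<longleftrightarrow> 0 < s0 10 (s 44 (B + u 57 0))"
        by simp_all
    qed simp_all
    then have "exec (scan_prog ?x ?y) t scan_time (\<lambda>u. 0 < u 68 0 \<longleftrightarrow> (\<exists>p\<in>regime_pairs a. final p))"
    proof (rule exec_weaken)
      fix u :: memory assume "0 < u 68 0 \<longleftrightarrow> (\<exists>k<m. \<exists>l<n. 0 < s0 3 (s 43 (B + k)) \<and> 0 < s0 10 (s 44 (B + l)) \<and> k mod g = l mod g)"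
      then show "0 < u 68 0 \<longleftrightarrow> (\<exists>p\<in>regime_pairs a. final p)"
        unfolding regime_pairs_eq final_def by auto
    qed (use mn_le in \<open>simp add: scan_time_def\<close>)
    then show ?thesis
    proof (rule exec_Seq)
      fix u assume u: "0 < u 68 0 \<longleftrightarrow> (\<exists>p\<in>regime_pairs a. final p)" "\<And>b. b \<notin> writes (scan_prog ?x ?y) \<Longrightarrow> u b = t b"
      have Ru: "rep u M Q ans" using t(1) by (rule rep_frame) (rule u(2), auto simp: writes_scan)
      show "exec (Seq ?set ?loops) u (20 + (c * (c * (scan_time + step_time + 100) + 100) + 100)) ?post"
        by (rule e5[OF Ru])
          (use u(1) u(2)[of 43] u(2)[of 44] u(2)[of 63] u(2)[of 64] u(2)[of 65] t in \<open>simp_all add: writes_scan\<close>)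
    qed
  qed
  let ?T = "scan_time + (20 + (c * (c * (scan_time + step_time + 100) + 100) + 100))"
  have "exec regime_prog s (3 * B * 100 + 40 + (3 * B * 100 + 40 + (6 * B * 25 + 30 + ?T))) ?post"
    unfolding regime_prog_def
  proof (rule exec_Seq[OF e1])
    fix t assume t: "t 63 0 = m" "\<And>b. b \<notin> writes (gap_prog 43 45 63) \<Longrightarrow> t b = s b"
    have tt: "t 27 0 = B" "t 29 0 = 3 * B" "t 43 = s 43" "t 44 = s 44"
      using st t(2)[of 27] t(2)[of 29] t(2)[of 43] t(2)[of 44] by (simp_all add: writes_scan)
    have Rt: "rep t M Q ans" using R(1) by (rule rep_frame) (rule t(2), auto simp: writes_scan)
    have "exec (gap_prog 44 46 64) t (3 * B * 100 + 40) (\<lambda>u. u 64 0 = n)"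
      using gap_spec[of 44 46 64 t B "3 * B"] tt gm by simp
    then show "exec (Seq (gap_prog 44 46 64) (Seq gcd_prog (Seq (scan_prog ?x ?y) (Seq ?set ?loops)))) t
        (3 * B * 100 + 40 + (6 * B * 25 + 30 + ?T)) ?post"
    proof (rule exec_Seq)
      fix u assume u: "u 64 0 = n" "\<And>b. b \<notin> writes (gap_prog 44 46 64) \<Longrightarrow> u b = t b"
      have uu: "u 43 = s 43" "u 44 = s 44" "u 63 0 = m"
        using tt t(1) u(2)[of 43] u(2)[of 44] u(2)[of 63] by (simp_all add: writes_scan)
      have Ru: "rep u M Q ans" using Rt by (rule rep_frame) (rule u(2), auto simp: writes_scan)
      have "exec gcd_prog u ((u 63 0 + u 64 0) * 25 + 30) (\<lambda>w. w 65 0 = gcd (u 63 0) (u 64 0))"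
        by (rule gcd_spec) (use uu u m n in simp_all)
      then have "exec gcd_prog u (6 * B * 25 + 30) (\<lambda>w. w 65 0 = g)"
        by (rule exec_weaken) (use uu u g mn_le in simp_all)
      then show "exec (Seq gcd_prog (Seq (scan_prog ?x ?y) (Seq ?set ?loops))) u (6 * B * 25 + 30 + ?T) ?post"
      proof (rule exec_Seq)
        fix w assume w: "w 65 0 = g" "\<And>b. b \<notin> writes gcd_prog \<Longrightarrow> w b = u b"
        have Rw: "rep w M Q ans" using Ru by (rule rep_frame) (rule w(2), auto simp: writes_scan)
        show "exec (Seq (scan_prog ?x ?y) (Seq ?set ?loops)) w ?T ?post"
          by (rule e4[OF Rw]) (use w(1) w(2)[of 43] w(2)[of 44] w(2)[of 63] w(2)[of 64] u(1) uu in \<open>simp_all add: writes_scan\<close>)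
      qed
    qed
  qed
  then show ?thesis by (rule exec_le) (simp add: regime_time_def)
qed

end

end

section \<open>The queue of trajectories\<close>

definition main_body :: program where
  "main_body = Seq (Assign 52 (Read 41 (Var 50))) (Seq (Assign 53 (Read 42 (Var 50)))
    (Seq (Assign 50 (Plus (Var 50) (Const 1))) (Seq (Assign 54 (Const 0)) (Seq (Assign 55 (Const 1))
    (Seq (Assign 62 (Const 0)) (Seq (WhileLess (Const 0) (Var 55) traj_body)
      (IfLess (Const 0) (Var 62) regime_prog Skip)))))))"

definition main_loop :: program where
  "main_loop = WhileLess (Var 50) (Var 51) main_body"

context machine
begin

definition reach :: "nat \<times> nat \<Rightarrow> nat \<times> nat \<Rightarrow> bool" where
  "reach = (\<lambda>p q. q \<in> set (succs p))\<^sup>*\<^sup>*"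

text \<open>The pairs for which the trajectory from the first argument is responsible: a path may
  arrive at a pair where both components branch, but not leave it.\<close>

definition free :: "nat \<times> nat \<Rightarrow> nat \<times> nat \<Rightarrow> bool" where
  "free = (\<lambda>p q. \<not> dfork p \<and> q \<in> set (succs p))\<^sup>*\<^sup>*"

lemma reach_orbit: "alive a k \<Longrightarrow> reach a (orbit a k)"
proof (induction k)
  case (Suc k)
  then have "alive a k" "succs (orbit a k) \<noteq> []" by (auto simp: alive_def)
  with Suc.IH show ?case unfolding reach_def by (auto intro: rtranclp.rtrancl_into_rtrancl)
qed (simp add: reach_def)

lemma free_closed:
  assumes "free a p" "a \<in> X" "\<And>q r. q \<in> X \<Longrightarrow> \<not> dfork q \<Longrightarrow> r \<in> set (succs q) \<Longrightarrow> r \<in> X"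
  shows "p \<in> X"
  using assms(1) unfolding free_def by (induction rule: rtranclp_induct) (use assms(2,3) in auto)

lemma reach_valid: "reach a p \<Longrightarrow> valid a \<Longrightarrow> valid p"
  unfolding reach_def by (induction rule: rtranclp_induct) (auto intro: succs_valid)

end

text \<open>What the queue needs to know about the graphs, supplied once the tables are known to
  represent them: \<open>unique\<close> comes from determinism, \<open>long\<close> from
  \<open>long_trajectory\<close>.\<close>

locale algorithm = fork_lists +
  fixes a0 :: "nat \<times> nat"
  assumes a0: "valid a0"
    and unique: "\<lbrakk>reach a0 p; \<not> dfork p\<rbrakk> \<Longrightarrow> length (succs p) \<le> 1"
    and long: "\<lbrakk>reach a0 a; fresh a (4 * B)\<rbrakk> \<Longrightarrow> 0 < max_gap (\<lambda>i. fst (orbit a (B + i))) (3 * B) \<and>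
      0 < max_gap (\<lambda>i. snd (orbit a (B + i))) (3 * B) \<and> (\<forall>p\<in>regime_pairs a. reach a p) \<and>
      (\<forall>p. free a p \<longrightarrow> (\<exists>i<4 * B. p = orbit a i) \<or> p \<in> regime_pairs a)"
    and degrees: "(\<Sum>x\<in>{x. x < N0 \<and> 1 < s0 21 x}. s0 21 x) \<le> c" "(\<Sum>y\<in>{y. y < N0 \<and> 1 < s0 31 y}. s0 31 y) \<le> c"
begin

text \<open>The meaning of a finished queue entry. It is stable when \<open>M\<close> and
  \<open>ans\<close> grow, so later rounds do not disturb it.\<close>

definition covered :: "(nat \<times> nat) set \<Rightarrow> bool \<Rightarrow> nat \<times> nat \<Rightarrow> bool" where
  "covered M ans a \<longleftrightarrow> (\<forall>p. free a p \<longrightarrow> (final p \<longrightarrow> ans) \<and> (dfork p \<longrightarrow> p \<in> M))"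

definition sound :: "(nat \<times> nat) set \<Rightarrow> bool \<Rightarrow> bool" where
  "sound M ans \<longleftrightarrow> (\<forall>p\<in>M. reach a0 p \<and> dfork p) \<and> (ans \<longrightarrow> (\<exists>p. reach a0 p \<and> final p))"

definition inv :: "nat \<Rightarrow> memory \<Rightarrow> bool" where
  "inv h t \<longleftrightarrow> (\<exists>M Q ans. rep t M Q ans \<and> queue_of (a0, []) M Q \<and> sound M ans \<and> t 50 0 = h \<and> h \<le> length Q \<and>
     (\<forall>i<h. covered M ans (Q ! i)))"

lemma reach_trans: "reach a b \<Longrightarrow> reach b d \<Longrightarrow> reach a d"
  unfolding reach_def by (rule rtranclp_trans)

lemma reach_succs: "reach a p \<Longrightarrow> q \<in> set (succs p) \<Longrightarrow> reach a q"
  unfolding reach_def by (rule rtranclp.rtrancl_into_rtrancl)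

lemma inv_head: "inv h t \<Longrightarrow> t 50 0 = h"
  unfolding inv_def by blast

lemma queue_reach:
  assumes "queue_of (a0, []) M Q" "sound M ans" "a \<in> set Q"
  shows "reach a0 a"
proof -
  have "a = a0 \<or> (\<exists>p\<in>M. a \<in> set (succs p))" using assms(1,3) by (auto simp: queue_of_def)
  moreover have "reach a0 a0" by (simp add: reach_def)
  ultimately show ?thesis using reach_succs assms(2) unfolding sound_def by blast
qed

text \<open>A marked pair contributes at most the product of its out-degrees, and the sum of these
  products over all pairs of branching vertices factors into two sums bounded by
  \<open>c\<close>.\<close>

lemma length_queue:
  assumes "queue_of (a0, []) M Q" "sound M ans"
  shows "length Q \<le> c * c + 1"
proof -
  obtain ps where ps: "distinct ps" "set ps = M" "Q = a0 # concat (map succs ps)"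
    using assms(1) unfolding queue_of_def fst_conv by blast
  define X where "X = {x. x < N0 \<and> 1 < s0 21 x}"
  define Y where "Y = {y. y < N0 \<and> 1 < s0 31 y}"
  have row_len: "length (row p i n) \<le> n" for p i n
    unfolding row_def by (induction n) (auto simp: Let_def)
  have "length (succs p) \<le> s0 21 (fst p) * s0 31 (snd p)" for p
  proof -
    have "length (concat (map (\<lambda>i. row p i (s0 31 (snd p))) [0..<n])) \<le> n * s0 31 (snd p)" for n
    proof (induction n)
      case (Suc n)
      then show ?case using row_len[of p n "s0 31 (snd p)"] by simp
    qed simp
    then show ?thesis unfolding succs_def by blast
  qed
  moreover have "length (concat (map succs ps)) = (\<Sum>p\<in>M. length (succs p))"
    using ps(1,2) by (simp add: length_concat comp_def sum_list_distinct_conv_sum_set)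
  ultimately have "length (concat (map succs ps)) \<le> (\<Sum>p\<in>M. s0 21 (fst p) * s0 31 (snd p))"
    by (simp add: sum_mono)
  also have "\<dots> \<le> (\<Sum>p\<in>X \<times> Y. s0 21 (fst p) * s0 31 (snd p))"
  proof (rule sum_mono2)
    show "M \<subseteq> X \<times> Y"
    proof
      fix p assume "p \<in> M"
      then have p: "reach a0 p" "dfork p" using assms(2) by (auto simp: sound_def)
      with reach_valid[OF p(1) a0] show "p \<in> X \<times> Y" by (cases p) (auto simp: X_def Y_def valid_def dfork_def)
    qed
  qed (auto simp: X_def Y_def)
  also have "\<dots> = (\<Sum>x\<in>X. s0 21 x) * (\<Sum>y\<in>Y. s0 31 y)"
    by (simp add: sum_product sum.cartesian_product case_prod_beta)
  also have "\<dots> \<le> c * c" using degrees unfolding X_def Y_def by (intro mult_le_mono)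
  finally show ?thesis using ps(3) by simp
qed

lemma succs_orbit:
  assumes "reach a0 a" "alive a (Suc i)"
  shows "set (succs (orbit a i)) = {orbit a (Suc i)}"
proof -
  have al: "alive a i" and i: "\<not> dfork (orbit a i)" "succs (orbit a i) \<noteq> []" using assms(2) by (auto simp: alive_def)
  have "length (succs (orbit a i)) \<le> 1" using unique[OF reach_trans[OF assms(1) reach_orbit[OF al]] i(1)] .
  then obtain q where "succs (orbit a i) = [q]" using i(2) by (cases "succs (orbit a i)") auto
  then show ?thesis by simp
qed

text \<open>Successors along the orbit are unique, so the orbit up to \<open>k\<close> is closed
  under free steps as soon as it ends in a branching pair, a dead end or a repetition.\<close>

lemma free_orbit:
  assumes a: "reach a0 a" "alive a k" "free a p"
    and last: "dfork (orbit a k) \<or> succs (orbit a k) = [] \<or> (alive a (Suc k) \<and> (\<exists>i\<le>k. orbit a (Suc k) = orbit a i))"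
  shows "\<exists>i\<le>k. p = orbit a i"
proof -
  have "p \<in> orbit a ` {..k}"
  proof (rule free_closed[OF a(3)])
    show "a \<in> orbit a ` {..k}" by (metis orbit.simps(1) atMost_iff imageI le0)
    fix q r assume q: "q \<in> orbit a ` {..k}" "\<not> dfork q" "r \<in> set (succs q)"
    then obtain i where i: "i \<le> k" "q = orbit a i" by auto
    show "r \<in> orbit a ` {..k}"
    proof (cases "i < k")
      case True
      then have "alive a (Suc i)" using a(2) by (auto simp: alive_def)
      then have "r = orbit a (Suc i)" using succs_orbit[OF a(1)] q(3) i(2) by blast
      then show ?thesis using True by (intro image_eqI[of _ _ "Suc i"]) simp_all
    next
      case False
      then have "i = k" using i(1) by simp
      then have al: "alive a (Suc k)" "\<exists>i\<le>k. orbit a (Suc k) = orbit a i" using last q i by auto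
      then have "r = orbit a (Suc k)" using succs_orbit[OF a(1) al(1)] q(3) i(2) \<open>i = k\<close> by blast
      then show ?thesis using al(2) by auto
    qed
  qed
  then show ?thesis by auto
qed

lemma found_iff: "found a ans (Suc k) \<longleftrightarrow> ans \<or> (\<exists>i\<le>k. final (orbit a i))"
  by (auto simp: found_def less_Suc_eq_le)

lemma sound_found:
  assumes "sound M ans" "reach a0 a" "alive a k"
  shows "sound M (found a ans (Suc k))"
proof -
  have "reach a0 (orbit a i)" if "i \<le> k" for i
  proof -
    have "alive a i" using assms(3) that by (auto simp: alive_def)
    then show ?thesis using reach_trans[OF assms(2) reach_orbit] by blast
  qed
  then show ?thesis using assms(1) unfolding sound_def found_iff by blast
qed

lemma covered_mono: "covered M ans a \<Longrightarrow> M \<subseteq> M' \<Longrightarrow> (ans \<Longrightarrow> ans') \<Longrightarrow> covered M' ans' a"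
  unfolding covered_def by blast

definition body_time :: nat where "body_time = 4 * B * (step_time + 4) + regime_time + 100"

text \<open>In the first three cases of \<open>stopped\<close> the recorded orbit is all that can be
  reached freely from the head of the queue. In the last case \<open>long\<close> places the rest
  into \<open>regime_pairs\<close>, which \<open>regime_prog\<close> searches.\<close>

lemma body_spec:
  assumes t: "inv h t" "h < t 51 0"
  shows "exec main_body t body_time (inv (Suc h))"
proof -
  from t(1) obtain M Q ans where R: "rep t M Q ans" and Q: "queue_of (a0, []) M Q" and so: "sound M ans"
    and h: "t 50 0 = h" "h \<le> length Q" and cov: "\<And>i. i < h \<Longrightarrow> covered M ans (Q ! i)"
    unfolding inv_def by blast
  have hl: "h < length Q" using R t(2) by (simp add: rep_def)
  define a where "a = Q ! h"
  have ra: "reach a0 a" using queue_reach[OF Q so] hl by (simp add: a_def)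
  have va: "valid a" using reach_valid[OF ra a0] .
  have qa: "(t 41 h, t 42 h) = a"
  proof -
    have "qlist t (length Q) ! h = Q ! h" using R by (simp add: rep_def)
    then show ?thesis using hl by (simp add: qlist_def a_def)
  qed
  let ?t = "t(52 := (t 52)(0 := fst a), 53 := (t 53)(0 := snd a), 50 := (t 50)(0 := Suc h),
    54 := (t 54)(0 := 0), 55 := (t 55)(0 := 1), 62 := (t 62)(0 := 0))"
  have "rep ?t M Q ans" by (intro rep_upd R) simp_all
  then have run: "running a M Q ans 0 ?t"
    using params(4) by (simp add: running_def found_def history_def fresh_def alive_def)
  have fin: "inv (Suc h) u"
    if u: "rep u M' Q' ans'" "queue_of (a0, []) M' Q'" "sound M' ans'" "u 50 0 = Suc h" "length Q \<le> length Q'"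
      "M \<subseteq> M'" "ans \<Longrightarrow> ans'" "covered M' ans' a" "\<And>i. i < length Q \<Longrightarrow> Q' ! i = Q ! i" for u M' Q' ans'
  proof -
    have "covered M' ans' (Q' ! i)" if "i < Suc h" for i
    proof (cases "i = h")
      case True
      then show ?thesis using u(8,9) hl by (simp add: a_def)
    next
      case False
      then have "i < h" using that by simp
      then show ?thesis using covered_mono[OF cov u(6,7)] u(9)[of i] hl by simp
    qed
    then show ?thesis unfolding inv_def using u(1-5) hl by (intro exI[of _ M'] exI[of _ Q'] exI[of _ ans']) auto
  qed
  have tail: "exec (IfLess (Const 0) (Var 62) regime_prog Skip) u (regime_time + 4) (inv (Suc h))"
    if u: "stopped a M Q ans u" and u50: "u 50 0 = Suc h" for u
  proof -
    from u obtain k where k: "fresh a k" and cases: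
     "dfork (orbit a k) \<and> u 62 0 = 0 \<and>
        rep u (insert (orbit a k) M) (if orbit a k \<in> M then Q else Q @ succs (orbit a k)) (found a ans (Suc k)) \<or>
      \<not> dfork (orbit a k) \<and> succs (orbit a k) = [] \<and> u 62 0 = 0 \<and> rep u M Q (found a ans (Suc k)) \<or>
      alive a (Suc k) \<and> B < Suc k \<and> orbit a (Suc k) = orbit a B \<and> u 62 0 = 0 \<and> rep u M Q (found a ans (Suc k)) \<or>
      fresh a (Suc k) \<and> Suc k = 4 * B \<and> u 62 0 = 1 \<and> rep u M Q (found a ans (Suc k)) \<and> history a (4 * B) u"
      unfolding stopped_def by blast
    have al: "alive a k" using k by (simp add: fresh_def)
    have so': "sound M (found a ans (Suc k))" using sound_found[OF so ra al] .
    have skip: "exec (IfLess (Const 0) (Var 62) regime_prog Skip) u (regime_time + 4) (inv (Suc h))"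
      if "u 62 0 = 0" "inv (Suc h) u"
      by (rule exec_le[OF exec_IfLess[where T = 1 and U = 1]]) (use that in \<open>simp_all add: exec_Skip[simplified] regime_time_def\<close>)
    have cov_orbit: "covered M' (found a ans (Suc k)) a"
      if cc: "dfork (orbit a k) \<or> succs (orbit a k) = [] \<or> (alive a (Suc k) \<and> (\<exists>i\<le>k. orbit a (Suc k) = orbit a i))"
        and cd: "dfork (orbit a k) \<Longrightarrow> orbit a k \<in> M'" for M'
      unfolding covered_def
    proof (intro allI impI)
      fix p assume "free a p"
      then obtain i where i: "i \<le> k" "p = orbit a i" using free_orbit[OF ra al _ cc] by blast
      have "dfork p \<Longrightarrow> i = k" using al i by (auto simp: alive_def le_less)
      then show "(final p \<longrightarrow> found a ans (Suc k)) \<and> (dfork p \<longrightarrow> p \<in> M')"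
        using i cd unfolding found_iff by auto
    qed
    from cases show ?thesis
    proof (elim disjE conjE)
      assume c: "dfork (orbit a k)" "u 62 0 = 0"
        "rep u (insert (orbit a k) M) (if orbit a k \<in> M then Q else Q @ succs (orbit a k)) (found a ans (Suc k))"
      have "sound (insert (orbit a k) M) (found a ans (Suc k))"
        using so' c(1) reach_trans[OF ra reach_orbit[OF al]] by (auto simp: sound_def)
      moreover have "covered (insert (orbit a k) M) (found a ans (Suc k)) a" using c(1) by (intro cov_orbit) auto
      ultimately have "inv (Suc h) u"
        by (intro fin[OF c(3) queue_of_visit[OF Q] _ u50]) (auto simp: found_def nth_append)
      with c(2) show ?thesis by (rule skip)
    next
      assume c: "\<not> dfork (orbit a k)" "succs (orbit a k) = []" "u 62 0 = 0" "rep u M Q (found a ans (Suc k))"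
      have "covered M (found a ans (Suc k)) a" using c by (intro cov_orbit) auto
      then have "inv (Suc h) u" by (intro fin[OF c(4) Q so' u50]) (auto simp: found_def)
      with c(3) show ?thesis by (rule skip)
    next
      assume c: "alive a (Suc k)" "B < Suc k" "orbit a (Suc k) = orbit a B" "u 62 0 = 0" "rep u M Q (found a ans (Suc k))"
      have nd: "\<not> dfork (orbit a k)" using c(1) by (simp add: alive_def)
      have "\<exists>i\<le>k. orbit a (Suc k) = orbit a i" using c(2,3) by (intro exI[of _ B]) simp
      with c(1) nd have "covered M (found a ans (Suc k)) a" by (intro cov_orbit) blast+
      then have "inv (Suc h) u" by (intro fin[OF c(5) Q so' u50]) (auto simp: found_def)
      with c(4) show ?thesis by (rule skip)
    next
      assume c: "fresh a (Suc k)" "Suc k = 4 * B" "u 62 0 = 1" "rep u M Q (found a ans (Suc k))" "history a (4 * B) u"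
      have fr: "fresh a (4 * B)" using c(1,2) by simp
      note lg = long[OF ra fr]
      have al4: "alive a (4 * B)" using fr by (simp add: fresh_def)
      have agu: "agree u" using c(4) by (simp add: rep_def)
      let ?M = "M \<union> {p \<in> regime_pairs a. dfork p}"
      let ?ans = "found a ans (Suc k) \<or> (\<exists>p\<in>regime_pairs a. final p)"
      have Q2: "queue_of (a0, Q) M Q" using Q by (simp add: queue_of_def)
      have "exec regime_prog u regime_time (\<lambda>w. \<exists>Q'. rep w ?M Q' ?ans \<and> queue_of (a0, Q) ?M Q')"
        by (rule regime_spec[OF va al4 c(5) agu refl _ refl _ refl c(4) Q2]) (use lg in blast)+
      then have "exec regime_prog u regime_time (inv (Suc h))"
      proof (rule exec_frame)
        fix w assume "\<exists>Q'. rep w ?M Q' ?ans \<and> queue_of (a0, Q) ?M Q'" and fr: "\<And>b. b \<notin> writes regime_prog \<Longrightarrow> w b = u b"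
        then obtain Q' where w: "rep w ?M Q' ?ans" "queue_of (a0, Q) ?M Q'" by blast
        then obtain Q1 where Q1: "Q' = Q @ Q1" by (auto simp: queue_of_def)
        show "inv (Suc h) w"
        proof (rule fin[OF w(1)])
          show "queue_of (a0, []) ?M Q'" using w(2) by (simp add: queue_of_def)
          show "sound ?M ?ans"
            using so' lg reach_trans[OF ra] unfolding sound_def by blast
          show "w 50 0 = Suc h" using fr[of 50] u50 by (simp add: writes_regime)
          show "covered ?M ?ans a"
            unfolding covered_def
          proof (intro allI impI)
            fix p assume "free a p"
            then consider i where "i < 4 * B" "p = orbit a i" | "p \<in> regime_pairs a" using lg by blast
            then show "(final p \<longrightarrow> ?ans) \<and> (dfork p \<longrightarrow> p \<in> ?M)"
            proof cases
              case 1
              then have "\<not> dfork p" using al4 by (simp add: alive_def)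
              moreover have "final p \<Longrightarrow> found a ans (Suc k)" using 1 c(2) unfolding found_def by auto
              ultimately show ?thesis by blast
            qed blast
          qed
        qed (use Q1 in \<open>auto simp: found_def nth_append\<close>)
      qed simp
      then show ?thesis
        by (intro exec_le[OF exec_IfLess[where T = regime_time and U = 1]]) (simp_all add: c(3) regime_time_def)
    qed
  qed
  have "exec (WhileLess (Const 0) (Var 55) traj_body) ?t (4 * B * (step_time + 4) + 4) (stopped a M Q ans)"
    by (rule traj_spec[OF run va])
  then have loop: "exec (Seq (WhileLess (Const 0) (Var 55) traj_body) (IfLess (Const 0) (Var 62) regime_prog Skip)) ?t
    (4 * B * (step_time + 4) + 4 + (regime_time + 4)) (inv (Suc h))"
  proof (rule exec_Seq)
    fix u assume u: "stopped a M Q ans u" "\<And>b. b \<notin> writes (WhileLess (Const 0) (Var 55) traj_body) \<Longrightarrow> u b = ?t b"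
    have "u 50 0 = Suc h" using u(2)[of 50] by (simp add: writes_traj)
    with u(1) show "exec (IfLess (Const 0) (Var 62) regime_prog Skip) u (regime_time + 4) (inv (Suc h))" by (rule tail)
  qed
  show ?thesis
  proof -
    have v: "t 41 h = fst a" "t 42 h = snd a" "t 50 0 = h" using h(1) qa by (cases a; simp)+
    have "exec main_body t (expr_steps (Const 0) + expr_steps (Read 41 (Var 50)) + 1 +
      (expr_steps (Const 0) + expr_steps (Read 42 (Var 50)) + 1 +
      (expr_steps (Const 0) + expr_steps (Plus (Var 50) (Const 1)) + 1 +
      (expr_steps (Const 0) + expr_steps (Const 0) + 1 + (expr_steps (Const 0) + expr_steps (Const 1) + 1 +
      (expr_steps (Const 0) + expr_steps (Const 0) + 1 + (4 * B * (step_time + 4) + 4 + (regime_time + 4)))))))) (inv (Suc h))"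
      unfolding main_body_def using loop by (intro exec_Seq_Write) (simp add: v)
    then show ?thesis by (rule exec_le) (simp add: body_time_def)
  qed
qed

text \<open>Induction along a path from \<open>a0\<close>: a pair where both components branch is
  marked, being freely reached from a queue entry, so its successor on the path is itself a queue
  entry and restarts the free part.\<close>

lemma complete:
  assumes "queue_of (a0, []) M Q" "\<And>i. i < length Q \<Longrightarrow> covered M ans (Q ! i)" "reach a0 p"
  shows "\<exists>a\<in>set Q. free a p"
  using assms(3) unfolding reach_def
proof (induction rule: rtranclp_induct)
  case base
  have "a0 \<in> set Q" using assms(1) by (auto simp: queue_of_def)
  then show ?case unfolding free_def by blast
next
  case (step p q)
  then obtain a where a: "a \<in> set Q" "free a p" by blast
  show ?case
  proof (cases "dfork p")
    case False
    then have "free a q" using a(2) step(2) unfolding free_def by (auto intro: rtranclp.rtrancl_into_rtrancl)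
    with a(1) show ?thesis by blast
  next
    case True
    from a(1) obtain i where "i < length Q" "a = Q ! i" by (auto simp: in_set_conv_nth)
    then have "p \<in> M" using assms(2) a(2) True unfolding covered_def by blast
    then have "q \<in> set Q" using assms(1) step(2) by (auto simp: queue_of_def)
    then show ?thesis unfolding free_def by blast
  qed
qed

lemma main_spec:
  assumes "agree s" "s 50 0 = 0" "s 51 0 = 1" "(s 41 0, s 42 0) = a0" "s 40 = (\<lambda>_. 0)" "s 61 0 = 0"
  shows "exec main_loop s ((c * c + 1) * (body_time + 5) + 5) (\<lambda>t. t 61 0 = (if \<exists>p. reach a0 p \<and> final p then 1 else 0))"
proof -
  have "exec main_loop s ((c * c + 1) * (body_time + expr_steps (Var 50) + expr_steps (Var 51) + 1) + (expr_steps (Var 50) + expr_steps (Var 51) + 1))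
    (\<lambda>t. (\<exists>h. inv h t) \<and> \<not> expr_val (Var 50) t < expr_val (Var 51) t)"
    unfolding main_loop_def
  proof (rule exec_WhileLess[where \<mu> = "\<lambda>t. c * c + 1 - t 50 0"])
    have "rep s {} [a0] False"
      using assms unfolding rep_def by (auto simp: qlist_def marks_def)
    moreover have "queue_of (a0, []) {} [a0]" by (auto simp: queue_of_def)
    ultimately have "inv 0 s" unfolding inv_def using assms(2)
      by (intro exI[of _ "{}"] exI[of _ "[a0]"] exI[of _ False]) (simp add: sound_def)
    then show "\<exists>h. inv h s" by blast
    fix t assume t: "\<exists>h. inv h t" "expr_val (Var 50) t < expr_val (Var 51) t"
    then obtain h where h: "inv h t" by blast
    then obtain M Q ans where i: "rep t M Q ans" "queue_of (a0, []) M Q" "sound M ans" "t 50 0 = h"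
      unfolding inv_def by blast
    have "h < t 51 0" using t(2) i(4) by simp
    moreover have "h < c * c + 1" using calculation length_queue[OF i(2,3)] i(1) by (simp add: rep_def)
    ultimately have hh: "h < t 51 0" "h < c * c + 1" by simp_all
    show "exec main_body t body_time (\<lambda>t'. (\<exists>h. inv h t') \<and> c * c + 1 - t' 50 0 < c * c + 1 - t 50 0)"
    proof (rule exec_weaken[OF body_spec[OF h hh(1)]])
      fix u assume u: "inv (Suc h) u"
      then have "u 50 0 = Suc h" by (rule inv_head)
      then have "c * c + 1 - u 50 0 < c * c + 1 - t 50 0" using hh(2) i(4) by simp
      with u show "(\<exists>h. inv h u) \<and> c * c + 1 - u 50 0 < c * c + 1 - t 50 0" by blast
    qed simp
  qed simp
  then show ?thesis
  proof (rule exec_weaken)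
    fix t assume t: "(\<exists>h. inv h t) \<and> \<not> expr_val (Var 50) t < expr_val (Var 51) t"
    then obtain h M Q ans where i: "rep t M Q ans" "queue_of (a0, []) M Q" "sound M ans" "t 50 0 = h" "h \<le> length Q"
      "\<And>i. i < h \<Longrightarrow> covered M ans (Q ! i)" unfolding inv_def by blast
    have "h = length Q" using t i by (simp add: rep_def)
    then have cov: "\<And>i. i < length Q \<Longrightarrow> covered M ans (Q ! i)" using i(6) by simp
    have "ans" if p: "reach a0 p" "final p" for p
    proof -
      obtain a where a: "a \<in> set Q" "free a p" using complete[OF i(2) cov p(1)] by blast
      then obtain i where "i < length Q" "a = Q ! i" by (auto simp: in_set_conv_nth)
      then show ans using cov a(2) p(2) unfolding covered_def by blast
    qed
    then have "ans \<longleftrightarrow> (\<exists>p. reach a0 p \<and> final p)" using i(3) unfolding sound_def by blast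
    then show "t 61 0 = (if \<exists>p. reach a0 p \<and> final p then 1 else 0)" using i(1) by (simp add: rep_def)
  qed (simp add: numeral_eq_Suc)
qed

end

section \<open>Preparation of the tables\<close>

text \<open>Row addresses \<open>v * N\<close> are tabulated by repeated addition, since the machine
  cannot multiply.\<close>

definition mul_prog :: program where
  "mul_prog = For 37 (Var 25) (Seq (Write 20 (Var 37) (Var 38)) (Assign 38 (Plus (Var 38) (Var 25))))"

text \<open>Edges are distributed into rows of length \<open>N\<close>, one per tail. Quadratically
  many cells are reserved, but only one slot per edge is written.\<close>

definition index_body :: "nat \<Rightarrow> nat \<Rightarrow> nat \<Rightarrow> nat \<Rightarrow> nat \<Rightarrow> program" where
  "index_body ta he deg ind slot =
    Seq (Assign 38 (Read ta (Var 37)))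
    (Seq (Write slot (Plus (Read 20 (Var 38)) (Read deg (Var 38))) (Var 37))
    (Seq (Write deg (Var 38) (Plus (Read deg (Var 38)) (Const 1)))
      (Write ind (Read he (Var 37)) (Plus (Read ind (Read he (Var 37))) (Const 1)))))"

text \<open>The sum of the two differences is positive exactly at vertices that are not plain, so
  cell 26 accumulates \<open>branching\<close>.\<close>

definition count_body :: "nat \<Rightarrow> nat \<Rightarrow> nat \<Rightarrow> nat \<Rightarrow> program" where
  "count_body deg ind L f =
    Seq (IfLess (Const 1) (Read deg (Var 37)) (Seq (Write L (Var f) (Var 37)) (Assign f (Plus (Var f) (Const 1)))) Skip)
      (IfLess (Const 0) (Plus (differ (Read deg (Var 37)) (Const 1)) (differ (Read ind (Var 37)) (Const 1)))
        (Assign 26 (Plus (Var 26) (Plus (Read deg (Var 37)) (Const 1)))) Skip)"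

text \<open>Cell 26, the small factor, is the number of additions. Thus five such products yield
  \<open>c ^ 5\<close> times the number of edges in time O(\<open>c\<close>).\<close>

definition times_prog :: program where
  "times_prog = Seq (Assign 38 (Const 0)) (Seq (For 37 (Var 26) (Assign 38 (Plus (Var 38) (Var 27)))) (Assign 27 (Var 38)))"

lemma mul_spec:
  assumes "s 25 0 = N" "s 38 0 = 0"
  shows "exec mul_prog s (N * 40 + 10) (\<lambda>t. \<forall>i<N. t 20 i = i * N)"
proof -
  have "exec mul_prog s (N * (20 + expr_steps (Var 25) + 9) + expr_steps (Var 25) + 6)
    (\<lambda>t. ((\<forall>i<N. t 20 i = i * N) \<and> t 38 0 = N * N) \<and> t 37 0 = N)"
    unfolding mul_prog_def
  proof (rule exec_For[where I = "\<lambda>k t. (\<forall>i<k. t 20 i = i * N) \<and> t 38 0 = k * N"])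
    fix k :: nat and t :: memory assume t: "k < N" "(\<forall>i<k. t 20 i = i * N) \<and> t 38 0 = k * N" "t 37 0 = k"
      and fr: "\<And>a. a \<notin> insert 37 (writes (Seq (Write 20 (Var 37) (Var 38)) (Assign 38 (Plus (Var 38) (Var 25))))) \<Longrightarrow> t a = s a"
    have "t 25 0 = N" using fr[of 25] assms by simp
    then show "exec (Seq (Write 20 (Var 37) (Var 38)) (Assign 38 (Plus (Var 38) (Var 25)))) t 20
       (\<lambda>t'. (\<forall>i<Suc k. (t'(37 := (t' 37)(0 := Suc k))) 20 i = i * N) \<and> (t'(37 := (t' 37)(0 := Suc k))) 38 0 = Suc k * N)"
      using t by (intro exec_loop_free) (auto simp: less_Suc_eq)
  next
    fix k :: nat and t :: memory
    assume fr: "\<And>a. a \<notin> insert 37 (writes (Seq (Write 20 (Var 37) (Var 38)) (Assign 38 (Plus (Var 38) (Var 25))))) \<Longrightarrow> t a = s a"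
    show "expr_val (Var 25) t = N" using fr[of 25] assms by simp
  qed (use assms in auto)
  then show ?thesis by (rule exec_weaken) auto
qed

lemma times_spec: "exec times_prog s (s 26 0 * 30 + 30) (\<lambda>t. t 27 0 = s 26 0 * s 27 0)"
proof -
  let ?s = "s(38 := (s 38)(0 := 0))"
  have "exec (For 37 (Var 26) (Assign 38 (Plus (Var 38) (Var 27)))) ?s (s 26 0 * (10 + expr_steps (Var 26) + 9) + expr_steps (Var 26) + 6)
     (\<lambda>t. t 38 0 = s 26 0 * s 27 0 \<and> t 37 0 = s 26 0)"
  proof (rule exec_For[where I = "\<lambda>k t. t 38 0 = k * s 27 0"])
    fix k :: nat and t :: memory assume t: "t 38 0 = k * s 27 0" "t 37 0 = k"
      and fr: "\<And>a. a \<notin> insert 37 (writes (Assign 38 (Plus (Var 38) (Var 27)))) \<Longrightarrow> t a = ?s a"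
    have "t 27 0 = s 27 0" using fr[of 27] by simp
    then show "exec (Assign 38 (Plus (Var 38) (Var 27))) t 10 (\<lambda>t'. (t'(37 := (t' 37)(0 := Suc k))) 38 0 = Suc k * s 27 0)"
      using t by (intro exec_loop_free) auto
  next
    fix k :: nat and t :: memory
    assume fr: "\<And>a. a \<notin> insert 37 (writes (Assign 38 (Plus (Var 38) (Var 27)))) \<Longrightarrow> t a = ?s a"
    show "expr_val (Var 26) t = s 26 0" using fr[of 26] by simp
  qed auto
  then have "exec (Seq (For 37 (Var 26) (Assign 38 (Plus (Var 38) (Var 27)))) (Assign 27 (Var 38))) ?s
     (s 26 0 * (10 + expr_steps (Var 26) + 9) + expr_steps (Var 26) + 6 + 10) (\<lambda>t. t 27 0 = s 26 0 * s 27 0)"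
    by (rule exec_Seq) (auto intro!: exec_loop_free)
  then have "exec times_prog s (expr_steps (Const 0) + expr_steps (Const 0) + 1 +
    (s 26 0 * (10 + expr_steps (Var 26) + 9) + expr_steps (Var 26) + 6 + 10)) (\<lambda>t. t 27 0 = s 26 0 * s 27 0)"
    unfolding times_prog_def by (intro exec_Seq_Write) simp
  then show ?thesis by (rule exec_le) simp
qed

lemma index_spec:
  assumes d: "distinct [E, ta, he, deg, ind, slot, 20, 37, 38]"
    and E: "s E 0 = n" "n \<le> N" and zero: "s deg = (\<lambda>_. 0)" "s ind = (\<lambda>_. 0)"
    and mul: "\<And>i. i < N \<Longrightarrow> s 20 i = i * N" and ta: "\<And>e. e < n \<Longrightarrow> s ta e < N"
  shows "exec (For 37 (Var E) (index_body ta he deg ind slot)) s (n * 60 + 10)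
    (\<lambda>t. (\<forall>v. t deg v = length (filter (\<lambda>e. s ta e = v) [0..<n])) \<and> (\<forall>v. t ind v = length (filter (\<lambda>e. s he e = v) [0..<n])) \<and>
      (\<forall>v<N. map (\<lambda>k. t slot (v * N + k)) [0..<length (filter (\<lambda>e. s ta e = v) [0..<n])] = filter (\<lambda>e. s ta e = v) [0..<n]))"
proof -
  define Out where "Out i v = filter (\<lambda>e. s ta e = v) [0..<i]" for i v
  define H where "H i v = filter (\<lambda>e. s he e = v) [0..<i]" for i v
  have Out_Suc: "Out (Suc i) v = (if s ta i = v then Out i v @ [i] else Out i v)" for i v by (simp add: Out_def)
  have H_Suc: "H (Suc i) v = (if s he i = v then H i v @ [i] else H i v)" for i v by (simp add: H_def)
  have Out_len: "length (Out i v) \<le> i" for i v unfolding Out_def by (metis length_filter_le length_upt minus_nat.diff_0)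
  let ?I = "\<lambda>i t. (\<forall>v. t deg v = length (Out i v)) \<and> (\<forall>v. t ind v = length (H i v)) \<and>
      (\<forall>v<N. map (\<lambda>k. t slot (v * N + k)) [0..<length (Out i v)] = Out i v)"
  have "exec (For 37 (Var E) (index_body ta he deg ind slot)) s (n * (40 + expr_steps (Var E) + 9) + expr_steps (Var E) + 6)
    (\<lambda>t. ?I n t \<and> t 37 0 = n)"
  proof (rule exec_For[where I = ?I])
    show "?I 0 (s(37 := (s 37)(0 := 0)))" using d zero by (auto simp: Out_def H_def)
    fix i :: nat and t :: memory assume t: "i < n" "?I i t" "t 37 0 = i"
      and fr: "\<And>a. a \<notin> insert 37 (writes (index_body ta he deg ind slot)) \<Longrightarrow> t a = s a"
    have same: "t 20 = s 20" "t ta = s ta" "t he = s he" using d by (intro fr; auto simp: index_body_def)+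
    define v where "v = s ta i"
    have v: "v < N" using ta t(1) by (simp add: v_def)
    let ?e = "effect (index_body ta he deg ind slot) t"
    have e_deg: "?e deg = (t deg)(v := Suc (t deg v))"
      and e_ind: "?e ind = (t ind)(s he i := Suc (t ind (s he i)))"
      and e_slot: "?e slot = (t slot)(v * N + t deg v := i)"
      using d same t(3) mul[OF v] by (auto simp: index_body_def v_def)
    have slots: "map (\<lambda>k. ?e slot (w * N + k)) [0..<length (Out (Suc i) w)] = Out (Suc i) w" if w: "w < N" for w
    proof -
      have old: "map (\<lambda>k. t slot (w * N + k)) [0..<length (Out i w)] = Out i w" using t(2) w by blast
      have "?e slot (w * N + k) = t slot (w * N + k)" if k: "k < length (Out i w)" for k
      proof -
        \<comment> \<open>Rows do not overlap: their fill levels stay below the number of edges,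
          which is at most \<open>N\<close>, so quotient and remainder recover row and
          place.\<close>
        have "w * N + k \<noteq> v * N + t deg v"
        proof
          assume eq: "w * N + k = v * N + t deg v"
          have lt: "k < N" "t deg v < N" using k Out_len[of i w] Out_len[of i v] t(1,2) E(2) by auto
          have "w = (w * N + k) div N" "v = (v * N + t deg v) div N" using lt by simp_all
          then have "w = v" using eq by simp
          then have "k = t deg v" using eq by simp
          then show False using k t(2) \<open>w = v\<close> by simp
        qed
        then show ?thesis unfolding e_slot by simp
      qed
      then have old': "map (\<lambda>k. ?e slot (w * N + k)) [0..<length (Out i w)] = Out i w"
        using old by (metis (no_types, lifting) atLeastLessThan_iff list.map_cong0 set_upt)
      show ?thesis
      proof (cases "w = v")
        case True
        then have "Out (Suc i) w = Out i w @ [i]" unfolding Out_Suc by (simp add: v_def)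
        moreover have "?e slot (w * N + length (Out i w)) = i" unfolding e_slot using True t(2) by simp
        ultimately show ?thesis using old' by simp
      next
        case False
        then have "Out (Suc i) w = Out i w" unfolding Out_Suc by (simp add: v_def)
        then show ?thesis using old' by simp
      qed
    qed
    show "exec (index_body ta he deg ind slot) t 40 (\<lambda>t'. ?I (Suc i) (t'(37 := (t' 37)(0 := Suc i))))"
    proof (rule exec_loop_free)
      have "(?e(37 := (?e 37)(0 := Suc i))) deg = ?e deg" "(?e(37 := (?e 37)(0 := Suc i))) ind = ?e ind" "(?e(37 := (?e 37)(0 := Suc i))) slot = ?e slot"
        using d by auto
      moreover have "?e deg w = length (Out (Suc i) w)" "?e ind w = length (H (Suc i) w)" for w
        unfolding e_deg e_ind Out_Suc H_Suc using t(2) by (auto simp: v_def)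
      ultimately show "?I (Suc i) (?e(37 := (?e 37)(0 := Suc i)))" using slots by simp
    qed (simp_all add: index_body_def)
  next
    fix i :: nat and t :: memory
    assume fr: "\<And>a. a \<notin> insert 37 (writes (index_body ta he deg ind slot)) \<Longrightarrow> t a = s a"
    have "t E = s E" using d by (intro fr; auto simp: index_body_def)
    then show "expr_val (Var E) t = n" using E by simp
  qed (use d in \<open>auto simp: index_body_def\<close>)
  then show ?thesis by (rule exec_weaken) (simp_all add: Out_def H_def)
qed

lemma count_spec:
  assumes d: "distinct [V, deg, ind, L, f, 26, 37]" and V: "s V 0 = n" and f: "s f 0 = 0"
  shows "exec (For 37 (Var V) (count_body deg ind L f)) s (n * 80 + 10)
    (\<lambda>t. t f 0 = length (filter (\<lambda>v. 1 < s deg v) [0..<n]) \<and>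
      map (t L) [0..<length (filter (\<lambda>v. 1 < s deg v) [0..<n])] = filter (\<lambda>v. 1 < s deg v) [0..<n] \<and>
      t 26 0 = s 26 0 + (\<Sum>v<n. if s deg v = 1 \<and> s ind v = 1 then 0 else s deg v + 1))"
proof -
  define F where "F i = filter (\<lambda>v. 1 < s deg v) [0..<i]" for i
  have F_Suc: "F (Suc i) = (if 1 < s deg i then F i @ [i] else F i)" for i by (simp add: F_def)
  define C where "C i = (\<Sum>v<i. if s deg v = 1 \<and> s ind v = 1 then 0 else s deg v + 1)" for i
  have C_Suc: "C (Suc i) = C i + (if s deg i = 1 \<and> s ind i = 1 then 0 else s deg i + 1)" for i by (simp add: C_def)
  let ?I = "\<lambda>i t. t f 0 = length (F i) \<and> map (t L) [0..<length (F i)] = F i \<and> t 26 0 = s 26 0 + C i"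
  have "exec (For 37 (Var V) (count_body deg ind L f)) s (n * (60 + expr_steps (Var V) + 9) + expr_steps (Var V) + 6)
    (\<lambda>t. ?I n t \<and> t 37 0 = n)"
  proof (rule exec_For[where I = ?I])
    show "?I 0 (s(37 := (s 37)(0 := 0)))" using d f by (auto simp: F_def C_def)
    fix i :: nat and t :: memory assume t: "i < n" "?I i t" "t 37 0 = i"
      and fr: "\<And>a. a \<notin> insert 37 (writes (count_body deg ind L f)) \<Longrightarrow> t a = s a"
    have same: "t deg = s deg" "t ind = s ind" using d by (intro fr; auto simp: count_body_def)+
    let ?e = "effect (count_body deg ind L f) t"
    have e: "?e f 0 = length (F (Suc i))" "?e L = (if 1 < s deg i then (t L)(length (F i) := i) else t L)"
      "?e 26 0 = s 26 0 + C (Suc i)"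
    proof -
      have "s deg i = 0 \<or> s deg i = 1 \<or> 1 < s deg i" "s ind i = 0 \<or> s ind i = 1 \<or> 1 < s ind i" by linarith+
      then show "?e f 0 = length (F (Suc i))" "?e L = (if 1 < s deg i then (t L)(length (F i) := i) else t L)"
        "?e 26 0 = s 26 0 + C (Suc i)"
        unfolding F_Suc C_Suc using d same t(2,3) by (auto simp: count_body_def differ_def)
    qed
    have L: "map (?e L) [0..<length (F (Suc i))] = F (Suc i)"
    proof (cases "1 < s deg i")
      case True
      have "map ((t L)(length (F i) := i)) [0..<length (F i)] = map (t L) [0..<length (F i)]"
        by (intro map_cong) auto
      then show ?thesis unfolding e F_Suc using True t(2) by simp
    next
      case False
      then show ?thesis unfolding e F_Suc using t(2) by simp
    qed
    show "exec (count_body deg ind L f) t 60 (\<lambda>t'. ?I (Suc i) (t'(37 := (t' 37)(0 := Suc i))))"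
    proof (rule exec_loop_free)
      have "(?e(37 := (?e 37)(0 := Suc i))) f = ?e f" "(?e(37 := (?e 37)(0 := Suc i))) L = ?e L" "(?e(37 := (?e 37)(0 := Suc i))) 26 = ?e 26"
        using d by auto
      then show "?I (Suc i) (?e(37 := (?e 37)(0 := Suc i)))" using e(1,3) L by simp
    qed (simp_all add: count_body_def differ_def)
  next
    fix i :: nat and t :: memory
    assume fr: "\<And>a. a \<notin> insert 37 (writes (count_body deg ind L f)) \<Longrightarrow> t a = s a"
    have "t V = s V" using d by (intro fr; auto simp: count_body_def)
    then show "expr_val (Var V) t = n" using V by simp
  qed (use d in \<open>auto simp: count_body_def\<close>)
  then show ?thesis by (rule exec_weaken) (simp_all add: F_def C_def)
qed

definition prep_prog :: program where
  "prep_prog =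
    Seq (Assign 25 (Plus (Plus (Var 0) (Var 7)) (Plus (Var 1) (Var 8))))
    (Seq mul_prog
    (Seq (For 37 (Var 1) (index_body 4 5 21 22 23))
    (Seq (For 37 (Var 8) (index_body 11 12 31 32 33))
    (Seq (Assign 26 (Const 2500))
    (Seq (For 37 (Var 0) (count_body 21 22 24 35))
    (Seq (For 37 (Var 7) (count_body 31 32 34 36))
    (Seq (Assign 27 (Plus (Var 1) (Var 8)))
    (Seq times_prog (Seq times_prog (Seq times_prog (Seq times_prog (Seq times_prog
    (Seq (Assign 29 (Plus (Var 27) (Plus (Var 27) (Var 27))))
    (Seq (Assign 28 (Plus (Var 29) (Var 27)))
    (Seq (Write 41 (Const 0) (Var 2)) (Seq (Write 42 (Const 0) (Var 9)) (Assign 51 (Const 1))))))))))))))))))"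

text \<open>Without edges the claimed time is constant, so not even a loop over the vertices is
  affordable. But then only the empty word can be accepted, and inspecting the two initial vertices
  decides.\<close>

definition solve_prog :: program where
  "solve_prog = IfLess (Const 0) (Plus (Var 1) (Var 8))
    (Seq prep_prog (Seq main_loop (Assign 0 (Var 61))))
    (IfLess (Const 0) (Read 3 (Var 2)) (IfLess (Const 0) (Read 10 (Var 9)) (Assign 0 (Const 1)) (Assign 0 (Const 0)))
      (Assign 0 (Const 0)))"

lemma writes_prep: "writes mul_prog = {37, 20, 38}" "writes times_prog = {38, 37, 27}"
  "writes (index_body a b d i l) = {38, l, d, i}" "writes (count_body d i l f) = {l, f, 26}"
  by (auto simp: mul_prog_def times_prog_def index_body_def count_body_def)

section \<open>Correctness of the tables\<close>

definition fibre :: "(nat \<Rightarrow> nat) \<Rightarrow> nat \<Rightarrow> nat \<Rightarrow> nat list" where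
  "fibre g n v = filter (\<lambda>e. g e = v) [0..<n]"

locale input =
  fixes s :: memory and V1 E1 V2 E2 :: nat
  assumes sizes: "s 0 0 = V1" "s 1 0 = E1" "s 7 0 = V2" "s 8 0 = E2"
    and zero: "14 \<le> a \<Longrightarrow> s a = (\<lambda>_. 0)"
    and tails: "e < E1 \<Longrightarrow> s 4 e < V1" "e < E2 \<Longrightarrow> s 11 e < V2"
begin

text \<open>The summand 2500 ensures that \<open>B = c ^ 5 * n\<close> exceeds the bound in \<open>long_trajectory\<close>.\<close>

definition N where "N = V1 + V2 + (E1 + E2)"
definition d1 where "d1 v = length (fibre (s 4) E1 v)"
definition i1 where "i1 v = length (fibre (s 5) E1 v)"
definition d2 where "d2 v = length (fibre (s 11) E2 v)"
definition i2 where "i2 v = length (fibre (s 12) E2 v)"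
definition weight where "weight d i n = (\<Sum>v<n::nat. if d v = 1 \<and> i v = 1 then 0 else d v + 1 :: nat)"
definition c where "c = 2500 + weight d1 i1 V1 + weight d2 i2 V2"
definition B where "B = c ^ 5 * (E1 + E2)"
definition forks where "forks d n = filter (\<lambda>v. 1 < d v) [0..<n::nat]" for d :: "nat \<Rightarrow> nat"

definition table where
  "table t a g n \<longleftrightarrow> (\<forall>v<N. map (\<lambda>k. t (a::nat) (v * N + k)) [0..<length (fibre g n v)] = fibre g n v)" for t :: memory

definition indexed1 where
  "indexed1 t \<longleftrightarrow> (\<forall>i<N. t 20 i = i * N) \<and> t 21 = d1 \<and> t 22 = i1 \<and> table t 23 (s 4) E1" for t :: memory
definition indexed2 where
  "indexed2 t \<longleftrightarrow> indexed1 t \<and> t 31 = d2 \<and> t 32 = i2 \<and> table t 33 (s 11) E2" for t :: memory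
definition counted1 where
  "counted1 t \<longleftrightarrow> indexed2 t \<and> t 35 0 = length (forks d1 V1) \<and> map (t 24) [0..<length (forks d1 V1)] = forks d1 V1" for t :: memory
definition counted2 where
  "counted2 t \<longleftrightarrow> counted1 t \<and> t 36 0 = length (forks d2 V2) \<and> map (t 34) [0..<length (forks d2 V2)] = forks d2 V2 \<and> t 26 0 = c" for t :: memory

definition prepared where
  "prepared t \<longleftrightarrow> counted2 t \<and> t 27 0 = B \<and> t 28 0 = 4 * B \<and> t 29 0 = 3 * B \<and> (\<forall>a<14. t a = s a) \<and>
     t 40 = (\<lambda>_. 0) \<and> t 50 0 = 0 \<and> t 61 0 = 0 \<and> t 51 0 = 1 \<and> t 41 0 = s 2 0 \<and> t 42 0 = s 9 0" for t :: memory

lemma sizes': "s 0 0 = V1" "s (Suc 0) 0 = E1" "s 7 0 = V2" "s 8 0 = E2"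
  using sizes by simp_all

lemma indexed1_cong: "indexed1 t \<Longrightarrow> (\<And>a. a \<in> {20, 21, 22, 23} \<Longrightarrow> u a = t a) \<Longrightarrow> indexed1 u"
  by (simp add: indexed1_def table_def)
lemma indexed2_cong: "indexed2 t \<Longrightarrow> (\<And>a. a \<in> {20, 21, 22, 23, 31, 32, 33} \<Longrightarrow> u a = t a) \<Longrightarrow> indexed2 u"
  by (auto simp: indexed2_def table_def intro: indexed1_cong)
lemma counted1_cong: "counted1 t \<Longrightarrow> (\<And>a. a \<in> {20, 21, 22, 23, 31, 32, 33, 35, 24} \<Longrightarrow> u a = t a) \<Longrightarrow> counted1 u"
  by (auto simp: counted1_def intro: indexed2_cong)
lemma counted2_cong: "counted2 t \<Longrightarrow> (\<And>a. a \<in> {20, 21, 22, 23, 31, 32, 33, 35, 24, 36, 34, 26} \<Longrightarrow> u a = t a) \<Longrightarrow> counted2 u"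
  by (auto simp: counted2_def intro: counted1_cong)

lemma step_final:
  assumes t: "counted2 t" "t 27 0 = B" "\<And>a. a < 14 \<or> 40 \<le> a \<Longrightarrow> t a = s a"
  shows "exec (Seq (Assign 29 (Plus (Var 27) (Plus (Var 27) (Var 27))))
    (Seq (Assign 28 (Plus (Var 29) (Var 27)))
    (Seq (Write 41 (Const 0) (Var 2)) (Seq (Write 42 (Const 0) (Var 9)) (Assign 51 (Const 1)))))) t 50 prepared"
proof (rule exec_loop_free)
  let ?u = "t(29 := (t 29)(0 := B + (B + B)), 28 := (t 28)(0 := B + (B + B) + B), 41 := (t 41)(0 := s 2 0), 42 := (t 42)(0 := s 9 0), 51 := (t 51)(0 := 1))"
  have io: "t 2 = s 2" "t 9 = s 9" "t 40 = s 40" "t 50 = s 50" "t 61 = s 61" by (simp_all add: t(3))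
  have "effect (Seq (Assign 29 (Plus (Var 27) (Plus (Var 27) (Var 27))))
    (Seq (Assign 28 (Plus (Var 29) (Var 27)))
    (Seq (Write 41 (Const 0) (Var 2)) (Seq (Write 42 (Const 0) (Var 9)) (Assign 51 (Const 1)))))) t = ?u"
    by (simp add: t(2) io)
  moreover have "counted2 ?u" using t(1) by (rule counted2_cong) auto
  moreover have "?u a = s a" if "a < 14" for a using that t(3)[of a] by auto
  ultimately show "prepared (effect (Seq (Assign 29 (Plus (Var 27) (Plus (Var 27) (Var 27))))
    (Seq (Assign 28 (Plus (Var 29) (Var 27)))
    (Seq (Write 41 (Const 0) (Var 2)) (Seq (Write 42 (Const 0) (Var 9)) (Assign 51 (Const 1)))))) t)"
    by (simp add: prepared_def t(2) io zero)
qed simp_all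

text \<open>One multiplication by \<open>c\<close> in continuation form: the remaining program
  \<open>P\<close> has to work from any state that the multiplication may produce.\<close>

lemma step_times:
  assumes t: "counted2 t" "c * t 27 0 = x" "\<And>a. a < 14 \<or> 40 \<le> a \<Longrightarrow> t a = s a"
    and P: "\<And>u. counted2 u \<Longrightarrow> u 27 0 = x \<Longrightarrow> (\<And>a. a < 14 \<or> 40 \<le> a \<Longrightarrow> u a = s a) \<Longrightarrow> exec P u T prepared"
  shows "exec (Seq times_prog P) t (c * 30 + 30 + T) prepared"
proof -
  have c: "t 26 0 = c" using t(1) by (simp add: counted2_def)
  have "exec times_prog t (c * 30 + 30) (\<lambda>u. u 27 0 = x)" using times_spec[of t] c t(2) by simp
  then show ?thesis
  proof (rule exec_Seq)
    fix u assume u: "u 27 0 = x" "\<And>a. a \<notin> writes times_prog \<Longrightarrow> u a = t a"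
    have "counted2 u" using t(1) by (rule counted2_cong) (rule u(2), auto simp: writes_prep)
    moreover have "u a = s a" if "a < 14 \<or> 40 \<le> a" for a
      using u(2)[of a] t(3)[OF that] that by (auto simp: writes_prep)
    ultimately show "exec P u T prepared" using P u(1) by blast
  qed
qed

lemma prep_spec: "exec prep_prog s (N * 200 + c * 150 + 400) prepared"
proof -
  let ?x = "E1 + E2"
  note final = step_final
  \<comment> \<open>The program is verified from its end; each stage presupposes the tables built so
    far and that the arrays still needed are as in the initial memory.\<close>
  have t5: "exec (Seq times_prog (Seq times_prog (Seq times_prog (Seq times_prog (Seq times_prog
    (Seq (Assign 29 (Plus (Var 27) (Plus (Var 27) (Var 27))))
    (Seq (Assign 28 (Plus (Var 29) (Var 27)))
    (Seq (Write 41 (Const 0) (Var 2)) (Seq (Write 42 (Const 0) (Var 9)) (Assign 51 (Const 1))))))))))) t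
    (c * 30 + 30 + (c * 30 + 30 + (c * 30 + 30 + (c * 30 + 30 + (c * 30 + 30 + 50))))) prepared"
    if t: "counted2 t" "t 27 0 = ?x" "\<And>a. a < 14 \<or> 40 \<le> a \<Longrightarrow> t a = s a" for t
    apply (rule step_times[where x = "c * ?x"], fact t(1), simp add: t(2), rule t(3), assumption)
    apply (rule step_times[where x = "c * (c * ?x)"], assumption, simp, blast)
    apply (rule step_times[where x = "c * (c * (c * ?x))"], assumption, simp, blast)
    apply (rule step_times[where x = "c * (c * (c * (c * ?x)))"], assumption, simp, blast)
    apply (rule step_times[where x = "c * (c * (c * (c * (c * ?x))))"], assumption, simp, blast)
    apply (rule step_final, assumption)
     apply (simp add: B_def numeral_eq_Suc mult.assoc)
    apply blast
    done
  define R3 where "R3 = (Seq (Assign 27 (Plus (Var 1) (Var 8))) (Seq times_prog (Seq times_prog (Seq times_prog (Seq times_prog (Seq times_prog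
    (Seq (Assign 29 (Plus (Var 27) (Plus (Var 27) (Var 27))))
    (Seq (Assign 28 (Plus (Var 29) (Var 27)))
    (Seq (Write 41 (Const 0) (Var 2)) (Seq (Write 42 (Const 0) (Var 9)) (Assign 51 (Const 1))))))))))))"
  have e3: "exec R3 t (c * 150 + 220) prepared"
    if t: "counted2 t" "\<And>a. a < 14 \<or> 40 \<le> a \<Longrightarrow> t a = s a" for t
  proof -
    let ?t = "t(27 := (t 27)(0 := ?x))"
    have io: "t (Suc 0) = s (Suc 0)" "t 8 = s 8" by (simp_all add: t(2))
    have c2: "counted2 ?t" using t(1) by (rule counted2_cong) auto
    have same: "?t a = s a" if "a < 14 \<or> 40 \<le> a" for a using t(2)[OF that] that by auto
    have "?t 27 0 = ?x" by simp
    from t5[of ?t, OF c2 this same]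
    have "exec R3 t (expr_steps (Const 0) + expr_steps (Plus (Var 1) (Var 8)) + 1 +
      (c * 30 + 30 + (c * 30 + 30 + (c * 30 + 30 + (c * 30 + 30 + (c * 30 + 30 + 50)))))) prepared"
      unfolding R3_def by (intro exec_Seq_Write) (simp add: io sizes')
    then show ?thesis by (rule exec_le) simp
  qed
  have e2: "exec (Seq (For 37 (Var 7) (count_body 31 32 34 36)) R3) t (V2 * 80 + 10 + (c * 150 + 220)) prepared"
    if t: "counted1 t" "t 26 0 = 2500 + weight d1 i1 V1" "\<And>a. a < 14 \<or> 40 \<le> a \<or> a \<in> {34, 36} \<Longrightarrow> t a = s a" for t
  proof -
    have io: "t 7 0 = V2" "t 36 0 = 0" by (simp_all add: t(3) sizes' zero)
    have dd: "t 31 = d2" "t 32 = i2" using t(1) by (auto simp: counted1_def indexed2_def)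
    have "exec (For 37 (Var 7) (count_body 31 32 34 36)) t (V2 * 80 + 10)
      (\<lambda>u. u 36 0 = length (forks d2 V2) \<and> map (u 34) [0..<length (forks d2 V2)] = forks d2 V2 \<and> u 26 0 = c)"
      by (rule exec_weaken[OF count_spec[of 7 31 32 34 36 t V2, unfolded dd]])
        (use io in \<open>simp_all add: t(2) forks_def weight_def c_def\<close>)
    then show ?thesis
    proof (rule exec_Seq)
      fix u assume u: "u 36 0 = length (forks d2 V2) \<and> map (u 34) [0..<length (forks d2 V2)] = forks d2 V2 \<and> u 26 0 = c"
        "\<And>a. a \<notin> writes (For 37 (Var 7) (count_body 31 32 34 36)) \<Longrightarrow> u a = t a"
      have "counted1 u" using t(1) by (rule counted1_cong) (rule u(2), auto simp: writes_prep)
      with u(1) have "counted2 u" by (simp add: counted2_def)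
      then show "exec R3 u (c * 150 + 220) prepared"
      proof (rule e3)
        fix a :: nat assume a: "a < 14 \<or> 40 \<le> a"
        then have "u a = t a" by (intro u(2)) (auto simp: writes_prep)
        with t(3)[of a] a show "u a = s a" by auto
      qed
    qed
  qed
  let ?R2 = "Seq (For 37 (Var 7) (count_body 31 32 34 36)) R3"
  let ?T2 = "V2 * 80 + 10 + (c * 150 + 220)"
  have e1: "exec (Seq (Assign 26 (Const 2500)) (Seq (For 37 (Var 0) (count_body 21 22 24 35)) ?R2)) t (10 + (V1 * 80 + 10 + ?T2)) prepared"
    if t: "indexed2 t" "\<And>a. a < 14 \<or> 40 \<le> a \<or> a \<in> {24, 34, 35, 36} \<Longrightarrow> t a = s a" for t
  proof -
    let ?t = "t(26 := (t 26)(0 := 2500))"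
    have io: "?t 0 0 = V1" "?t 35 0 = 0" by (simp_all add: t(2) sizes' zero)
    have dd: "?t 21 = d1" "?t 22 = i1" using t(1) by (auto simp: indexed2_def indexed1_def)
    have "exec (For 37 (Var 0) (count_body 21 22 24 35)) ?t (V1 * 80 + 10)
      (\<lambda>u. u 35 0 = length (forks d1 V1) \<and> map (u 24) [0..<length (forks d1 V1)] = forks d1 V1 \<and> u 26 0 = 2500 + weight d1 i1 V1)"
      by (rule exec_weaken[OF count_spec[of 0 21 22 24 35 ?t V1, unfolded dd]])
        (use io in \<open>simp_all add: forks_def weight_def\<close>)
    then have "exec (Seq (For 37 (Var 0) (count_body 21 22 24 35)) ?R2) ?t (V1 * 80 + 10 + ?T2) prepared"
    proof (rule exec_Seq)
      fix u assume u: "u 35 0 = length (forks d1 V1) \<and> map (u 24) [0..<length (forks d1 V1)] = forks d1 V1 \<and> u 26 0 = 2500 + weight d1 i1 V1"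
        "\<And>a. a \<notin> writes (For 37 (Var 0) (count_body 21 22 24 35)) \<Longrightarrow> u a = ?t a"
      have "indexed2 u" using t(1) by (rule indexed2_cong) (subst u(2), auto simp: writes_prep)
      with u(1) have "counted1 u" by (simp add: counted1_def)
      then show "exec ?R2 u ?T2 prepared"
      proof (rule e2)
        show "u 26 0 = 2500 + weight d1 i1 V1" using u(1) by blast
        fix a :: nat assume a: "a < 14 \<or> 40 \<le> a \<or> a \<in> {34, 36}"
        then have "u a = ?t a" by (intro u(2)) (auto simp: writes_prep)
        with t(2)[of a] a show "u a = s a" by auto
      qed
    qed
    then have "exec (Seq (Assign 26 (Const 2500)) (Seq (For 37 (Var 0) (count_body 21 22 24 35)) ?R2)) t
      (expr_steps (Const 0) + expr_steps (Const 2500) + 1 + (V1 * 80 + 10 + ?T2)) prepared"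
      by (intro exec_Seq_Write) simp
    then show ?thesis by (rule exec_le) simp
  qed
  let ?R1 = "Seq (Assign 26 (Const 2500)) (Seq (For 37 (Var 0) (count_body 21 22 24 35)) ?R2)"
  let ?T1 = "10 + (V1 * 80 + 10 + ?T2)"
  have tails': "e < E1 \<Longrightarrow> s 4 e < N" "e < E2 \<Longrightarrow> s 11 e < N" for e
    using tails[of e] by (auto simp: N_def)
  have e0: "exec (Seq (For 37 (Var 8) (index_body 11 12 31 32 33)) ?R1) t (E2 * 60 + 10 + ?T1) prepared"
    if t: "indexed1 t" "\<And>a. a < 14 \<or> 40 \<le> a \<or> a \<in> {24, 31, 32, 33, 34, 35, 36} \<Longrightarrow> t a = s a" for t
  proof -
    have io: "t 8 0 = E2" "t 11 = s 11" "t 12 = s 12" "t 31 = (\<lambda>_. 0)" "t 32 = (\<lambda>_. 0)" by (simp_all add: t(2) sizes' zero)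
    have mul: "\<And>i. i < N \<Longrightarrow> t 20 i = i * N" using t(1) by (simp add: indexed1_def)
    have "exec (For 37 (Var 8) (index_body 11 12 31 32 33)) t (E2 * 60 + 10) (\<lambda>u. u 31 = d2 \<and> u 32 = i2 \<and> table u 33 (s 11) E2)"
      by (rule exec_weaken[OF index_spec[of 8 11 12 31 32 33 t E2 N]])
        (use io mul tails' in \<open>auto simp: d2_def i2_def fibre_def table_def N_def fun_eq_iff\<close>)
    then show ?thesis
    proof (rule exec_Seq)
      fix u assume u: "u 31 = d2 \<and> u 32 = i2 \<and> table u 33 (s 11) E2"
        "\<And>a. a \<notin> writes (For 37 (Var 8) (index_body 11 12 31 32 33)) \<Longrightarrow> u a = t a"
      have "indexed1 u" using t(1) by (rule indexed1_cong) (rule u(2), auto simp: writes_prep)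
      with u(1) have "indexed2 u" by (simp add: indexed2_def)
      then show "exec ?R1 u ?T1 prepared"
      proof (rule e1)
        fix a :: nat assume a: "a < 14 \<or> 40 \<le> a \<or> a \<in> {24, 34, 35, 36}"
        then have "u a = t a" by (intro u(2)) (auto simp: writes_prep)
        with t(2)[of a] a show "u a = s a" by auto
      qed
    qed
  qed
  let ?R0 = "Seq (For 37 (Var 8) (index_body 11 12 31 32 33)) ?R1"
  let ?T0 = "E2 * 60 + 10 + ?T1"
  have em: "exec (Seq (For 37 (Var 1) (index_body 4 5 21 22 23)) ?R0) t (E1 * 60 + 10 + ?T0) prepared"
    if t: "\<forall>i<N. t 20 i = i * N" "\<And>a. a \<notin> {20, 25, 37, 38} \<Longrightarrow> t a = s a" for t
  proof -
    have io: "t 1 0 = E1" "t 4 = s 4" "t 5 = s 5" "t 21 = (\<lambda>_. 0)" "t 22 = (\<lambda>_. 0)" by (simp_all add: t(2) sizes' zero)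
    have "exec (For 37 (Var 1) (index_body 4 5 21 22 23)) t (E1 * 60 + 10) (\<lambda>u. u 21 = d1 \<and> u 22 = i1 \<and> table u 23 (s 4) E1)"
      by (rule exec_weaken[OF index_spec[of 1 4 5 21 22 23 t E1 N]])
        (use io t(1) tails' in \<open>auto simp: d1_def i1_def fibre_def table_def N_def fun_eq_iff\<close>)
    then show ?thesis
    proof (rule exec_Seq)
      fix u assume u: "u 21 = d1 \<and> u 22 = i1 \<and> table u 23 (s 4) E1"
        "\<And>a. a \<notin> writes (For 37 (Var 1) (index_body 4 5 21 22 23)) \<Longrightarrow> u a = t a"
      have "u 20 = t 20" by (rule u(2)) (simp add: writes_prep)
      with u(1) t(1) have "indexed1 u" by (simp add: indexed1_def)
      then show "exec ?R0 u ?T0 prepared"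
      proof (rule e0)
        fix a :: nat assume a: "a < 14 \<or> 40 \<le> a \<or> a \<in> {24, 31, 32, 33, 34, 35, 36}"
        then have "u a = t a" by (intro u(2)) (auto simp: writes_prep)
        moreover have "t a = s a" using a by (intro t(2)) auto
        ultimately show "u a = s a" by simp
      qed
    qed
  qed
  let ?Rm = "Seq (For 37 (Var 1) (index_body 4 5 21 22 23)) ?R0"
  let ?Tm = "E1 * 60 + 10 + ?T0"
  let ?s = "s(25 := (s 25)(0 := N))"
  have "exec mul_prog ?s (N * 40 + 10) (\<lambda>t. \<forall>i<N. t 20 i = i * N)"
    by (rule mul_spec) (simp_all add: zero)
  then have "exec (Seq mul_prog ?Rm) ?s (N * 40 + 10 + ?Tm) prepared"
  proof (rule exec_Seq)
    fix u assume u: "\<forall>i<N. u 20 i = i * N" "\<And>a. a \<notin> writes mul_prog \<Longrightarrow> u a = ?s a"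
    show "exec ?Rm u ?Tm prepared"
      by (rule em[of u, OF u(1)]) (subst u(2), auto simp: writes_prep)
  qed
  then have "exec prep_prog s (expr_steps (Const 0) + expr_steps (Plus (Plus (Var 0) (Var 7)) (Plus (Var 1) (Var 8))) + 1 + (N * 40 + 10 + ?Tm)) prepared"
    unfolding prep_prog_def R3_def by (intro exec_Seq_Write) (simp add: sizes' N_def)
  then show ?thesis by (rule exec_le) (simp add: N_def)
qed

end

section \<open>Correctness and running time\<close>

locale automaton =
  fixes Sig :: "nat set" and A :: "(nat, nat, nat) fsa"
  assumes deterministic: "deterministic_fsa Sig A" and numbered: "numbered A"
begin

abbreviation G where "G \<equiv> graph_of A"
definition nv where "nv = card (verts G)"
definition ne where "ne = card (arcs G)"

sublocale fin_digraph G
  using deterministic by (simp add: deterministic_fsa_def is_fsa_def)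

lemma verts_eq: "verts G = {..<nv}" and arcs_eq: "arcs G = {..<ne}"
proof -
  obtain k l where kl: "verts G = {..<k}" "arcs G = {..<l}" using numbered unfolding numbered_def by blast
  then have "nv = k" "ne = l" unfolding nv_def ne_def by simp_all
  with kl show "verts G = {..<nv}" "arcs G = {..<ne}" by simp_all
qed

lemma initial_lt: "initial A < nv"
  using deterministic verts_eq by (auto simp: deterministic_fsa_def is_fsa_def)

lemma letter_inj: "\<lbrakk>e \<in> arcs G; f \<in> arcs G; tail G e = tail G f; letter A e = letter A f\<rbrakk> \<Longrightarrow> e = f"
proof -
  assume ef: "e \<in> arcs G" "f \<in> arcs G" "tail G e = tail G f" "letter A e = letter A f"
  have "inj_on (letter A) (out_arcs G (tail G f))"
    using deterministic tail_in_verts[OF ef(2)] by (simp add: deterministic_fsa_def forwards_immersion_def)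
  then show "e = f" by (rule inj_onD) (use ef in simp_all)
qed

text \<open>The value 0 outside the edges is that of the arrays in
  \<open>fsa_arrays\<close>.\<close>

definition ta where "ta e = (if e \<in> arcs G then tail G e else 0)"
definition he where "he e = (if e \<in> arcs G then head G e else 0)"

lemma ta_lt: "e < ne \<Longrightarrow> ta e < nv" and he_lt: "he e < nv"
proof -
  show "ta e < nv" if "e < ne" using that tail_in_verts[of e] by (simp add: ta_def verts_eq arcs_eq)
  show "he e < nv" using head_in_verts[of e] initial_lt by (auto simp: he_def verts_eq)
qed

lemma set_fibre_ta: "set (fibre ta ne v) = out_arcs G v"
  unfolding fibre_def ta_def out_arcs_def arcs_eq by auto

lemma set_fibre_he: "set (fibre he ne v) = in_arcs G v"
  unfolding fibre_def he_def in_arcs_def arcs_eq by auto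

lemma distinct_fibre: "distinct (fibre g n v)"
  by (simp add: fibre_def)

lemma length_fibre_ta: "length (fibre ta ne v) = out_degree G v"
  using distinct_card[OF distinct_fibre, of ta ne v] by (simp add: set_fibre_ta out_degree_def)

lemma length_fibre_he: "length (fibre he ne v) = in_degree G v"
  using distinct_card[OF distinct_fibre, of he ne v] by (simp add: set_fibre_he in_degree_def)

lemma out_degree_0: "nv \<le> v \<Longrightarrow> out_degree G v = 0"
proof -
  assume v: "nv \<le> v"
  have "out_arcs G v = {}"
  proof (rule ccontr)
    assume "out_arcs G v \<noteq> {}"
    then obtain e where "e \<in> arcs G" "tail G e = v" by (metis ex_in_conv in_out_arcs_conv)
    with tail_in_verts[of e] v show False by (simp add: verts_eq)
  qed
  then show ?thesis by (simp add: out_degree_def)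
qed

definition plain :: "nat \<Rightarrow> bool" where
  "plain v \<longleftrightarrow> out_degree G v = 1 \<and> in_degree G v = 1"

text \<open>The edges at \<open>x\<close>, the vertex where a trajectory begins, are included so
  that its first edge opens a segment. If \<open>x\<close> is plain this adds at most one
  edge.\<close>

definition starts :: "nat \<Rightarrow> nat set" where
  "starts x = {e \<in> arcs G. tail G e = x \<or> \<not> plain (tail G e)}"

lemma branching_eq: "branching = (\<Sum>v<nv. if plain v then 0 else out_degree G v + 1)"
  by (simp add: branching_def plain_def verts_eq)

lemma card_starts: "card (starts x) \<le> branching + 1"
proof -
  define X where "X = {v \<in> verts G. \<not> plain v}"
  have "starts x \<subseteq> (\<Union>v\<in>X. out_arcs G v) \<union> (if plain x then out_arcs G x else {})"
    using tail_in_verts by (auto simp: starts_def X_def)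
  then have "card (starts x) \<le> card ((\<Union>v\<in>X. out_arcs G v) \<union> (if plain x then out_arcs G x else {}))"
    by (intro card_mono) (auto simp: X_def)
  also have "\<dots> \<le> card (\<Union>v\<in>X. out_arcs G v) + card (if plain x then out_arcs G x else {})"
    by (rule card_Un_le)
  also have "\<dots> \<le> (\<Sum>v\<in>X. out_degree G v) + 1"
    by (intro add_mono) (auto simp: X_def out_degree_def plain_def intro!: card_UN_le)
  also have "(\<Sum>v\<in>X. out_degree G v) \<le> branching"
    unfolding branching_def X_def plain_def
    by (simp add: sum.inter_filter) (rule sum_mono, simp)
  finally show ?thesis by simp
qed

lemma plain_out: "\<lbrakk>plain (tail G e); e \<in> arcs G; f \<in> arcs G; tail G f = tail G e\<rbrakk> \<Longrightarrow> f = e"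
  unfolding plain_def out_degree_def
  by (metis card_1_singletonE in_out_arcs_conv singletonD)

lemma plain_in: "\<lbrakk>plain (head G e); e \<in> arcs G; f \<in> arcs G; head G f = head G e\<rbrakk> \<Longrightarrow> f = e"
  unfolding plain_def in_degree_def
  by (metis card_1_singletonE in_in_arcs_conv singletonD)

lemma one_out: "\<lbrakk>out_degree G v \<le> 1; e \<in> arcs G; f \<in> arcs G; tail G e = v; tail G f = v\<rbrakk> \<Longrightarrow> e = f"
proof -
  assume d: "out_degree G v \<le> 1" "e \<in> arcs G" "f \<in> arcs G" "tail G e = v" "tail G f = v"
  have "finite (out_arcs G v)" by (simp add: out_arcs_def)
  moreover have "card (out_arcs G v) \<le> Suc 0" using d(1) by (simp add: out_degree_def)
  ultimately have "\<forall>e\<in>out_arcs G v. \<forall>f\<in>out_arcs G v. e = f" using card_le_Suc0_iff_eq by blast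
  moreover have "e \<in> out_arcs G v" "f \<in> out_arcs G v" using d(2-5) by simp_all
  ultimately show "e = f" by blast
qed

text \<open>Outside \<open>starts\<close> the tail of an edge is plain: the single edge entering it
  gives \<open>pred\<close> and the single edge leaving it gives \<open>forced\<close>.\<close>

lemma walk_track:
  assumes e: "\<And>k. k < K \<Longrightarrow> e k \<in> arcs G" "\<And>k. Suc k < K \<Longrightarrow> tail G (e (Suc k)) = head G (e k)"
    and K: "0 < K" and W: "\<And>k. k < K \<Longrightarrow> W k = letter A (e k)"
  shows "track e (starts (tail G (e 0))) W K"
proof
  show "e 0 \<in> starts (tail G (e 0))" using e(1)[OF K] by (simp add: starts_def)
next
  fix i j assume ij: "Suc i < K" "Suc j < K" "e (Suc i) = e (Suc j)" "e (Suc i) \<notin> starts (tail G (e 0))"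
  then have "plain (tail G (e (Suc i)))" using e(1) by (auto simp: starts_def)
  then have "plain (head G (e j))" "head G (e i) = head G (e j)" using e(2)[OF ij(1)] e(2)[OF ij(2)] ij(3) by simp_all
  then show "e i = e j" using plain_in e(1) ij(1,2) by simp
next
  fix i j assume ij: "Suc i < K" "Suc j < K" "e i = e j" "e (Suc i) \<notin> starts (tail G (e 0))"
  then have "plain (tail G (e (Suc i)))" using e(1) by (auto simp: starts_def)
  then show "e (Suc j) = e (Suc i)" using plain_out e(1) e(2)[OF ij(1)] e(2)[OF ij(2)] ij(1-3) by simp
next
  fix i j assume ij: "Suc i < K" "Suc j < K" "e i = e j" "W (Suc i) = W (Suc j)"
  then show "e (Suc i) = e (Suc j)"
    using letter_inj e(1) e(2)[OF ij(1)] e(2)[OF ij(2)] W by simp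
next
  fix i j assume "i < K" "j < K" "e i = e j"
  then show "W i = W j" using W by simp
qed

text \<open>The edge seen once per period has a plain tail, which is therefore seen only once per
  period as well; so \<open>max_gap_eq\<close> applies to the vertices.\<close>

lemma once_periodic_gap:
  assumes op: "once_periodic e (starts x) p B (4 * B)" and e: "\<And>k. k < 4 * B \<Longrightarrow> e k \<in> arcs G"
    and v: "\<And>i. i < 3 * B \<Longrightarrow> v i = tail G (e (B + i))"
  obtains z where "0 < z" "z \<le> B" "p dvd z" "\<And>k. B \<le> k \<Longrightarrow> k + z < 4 * B \<Longrightarrow> e (k + z) = e k" "max_gap v (3 * B) = z"
proof -
  from op obtain z k where z: "0 < z" "z \<le> B" "p dvd z" "\<And>k. B \<le> k \<Longrightarrow> k + z < 4 * B \<Longrightarrow> e (k + z) = e k"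
    and k: "B \<le> k" "k < B + z" "e k \<notin> starts x" "\<And>k'. k < k' \<Longrightarrow> k' < k + z \<Longrightarrow> e k' \<noteq> e k"
    unfolding once_periodic_def by blast
  have kz: "k - B + z < 3 * B" using k z by linarith
  have "max_gap v (3 * B) = z"
  proof (rule max_gap_eq[where k = "k - B"])
    show "v (i + z) = v i" if "i + z < 3 * B" for i
    proof -
      have "e (B + i + z) = e (B + i)" using that by (intro z(4)) simp_all
      then show ?thesis using that v[of i] v[of "i + z"] by (simp add: add.assoc)
    qed
    fix k' assume k': "k - B < k'" "k' < k - B + z"
    show "v k' \<noteq> v (k - B)"
    proof
      assume "v k' = v (k - B)"
      moreover have "v k' = tail G (e (B + k'))" using v k' kz by simp
      moreover have "v (k - B) = tail G (e k)" using v[of "k - B"] k kz by simp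
      ultimately have "tail G (e (B + k')) = tail G (e k)" by simp
      moreover have lt: "k < 4 * B" "B + k' < 4 * B" using k k' kz by linarith+
      moreover have "plain (tail G (e k))" using k(3) e[OF lt(1)] by (auto simp: starts_def)
      ultimately have "e (B + k') = e k" using plain_out e by simp
      moreover have "k < B + k'" "B + k' < k + z" using k k' by linarith+
      ultimately show False using k(4) by blast
    qed
  qed (use z kz in auto)
  with z show ?thesis by (rule that)
qed

end

text \<open>Bezout's identity \<open>m * x = n * y + gcd m n\<close>, multiplied by the quotient of
  \<open>j - i\<close> by the gcd, gives a common solution. Natural numbers require the distinction
  of \<open>i \<le> j\<close>.\<close>

lemma common_residue:
  fixes m n i j :: nat
  assumes "0 < m" "0 < n" "i < m" "j < n" "i mod gcd m n = j mod gcd m n"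
  obtains r where "r mod m = i" "r mod n = j"
proof -
  have main: "\<exists>r. r mod m = i \<and> r mod n = j" if le: "i \<le> j" and mn: "0 < m" "0 < n" "i < m" "j < n" "i mod gcd m n = j mod gcd m n" for m n i j :: nat
  proof -
    have "gcd m n dvd j - i" using mn(5) le by (metis mod_eq_dvd_iff_nat)
    then obtain q where q: "j - i = gcd m n * q" by auto
    obtain x y where xy: "m * x = n * y + gcd m n" using bezout_nat[of m n] mn(1) by auto
    have "(i + m * (x * q)) mod m = i" using mn by simp
    moreover have "i + m * (x * q) = j + n * (y * q)"
    proof -
      have "m * (x * q) = (n * y + gcd m n) * q" using xy by (simp add: mult.assoc[symmetric])
      then show ?thesis using q le by (simp add: algebra_simps)
    qed
    ultimately show ?thesis using mn by (metis mod_less mod_mult_self2)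
  qed
  show ?thesis
  proof (cases "i \<le> j")
    case True
    then show ?thesis using main[OF True assms] that by blast
  next
    case False
    then show ?thesis using main[of j i n m] assms that by (auto simp: gcd.commute)
  qed
qed

locale automata = G: automaton Sig \<Gamma> + H: automaton Sig \<Lambda> for Sig \<Gamma> \<Lambda>
begin

abbreviation inp where "inp \<equiv> input_memory \<Gamma> \<Lambda>"

lemma inp_0: "inp 0 = (\<lambda>i. if i = 0 then G.nv else 0)" "inp (Suc 0) = (\<lambda>i. if i = 0 then G.ne else 0)"
    "inp 2 = (\<lambda>i. if i = 0 then initial \<Gamma> else 0)" "inp 3 = (\<lambda>i. if i \<in> finals \<Gamma> then 1 else 0)"
    "inp 4 = G.ta" "inp 5 = G.he" "inp 6 = (\<lambda>i. if i \<in> arcs G.G then letter \<Gamma> i else 0)"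
    "inp 7 = (\<lambda>i. if i = 0 then H.nv else 0)" "inp 8 = (\<lambda>i. if i = 0 then H.ne else 0)"
    "inp 9 = (\<lambda>i. if i = 0 then initial \<Lambda> else 0)" "inp 10 = (\<lambda>i. if i \<in> finals \<Lambda> then 1 else 0)"
    "inp 11 = H.ta" "inp 12 = H.he" "inp 13 = (\<lambda>i. if i \<in> arcs H.G then letter \<Lambda> i else 0)"
  by (simp_all add: input_memory_def fsa_arrays_def Let_def G.nv_def G.ne_def H.nv_def H.ne_def fun_eq_iff
      G.ta_def G.he_def H.ta_def H.he_def nth_append)

sublocale input inp G.nv G.ne H.nv H.ne
  by unfold_locales (simp_all add: inp_0 G.ta_lt H.ta_lt, simp add: input_memory_def fsa_arrays_def Let_def fun_eq_iff)

lemma degrees: "d1 = out_degree G.G" "i1 = in_degree G.G" "d2 = out_degree H.G" "i2 = in_degree H.G"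
  by (simp_all add: fun_eq_iff d1_def i1_def d2_def i2_def inp_0 G.length_fibre_ta G.length_fibre_he H.length_fibre_ta H.length_fibre_he)

lemma weights: "weight d1 i1 G.nv = G.branching" "weight d2 i2 H.nv = H.branching"
  by (simp_all add: weight_def degrees G.branching_eq G.plain_def H.branching_eq H.plain_def)

lemma c_eq: "c = 2500 + G.branching + H.branching"
  by (simp add: c_def weights)

text \<open>Vertices of out-degree above 1 are not plain, so their degrees are counted in
  \<open>branching\<close>.\<close>

lemma fork_degrees: "(\<Sum>v\<in>{v. v < N \<and> 1 < out_degree G.G v}. out_degree G.G v) \<le> c"
  "(\<Sum>v\<in>{v. v < N \<and> 1 < out_degree H.G v}. out_degree H.G v) \<le> c"
proof -
  have *: "(\<Sum>v\<in>{v. v < N \<and> 1 < d v}. d v) \<le> (\<Sum>v<n. if d v = 1 \<and> i v = 1 then 0 else d v + 1)"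
    if "\<And>v. n \<le> v \<Longrightarrow> d v = 0" for d i :: "nat \<Rightarrow> nat" and n
  proof -
    have "(\<Sum>v\<in>{v. v < N \<and> 1 < d v}. d v) \<le> (\<Sum>v\<in>{v. v < N \<and> 1 < d v}. if d v = 1 \<and> i v = 1 then 0 else d v + 1)"
      by (rule sum_mono) auto
    also have "\<dots> \<le> (\<Sum>v<n. if d v = 1 \<and> i v = 1 then 0 else d v + 1)"
    proof (rule sum_mono2)
      show "{v. v < N \<and> 1 < d v} \<subseteq> {..<n}" using that by (force simp: not_le[symmetric])
    qed auto
    finally show ?thesis .
  qed
  show "(\<Sum>v\<in>{v. v < N \<and> 1 < out_degree G.G v}. out_degree G.G v) \<le> c"
    using *[where d = "out_degree G.G" and i = "in_degree G.G" and n = G.nv, OF G.out_degree_0]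
    unfolding c_eq G.branching_eq G.plain_def by linarith
  show "(\<Sum>v\<in>{v. v < N \<and> 1 < out_degree H.G v}. out_degree H.G v) \<le> c"
    using *[where d = "out_degree H.G" and i = "in_degree H.G" and n = H.nv, OF H.out_degree_0]
    unfolding c_eq H.branching_eq H.plain_def by linarith
qed

lemma degree_le: "v < N \<Longrightarrow> out_degree G.G v \<le> c" "v < N \<Longrightarrow> out_degree H.G v \<le> c"
proof -
  have *: "d v \<le> c" if "v < N" "(\<Sum>v\<in>{v. v < N \<and> 1 < d v}. d v) \<le> c" for d :: "nat \<Rightarrow> nat" and v
  proof (cases "1 < d v")
    case True
    then have "d v \<le> (\<Sum>v\<in>{v. v < N \<and> 1 < d v}. d v)" using that(1) by (intro member_le_sum) auto
    with that(2) show ?thesis by linarith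
  qed (simp add: c_eq)
  show "v < N \<Longrightarrow> out_degree G.G v \<le> c" using *[OF _ fork_degrees(1)] .
  show "v < N \<Longrightarrow> out_degree H.G v \<le> c" using *[OF _ fork_degrees(2)] .
qed

lemma fork_set: "set (forks d1 G.nv) = {x. x < N \<and> 1 < out_degree G.G x}"
  "set (forks d2 H.nv) = {x. x < N \<and> 1 < out_degree H.G x}"
proof -
  have "x < G.nv" if "1 < out_degree G.G x" for x using that G.out_degree_0[of x] by (cases "x < G.nv") auto
  then show "set (forks d1 G.nv) = {x. x < N \<and> 1 < out_degree G.G x}" by (force simp: forks_def degrees N_def)
  have "x < H.nv" if "1 < out_degree H.G x" for x using that H.out_degree_0[of x] by (cases "x < H.nv") auto
  then show "set (forks d2 H.nv) = {x. x < N \<and> 1 < out_degree H.G x}" by (force simp: forks_def degrees N_def)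
qed

lemma fork_length: "length (forks d1 G.nv) \<le> c" "length (forks d2 H.nv) \<le> c"
proof -
  have *: "length xs \<le> c" if xs: "distinct xs" "set xs = {v. v < N \<and> 1 < d v}" and le: "(\<Sum>v\<in>{v. v < N \<and> 1 < d v}. d v) \<le> c"
    for xs and d :: "nat \<Rightarrow> nat"
  proof -
    have "length xs = (\<Sum>v\<in>{v. v < N \<and> 1 < d v}. 1)" using distinct_card[OF xs(1)] xs(2) by simp
    also have "\<dots> \<le> (\<Sum>v\<in>{v. v < N \<and> 1 < d v}. d v)" by (rule sum_mono) auto
    finally show ?thesis using le by linarith
  qed
  show "length (forks d1 G.nv) \<le> c" by (rule *[OF _ fork_set(1) fork_degrees(1)]) (simp add: forks_def)
  show "length (forks d2 H.nv) \<le> c" by (rule *[OF _ fork_set(2) fork_degrees(2)]) (simp add: forks_def)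
qed

end

lemma length_filter_le_1:
  "distinct xs \<Longrightarrow> (\<And>x y. x \<in> set xs \<Longrightarrow> y \<in> set xs \<Longrightarrow> P x \<Longrightarrow> P y \<Longrightarrow> x = y) \<Longrightarrow> length (filter P xs) \<le> 1"
proof -
  assume d: "distinct xs" and eq: "\<And>x y. x \<in> set xs \<Longrightarrow> y \<in> set xs \<Longrightarrow> P x \<Longrightarrow> P y \<Longrightarrow> x = y"
  have "card (set (filter P xs)) \<le> Suc 0" by (subst card_le_Suc0_iff_eq) (auto intro: eq)
  then show ?thesis using distinct_card[of "filter P xs"] d by simp
qed

lemma concat_map_if: "concat (map (\<lambda>x. if P x then [g x] else []) xs) = map g (filter P xs)"
  by (induction xs) auto

locale prepared_automata = automata +
  fixes t :: memory
  assumes t: "prepared t" and edges: "0 < G.ne + H.ne"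
begin

lemma tabs: "\<And>v. v < N \<Longrightarrow> t 20 v = v * N" "t 21 = out_degree G.G" "t 31 = out_degree H.G"
  "table t 23 G.ta G.ne" "table t 33 H.ta H.ne" "t 35 0 = length (forks d1 G.nv)" "t 36 0 = length (forks d2 H.nv)"
  "map (t 24) [0..<length (forks d1 G.nv)] = forks d1 G.nv" "map (t 34) [0..<length (forks d2 H.nv)] = forks d2 H.nv"
  using t by (auto simp: prepared_def counted2_def counted1_def indexed2_def indexed1_def degrees[symmetric] inp_0[symmetric])

lemma same: "a < 14 \<Longrightarrow> t a = inp a"
  using t by (simp add: prepared_def)

lemma B_pos: "0 < B" using edges by (simp add: B_def c_eq)

sublocale fork_lists t N c B "length (forks d1 G.nv)" "length (forks d2 H.nv)"
proof (unfold_locales)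
  show "t 24 ` {..<length (forks d1 G.nv)} = {x. x < N \<and> 1 < t 21 x}"
    using arg_cong[where f = set, OF tabs(8)] unfolding set_map set_upt atLeast0LessThan fork_set tabs(2) .
  show "t 34 ` {..<length (forks d2 H.nv)} = {x. x < N \<and> 1 < t 31 x}"
    using arg_cong[where f = set, OF tabs(9)] unfolding set_map set_upt atLeast0LessThan fork_set tabs(3) .
  show "t 5 e < N" for e using G.he_lt[of e] by (simp add: same inp_0 N_def)
  show "t 12 e < N" for e using H.he_lt[of e] by (simp add: same inp_0 N_def)
  show "t 27 0 = B" "t 28 0 = 4 * B" "t 29 0 = 3 * B" using t by (simp_all add: prepared_def)
qed (simp_all add: tabs degree_le fork_length B_pos)

lemma dfork_iff: "dfork p \<longleftrightarrow> 1 < out_degree G.G (fst p) \<and> 1 < out_degree H.G (snd p)"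
  by (simp add: dfork_def tabs)

lemma final_iff: "final p \<longleftrightarrow> fst p \<in> finals \<Gamma> \<and> snd p \<in> finals \<Lambda>"
  by (simp add: final_def same inp_0)

lemma succs_eq:
  assumes "valid p"
  shows "succs p = concat (map (\<lambda>e. map (\<lambda>f. (head G.G e, head H.G f)) (filter (\<lambda>f. letter \<Gamma> e = letter \<Lambda> f) (fibre H.ta H.ne (snd p))))
    (fibre G.ta G.ne (fst p)))"
proof -
  define h where "h e f = (if t 6 e = t 13 f then [(t 5 e, t 12 f)] else [])" for e f
  have p: "fst p < N" "snd p < N" using assms by (simp_all add: valid_def)
  have 1: "map (\<lambda>i. t 23 (t 20 (fst p) + i)) [0..<t 21 (fst p)] = fibre G.ta G.ne (fst p)"
    using tabs(4) p(1) by (simp add: table_def tabs G.length_fibre_ta)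
  have 2: "map (\<lambda>i. t 33 (t 20 (snd p) + i)) [0..<t 31 (snd p)] = fibre H.ta H.ne (snd p)"
    using tabs(5) p(2) by (simp add: table_def tabs H.length_fibre_ta)
  have "row p i (t 31 (snd p)) = concat (map (h (t 23 (t 20 (fst p) + i))) (fibre H.ta H.ne (snd p)))" for i
    unfolding row_def 2[symmetric] map_map by (simp add: h_def Let_def comp_def)
  then have "succs p = concat (map (\<lambda>e. concat (map (h e) (fibre H.ta H.ne (snd p)))) (fibre G.ta G.ne (fst p)))"
    unfolding succs_def 1[symmetric] map_map by (simp add: comp_def)
  also have "map (\<lambda>e. concat (map (h e) (fibre H.ta H.ne (snd p)))) (fibre G.ta G.ne (fst p)) =
    map (\<lambda>e. map (\<lambda>f. (head G.G e, head H.G f)) (filter (\<lambda>f. letter \<Gamma> e = letter \<Lambda> f) (fibre H.ta H.ne (snd p)))) (fibre G.ta G.ne (fst p))"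
  proof (rule map_cong[OF refl])
    fix e assume "e \<in> set (fibre G.ta G.ne (fst p))"
    then have e: "e \<in> arcs G.G" by (simp add: G.set_fibre_ta)
    have "map (h e) (fibre H.ta H.ne (snd p)) = map (\<lambda>f. if letter \<Gamma> e = letter \<Lambda> f then [(head G.G e, head H.G f)] else []) (fibre H.ta H.ne (snd p))"
      using e by (intro map_cong) (auto simp: H.set_fibre_ta h_def same inp_0 G.he_def H.he_def)
    then show "concat (map (h e) (fibre H.ta H.ne (snd p))) =
      map (\<lambda>f. (head G.G e, head H.G f)) (filter (\<lambda>f. letter \<Gamma> e = letter \<Lambda> f) (fibre H.ta H.ne (snd p)))"
      by (simp only: concat_map_if)
  qed
  finally show ?thesis .
qed

lemma succs_iff:
  assumes "valid p"
  shows "q \<in> set (succs p) \<longleftrightarrow> (\<exists>e f. e \<in> arcs G.G \<and> f \<in> arcs H.G \<and> tail G.G e = fst p \<and> tail H.G f = snd p \<and>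
    letter \<Gamma> e = letter \<Lambda> f \<and> q = (head G.G e, head H.G f))"
  unfolding succs_eq[OF assms] by (auto simp: G.set_fibre_ta H.set_fibre_ta) blast

text \<open>One component has at most one outgoing edge; its letter and determinism leave at most
  one edge in the other.\<close>

lemma succs_unique:
  assumes p: "valid p" "\<not> dfork p"
  shows "length (succs p) \<le> 1"
proof -
  define xs where "xs = fibre G.ta G.ne (fst p)"
  define ys where "ys = fibre H.ta H.ne (snd p)"
  have xs: "distinct xs" "set xs = out_arcs G.G (fst p)" and ys: "distinct ys" "set ys = out_arcs H.G (snd p)"
    by (simp_all add: xs_def ys_def G.distinct_fibre H.distinct_fibre G.set_fibre_ta H.set_fibre_ta)
  have "length xs \<le> 1 \<or> length ys \<le> 1"
    using p(2) by (auto simp: dfork_iff xs_def ys_def G.length_fibre_ta H.length_fibre_ta not_less)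
  then consider "xs = [] \<or> ys = []" | e where "xs = [e]" | f where "ys = [f]"
    by (cases xs; cases ys) auto
  then show ?thesis
  proof cases
    case 1
    then show ?thesis unfolding succs_eq[OF p(1)] xs_def[symmetric] ys_def[symmetric]
      by (auto simp: concat_eq_Nil_conv[THEN iffD2])
  next
    case 2
    have "length (filter (\<lambda>f. letter \<Gamma> e = letter \<Lambda> f) ys) \<le> 1"
      using ys H.letter_inj by (intro length_filter_le_1) auto
    then show ?thesis unfolding succs_eq[OF p(1)] xs_def[symmetric] ys_def[symmetric] by (simp add: 2)
  next
    case 3
    have "length (filter (\<lambda>e. letter \<Gamma> e = letter \<Lambda> f) xs) \<le> 1"
      using xs G.letter_inj by (intro length_filter_le_1) auto
    moreover have "concat (map (\<lambda>e. map (\<lambda>f. (head G.G e, head H.G f)) (filter (\<lambda>f. letter \<Gamma> e = letter \<Lambda> f) [f])) xs)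
      = map (\<lambda>e. (head G.G e, head H.G f)) (filter (\<lambda>e. letter \<Gamma> e = letter \<Lambda> f) xs)"
      by (subst concat_map_if[symmetric]) (rule arg_cong[where f = concat], rule map_cong, simp_all)
    ultimately show ?thesis unfolding succs_eq[OF p(1)] xs_def[symmetric] ys_def[symmetric] by (simp add: 3)
  qed
qed

end

lemma periodic_mod:
  fixes g :: "nat \<Rightarrow> 'a"
  assumes per: "\<And>k. B \<le> k \<Longrightarrow> k + z < K \<Longrightarrow> g (k + z) = g k" and z: "0 < z" and i: "B + i < K"
  shows "g (B + i) = g (B + i mod z)"
  using i
proof (induction i rule: less_induct)
  case (less i)
  show ?case
  proof (cases "i < z")
    case False
    then have "g (B + (i - z) + z) = g (B + (i - z))" using less.prems by (intro per) simp_all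
    moreover have "g (B + (i - z)) = g (B + (i - z) mod z)" using False z less.prems by (intro less.IH) simp_all
    moreover have "B + (i - z) + z = B + i" "(i - z) mod z = i mod z" using False by (simp_all add: le_mod_geq)
    ultimately show ?thesis by simp
  qed simp
qed

text \<open>The two indices differ only where the residue wraps around, and there
  \<open>g (B + z) = g B\<close> helps.\<close>

lemma mod_Suc_periodic:
  assumes "g (B + z) = g B" "0 < z"
  shows "g (B + Suc r mod z) = g (Suc (B + r mod z))"
proof (cases "Suc (r mod z) = z")
  case True
  then show ?thesis using assms by (simp add: mod_Suc) (metis add_Suc_right)
next
  case False
  then show ?thesis by (simp add: mod_Suc)
qed

context prepared_automata
begin

definition a0 where "a0 = (initial \<Gamma>, initial \<Lambda>)"

lemma valid_a0: "valid a0"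
  using G.initial_lt H.initial_lt unfolding valid_def by (simp add: a0_def N_def)

lemma orbit_walk:
  assumes a: "valid a" "alive a K"
  obtains e f where "\<And>k. k < K \<Longrightarrow> e k \<in> arcs G.G" "\<And>k. k < K \<Longrightarrow> f k \<in> arcs H.G"
    "\<And>k. k < K \<Longrightarrow> orbit a k = (tail G.G (e k), tail H.G (f k))"
    "\<And>k. k < K \<Longrightarrow> orbit a (Suc k) = (head G.G (e k), head H.G (f k))"
    "\<And>k. k < K \<Longrightarrow> letter \<Gamma> (e k) = letter \<Lambda> (f k)"
proof -
  define R where "R k x \<longleftrightarrow> fst x \<in> arcs G.G \<and> snd x \<in> arcs H.G \<and> orbit a k = (tail G.G (fst x), tail H.G (snd x)) \<and>
    orbit a (Suc k) = (head G.G (fst x), head H.G (snd x)) \<and> letter \<Gamma> (fst x) = letter \<Lambda> (snd x)" for k x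
  have "\<exists>x. k < K \<longrightarrow> R k x" for k
  proof (cases "k < K")
    case True
    then have "alive a k" "succs (orbit a k) \<noteq> []" using a(2) by (auto simp: alive_def)
    then have "valid (orbit a k)" "orbit a (Suc k) \<in> set (succs (orbit a k))" using orbit_valid[OF a(1)] by simp_all
    then obtain e f where "e \<in> arcs G.G" "f \<in> arcs H.G" "tail G.G e = fst (orbit a k)" "tail H.G f = snd (orbit a k)"
      "letter \<Gamma> e = letter \<Lambda> f" "orbit a (Suc k) = (head G.G e, head H.G f)"
      unfolding succs_iff[OF \<open>valid (orbit a k)\<close>] by (elim exE conjE)
    then have "R k (e, f)" by (simp add: R_def)
    then show ?thesis by blast
  qed simp
  then obtain g where g: "\<And>k. k < K \<Longrightarrow> R k (g k)" using choice[of "\<lambda>k x. k < K \<longrightarrow> R k x"] by blast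
  show thesis by (rule that[of "\<lambda>k. fst (g k)" "\<lambda>k. snd (g k)"]) (use g in \<open>simp_all add: R_def del: orbit.simps\<close>)
qed

lemma orbit_shift: "orbit a i = orbit a j \<Longrightarrow> orbit a (i + k) = orbit a (j + k)"
  by (induction k) simp_all

text \<open>By \<open>c + 1 \<le> 2 * c\<close> the main term is at most 60 * 37 = 2220 times
  \<open>c ^ 4 * n\<close>. The other terms cost 5 more, and the fifth factor \<open>c\<close> of
  \<open>B\<close> is at least 2500.\<close>

lemma bound: "c * c * (60 * (9 * (c + 1) * (c + 1) + 1) * (G.ne + H.ne)) + 4 * (G.ne + H.ne) + 1 \<le> B"
proof -
  define n where "n = G.ne + H.ne"
  have n: "1 \<le> n" using edges unfolding n_def by linarith
  have c: "2500 \<le> c" by (simp add: c_eq)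
  have "c + 1 \<le> 2 * c" using c by simp
  then have "(c + 1) * (c + 1) \<le> (2 * c) * (2 * c)" by (intro mult_le_mono)
  moreover have "1 \<le> c * c" using c mult_le_mono[of 1 c 1 c] by simp
  ultimately have "9 * ((c + 1) * (c + 1)) + 1 \<le> 37 * (c * c)" by (simp add: algebra_simps)
  then have "60 * (9 * ((c + 1) * (c + 1)) + 1) \<le> 60 * (37 * (c * c))" by (rule mult_le_mono2)
  also have "\<dots> = 2220 * (c * c)" by simp
  finally have "60 * (9 * ((c + 1) * (c + 1)) + 1) \<le> 2220 * (c * c)" .
  then have "c * c * (60 * (9 * (c + 1) * (c + 1) + 1) * n) \<le> c * c * (2220 * (c * c) * n)"
    by (intro mult_le_mono1 mult_le_mono2) (simp only: mult.assoc)
  moreover have "4 * n + 1 \<le> 5 * (c * c * (c * c) * n)"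
  proof -
    have "1 * n \<le> c * c * (c * c) * n" using \<open>1 \<le> c * c\<close> mult_le_mono[of 1 "c * c" 1 "c * c"] by (intro mult_le_mono) simp_all
    then show ?thesis using n by linarith
  qed
  moreover have "2225 * (c * c * (c * c) * n) \<le> c * (c * c * (c * c) * n)" using c by (intro mult_le_mono) simp_all
  moreover have "c * (c * c * (c * c) * n) = B" by (simp add: B_def n_def numeral_eq_Suc)
  moreover have "c * c * (2220 * (c * c) * n) = 2220 * (c * c * (c * c) * n)" by (simp add: algebra_simps)
  ultimately show ?thesis unfolding n_def[symmetric] by linarith
qed

text \<open>The prefix of length \<open>4 * B\<close> shows both cycles completely. Joint successors
  are unique at pairs where not both components branch, so a free path that has come to the periodic
  part continues along the two cycles.\<close>

lemma long:
  assumes a: "reach a0 a" "fresh a (4 * B)"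
  shows "0 < max_gap (\<lambda>i. fst (orbit a (B + i))) (3 * B) \<and>
      0 < max_gap (\<lambda>i. snd (orbit a (B + i))) (3 * B) \<and> (\<forall>p\<in>regime_pairs a. reach a p) \<and>
      (\<forall>p. free a p \<longrightarrow> (\<exists>i<4 * B. p = orbit a i) \<or> p \<in> regime_pairs a)"
proof -
  define K where "K = 4 * B"
  have va: "valid a" using reach_valid[OF a(1) valid_a0] .
  have al: "alive a K" and fr: "\<And>i. B < i \<Longrightarrow> i \<le> K \<Longrightarrow> orbit a i \<noteq> orbit a B" using a(2) by (auto simp: fresh_def K_def)
  obtain e f where e: "\<And>k. k < K \<Longrightarrow> e k \<in> arcs G.G" and f: "\<And>k. k < K \<Longrightarrow> f k \<in> arcs H.G"
    and ob: "\<And>k. k < K \<Longrightarrow> orbit a k = (tail G.G (e k), tail H.G (f k))"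
    and obS: "\<And>k. k < K \<Longrightarrow> orbit a (Suc k) = (head G.G (e k), head H.G (f k))"
    and lab: "\<And>k. k < K \<Longrightarrow> letter \<Gamma> (e k) = letter \<Lambda> (f k)"
    using orbit_walk[OF va al] by blast
  have K: "0 < K" "3 * B \<le> K" "B \<le> K" using B_pos by (simp_all add: K_def)
  have ee: "tail G.G (e (Suc k)) = head G.G (e k)" "tail H.G (f (Suc k)) = head H.G (f k)" if "Suc k < K" for k
    using ob[OF that] obS[of k] that by simp_all
  define W where "W k = letter \<Gamma> (e k)" for k
  define x0 where "x0 = tail G.G (e 0)"
  define y0 where "y0 = tail H.G (f 0)"
  have tr: "track e (G.starts x0) W K" "track f (H.starts y0) W K"
    unfolding x0_def y0_def using K e f ee lab by (intro G.walk_track H.walk_track; simp add: W_def)+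
  have tt: "two_tracks e (G.starts x0) f (H.starts y0) W K"
  proof (rule two_tracks.intro[OF tr], unfold_locales)
    fix k i j assume h: "Suc k < K" "Suc i < K" "Suc j < K" "e i = e k" "f j = f k" "W (Suc i) = W (Suc j)"
    have "\<not> dfork (orbit a (Suc k))" using al h(1) unfolding alive_def by blast
    then consider "out_degree G.G (head G.G (e k)) \<le> 1" | "out_degree H.G (head H.G (f k)) \<le> 1"
      using obS[of k] h(1) by (fastforce simp: dfork_iff not_less)
    then show "W (Suc i) = W (Suc k)"
    proof cases
      case 1
      then have "e (Suc i) = e (Suc k)"
        by (rule G.one_out) (use e ee h in simp_all)
      then show ?thesis by (simp add: W_def)
    next
      case 2
      then have "f (Suc j) = f (Suc k)"
        by (rule H.one_out) (use f ee h in simp_all)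
      then show ?thesis using h lab by (simp add: W_def)
    qed
  qed
  interpret two_tracks e "G.starts x0" f "H.starts y0" W K by (fact tt)
  have img: "e ` {..<K} \<subseteq> {..<G.ne}" "f ` {..<K} \<subseteq> {..<H.ne}"
    using e f by (auto simp: G.arcs_eq H.arcs_eq)
  have fin: "finite (e ` {..<K})" "finite (f ` {..<K})" by simp_all
  have cards: "card (e ` {..<K}) \<le> G.ne + H.ne" "card (f ` {..<K}) \<le> G.ne + H.ne"
    using card_mono[OF _ img(1)] card_mono[OF _ img(2)] by simp_all
  have pos: "x.pos k < G.ne + H.ne" "y.pos k < G.ne + H.ne" if "k < K" for k
    using x.pos_less[OF that fin(1)] y.pos_less[OF that fin(2)] cards by linarith+
  have starts: "finite (G.starts x0)" "finite (H.starts y0)" "card (G.starts x0) \<le> c" "card (H.starts y0) \<le> c"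
    using G.card_starts[of x0] H.card_starts[of y0] by (simp_all add: G.starts_def H.starts_def c_eq)
  have inj: "inj_on (\<lambda>k. (e k, f k)) {..<B}"
  proof (rule linorder_inj_onI')
    fix j k :: nat assume jk: "j \<in> {..<B}" "k \<in> {..<B}" "j < k"
    show "(e j, f j) \<noteq> (e k, f k)"
    proof
      assume "(e j, f j) = (e k, f k)"
      then have "orbit a j = orbit a k" using ob jk K by simp
      then have "orbit a (j + (B - j)) = orbit a (k + (B - j))" by (rule orbit_shift)
      moreover have "j + (B - j) = B" "B < k + (B - j)" "k + (B - j) \<le> K" using jk by (simp_all add: K_def)
      ultimately show False using fr by metis
    qed
  qed
  obtain p where p: "0 < p" "\<And>k. B \<le> k \<Longrightarrow> k + p < K \<Longrightarrow> W (k + p) = W k"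
    and op: "once_periodic e (G.starts x0) p B K" "once_periodic f (H.starts y0) p B K"
    using long_trajectory[OF starts pos bound K(2) inj] by blast
  define X where "X i = fst (orbit a (B + i))" for i
  define Y where "Y i = snd (orbit a (B + i))" for i
  have XY: "X i = tail G.G (e (B + i))" "Y i = tail H.G (f (B + i))" if "i < 3 * B" for i
    using ob[of "B + i"] that by (simp_all add: X_def Y_def K_def)
  obtain m where m: "0 < m" "m \<le> B" "p dvd m" "\<And>k. B \<le> k \<Longrightarrow> k + m < K \<Longrightarrow> e (k + m) = e k" "max_gap X (3 * B) = m"
    using G.once_periodic_gap[of e x0 p B X, OF op(1)[unfolded K_def]] e XY unfolding K_def by blast
  obtain n where n: "0 < n" "n \<le> B" "p dvd n" "\<And>k. B \<le> k \<Longrightarrow> k + n < K \<Longrightarrow> f (k + n) = f k" "max_gap Y (3 * B) = n"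
    using H.once_periodic_gap[of f y0 p B Y, OF op(2)[unfolded K_def]] f XY unfolding K_def by blast
  have mB: "B + r mod m < K" "r mod m < 3 * B" "B + r mod n < K" "r mod n < 3 * B" "Suc (B + r mod m) < K" "Suc (B + r mod n) < K" for r
    using mod_less_divisor[OF m(1), of r] mod_less_divisor[OF n(1), of r] m(2) n(2) by (simp_all add: K_def)
  \<comment> \<open>The pair \<open>r\<close> steps after time \<open>B\<close> if both components
    go on periodically, also for \<open>r\<close> beyond the recorded prefix.\<close>
  define Z where "Z r = (X (r mod m), Y (r mod n))" for r
  have Z: "Z r = (tail G.G (e (B + r mod m)), tail H.G (f (B + r mod n)))" for r
    by (simp add: Z_def XY mB)
  have period0: "e (B + m) = e B" "f (B + n) = f B" using m n B_pos by (simp_all add: K_def)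
  have Wp: "W (B + r mod m) = W (B + r mod p)" "W (B + r mod n) = W (B + r mod p)" for r
    using periodic_mod[of B p K W "r mod m", OF p(2) p(1) mB(1)] periodic_mod[of B p K W "r mod n", OF p(2) p(1) mB(3)] m(3) n(3)
    by (simp_all add: mod_mod_cancel)
  have orbit_Z: "orbit a (B + i) = Z i" if "i < 3 * B" for i
  proof -
    have i: "B + i < K" using that by (simp add: K_def)
    show ?thesis
      using ob[OF i] periodic_mod[of B m K e i, OF m(4) m(1) i] periodic_mod[of B n K f i, OF n(4) n(1) i] by (simp add: Z)
  qed
  have Z_step: "Z (Suc r) \<in> set (succs (Z r))" if "valid (Z r)" for r
  proof -
    have "Z (Suc r) = (head G.G (e (B + r mod m)), head H.G (f (B + r mod n)))"
      unfolding Z mod_Suc_periodic[of e, OF period0(1) m(1)] mod_Suc_periodic[of f, OF period0(2) n(1)] using ee mB by simp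
    moreover have "letter \<Gamma> (e (B + r mod m)) = letter \<Lambda> (f (B + r mod n))"
      using Wp[of r] lab[OF mB(3)] by (simp add: W_def)
    ultimately show ?thesis unfolding succs_iff[OF that] using e[OF mB(1)] f[OF mB(3)]
      by (intro exI[of _ "e (B + r mod m)"] exI[of _ "f (B + r mod n)"]) (simp add: Z)
  qed
  have "alive a B" using al K(3) by (simp add: alive_def)
  have reach_Z: "reach a (Z r)" for r
  proof (induction r)
    case 0
    show ?case using reach_orbit[OF \<open>alive a B\<close>] orbit_Z[of 0] B_pos by simp
  next
    case (Suc r)
    then show ?case using Z_step[OF reach_valid[OF Suc va]] unfolding reach_def by (rule rtranclp.rtrancl_into_rtrancl)
  qed
  have gaps: "max_gap (\<lambda>i. fst (orbit a (B + i))) (3 * B) = m" "max_gap (\<lambda>i. snd (orbit a (B + i))) (3 * B) = n"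
    using m(5) n(5) by (simp_all add: X_def[abs_def] Y_def[abs_def])
  have pairs: "regime_pairs a = range Z"
  proof -
    have "regime_pairs a = {(X i, Y j) |i j. i < m \<and> j < n \<and> i mod gcd m n = j mod gcd m n}"
      by (simp add: regime_pairs_def Let_def gaps X_def Y_def)
    also have "\<dots> = range Z"
    proof (intro equalityI subsetI)
      fix q assume "q \<in> {(X i, Y j) |i j. i < m \<and> j < n \<and> i mod gcd m n = j mod gcd m n}"
      then obtain i j where ij: "q = (X i, Y j)" "i < m" "j < n" "i mod gcd m n = j mod gcd m n" by auto
      obtain r where "r mod m = i" "r mod n = j" using common_residue[OF m(1) n(1) ij(2-4)] .
      then show "q \<in> range Z" using ij(1) by (intro image_eqI[of _ _ r]) (simp_all add: Z_def)
    next
      fix q assume "q \<in> range Z"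
      then obtain r where "q = Z r" by auto
      moreover have "r mod m mod gcd m n = r mod n mod gcd m n" by (simp add: mod_mod_cancel)
      ultimately show "q \<in> {(X i, Y j) |i j. i < m \<and> j < n \<and> i mod gcd m n = j mod gcd m n}"
        using m(1) n(1) unfolding Z_def by (intro CollectI exI[of _ "r mod m"] exI[of _ "r mod n"]) simp
    qed
    finally show ?thesis .
  qed
  have "q \<in> orbit a ` {..<B} \<union> range Z" if "free a q" for q
  proof (rule free_closed[OF that])
    show "a \<in> orbit a ` {..<B} \<union> range Z" using B_pos by (intro UnI1 image_eqI[of _ _ 0]) simp_all
    fix q r assume q: "q \<in> orbit a ` {..<B} \<union> range Z" "\<not> dfork q" "r \<in> set (succs q)"
    have single: "r = r'" if "valid q" "r' \<in> set (succs q)" for r'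
    proof -
      have "length (succs q) \<le> 1" using succs_unique[OF that(1) q(2)] .
      then show ?thesis using that(2) q(3) by (cases "succs q") auto
    qed
    from q(1) consider i where "i < B" "q = orbit a i" | i where "q = Z i" by auto
    then show "r \<in> orbit a ` {..<B} \<union> range Z"
    proof cases
      case 1
      then have "alive a i" "succs (orbit a i) \<noteq> []" using al K(3) by (simp_all add: alive_def)
      then have "r = orbit a (Suc i)" using single[of "orbit a (Suc i)"] orbit_valid[OF va] 1(2) by simp
      moreover have "orbit a (Suc i) = Z 0" if "Suc i = B" using orbit_Z[of 0] B_pos that by simp
      moreover have "r \<in> orbit a ` {..<B}" if "Suc i \<noteq> B"
        using \<open>r = orbit a (Suc i)\<close> that 1(1) by (intro image_eqI[of _ _ "Suc i"]) simp_all
      ultimately show ?thesis by blast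
    next
      case 2
      then have "valid q" using reach_valid[OF reach_Z va] by simp
      then have "r = Z (Suc i)" using single Z_step 2 by blast
      then show ?thesis by simp
    qed
  qed
  moreover have "\<exists>i<4 * B. q = orbit a i" if "q \<in> orbit a ` {..<B}" for q
  proof -
    from that obtain i where "i < B" "q = orbit a i" by auto
    then show ?thesis by (intro exI[of _ i]) simp
  qed
  ultimately have "\<forall>q. free a q \<longrightarrow> (\<exists>i<4 * B. q = orbit a i) \<or> q \<in> regime_pairs a"
    unfolding pairs by blast
  moreover have "\<forall>q\<in>regime_pairs a. reach a q" unfolding pairs using reach_Z by blast
  ultimately show ?thesis using m(1) n(1) unfolding gaps by simp
qed

sublocale algorithm t N c B "length (forks d1 G.nv)" "length (forks d2 H.nv)" a0
proof unfold_locales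
  show "valid a0" by (rule valid_a0)
  show "length (succs p) \<le> 1" if "reach a0 p" "\<not> dfork p" for p
    using succs_unique[OF reach_valid[OF that(1) valid_a0] that(2)] .
qed (use long fork_degrees in \<open>simp_all add: tabs\<close>)

end

section \<open>Languages and the total running time\<close>

context automaton
begin

text \<open>Every vertex is paid for: a plain one by its outgoing edge, any other one by
  \<open>branching\<close>.\<close>

lemma nv_le: "nv \<le> branching + ne"
proof -
  have "nv = (\<Sum>v\<in>verts G. 1)" by (simp add: nv_def)
  also have "\<dots> \<le> (\<Sum>v\<in>verts G. (if plain v then 0 else out_degree G v + 1) + out_degree G v)"
    by (rule sum_mono) (simp add: plain_def)
  also have "\<dots> = branching + ne"
    by (simp add: sum.distrib sum_out_degree ne_def branching_def plain_def)
  finally show ?thesis .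
qed

lemma branching_bounds: "branching \<le> 6 * (betti1 G + card (boundary G))" "1 \<le> betti1 G + card (boundary G)"
  using branching_le initial_lt verts_eq by auto

lemma language_empty_graph: "ne = 0 \<Longrightarrow> language A = (if initial A \<in> finals A then {[]} else {})"
  using initial_lt by (auto simp: language_def accepting_path_def awalk_def arcs_eq verts_eq)

end

context prepared_automata
begin

lemma reach_walks:
  "\<lbrakk>G.awalk u es x; H.awalk v fs y; map (letter \<Gamma>) es = map (letter \<Lambda>) fs\<rbrakk> \<Longrightarrow> reach (u, v) (x, y)"
proof (induction es arbitrary: u v fs)
  case Nil
  then show ?case by (simp add: G.awalk_Nil_iff H.awalk_Nil_iff reach_def)
next
  case (Cons e es)
  from Cons.prems(3) obtain f fs' where fs: "fs = f # fs'" "letter \<Gamma> e = letter \<Lambda> f" "map (letter \<Gamma>) es = map (letter \<Lambda>) fs'"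
    by (cases fs) auto
  have e: "e \<in> arcs G.G" "u = tail G.G e" "G.awalk (head G.G e) es x" using Cons.prems(1) by (simp_all add: G.awalk_Cons_iff)
  have f: "f \<in> arcs H.G" "v = tail H.G f" "H.awalk (head H.G f) fs' y" using Cons.prems(2) by (simp_all add: H.awalk_Cons_iff fs(1))
  have "valid (u, v)"
    using G.tail_in_verts[OF e(1)] H.tail_in_verts[OF f(1)] unfolding valid_def G.verts_eq H.verts_eq by (simp add: e f N_def)
  then have "(head G.G e, head H.G f) \<in> set (succs (u, v))"
    unfolding succs_iff[OF \<open>valid (u, v)\<close>] using e f fs(2) by (intro exI[of _ e] exI[of _ f]) simp
  moreover have "reach (head G.G e, head H.G f) (x, y)" using Cons.IH[OF e(3) f(3) fs(3)] .
  ultimately show ?case unfolding reach_def by (rule converse_rtranclp_into_rtranclp)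
qed

lemma walks_reach:
  assumes "reach p q" "fst p \<in> verts G.G" "snd p \<in> verts H.G"
  shows "\<exists>es fs. G.awalk (fst p) es (fst q) \<and> H.awalk (snd p) fs (snd q) \<and> map (letter \<Gamma>) es = map (letter \<Lambda>) fs"
  using assms unfolding reach_def
proof (induction rule: converse_rtranclp_induct)
  case base
  then show ?case by (intro exI[of _ "[]"]) (simp add: G.awalk_Nil_iff H.awalk_Nil_iff)
next
  case (step p r)
  have "valid p" using step.prems by (simp add: valid_def G.verts_eq H.verts_eq) (simp add: N_def)
  then obtain e f where ef: "e \<in> arcs G.G" "f \<in> arcs H.G" "tail G.G e = fst p" "tail H.G f = snd p"
    "letter \<Gamma> e = letter \<Lambda> f" "r = (head G.G e, head H.G f)"
    using step.hyps(1) unfolding succs_iff[OF \<open>valid p\<close>] by (elim exE conjE)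
  obtain es fs where "G.awalk (fst r) es (fst q)" "H.awalk (snd r) fs (snd q)" "map (letter \<Gamma>) es = map (letter \<Lambda>) fs"
    using step.IH ef by auto
  then show ?case using ef by (intro exI[of _ "e # es"] exI[of _ "f # fs"]) (simp add: G.awalk_Cons_iff H.awalk_Cons_iff)
qed

lemma languages_meet: "language \<Gamma> \<inter> language \<Lambda> \<noteq> {} \<longleftrightarrow> (\<exists>p. reach a0 p \<and> final p)"
proof
  assume "language \<Gamma> \<inter> language \<Lambda> \<noteq> {}"
  then obtain es fs where w: "accepting_path \<Gamma> es" "accepting_path \<Lambda> fs" "map (letter \<Gamma>) es = map (letter \<Lambda>) fs"
    by (auto simp: language_def)
  then obtain x y where "x \<in> finals \<Gamma>" "G.awalk (initial \<Gamma>) es x" "y \<in> finals \<Lambda>" "H.awalk (initial \<Lambda>) fs y"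
    by (auto simp: accepting_path_def)
  then have "reach a0 (x, y)" "final (x, y)" using reach_walks w(3) by (simp_all add: a0_def final_iff)
  then show "\<exists>p. reach a0 p \<and> final p" by blast
next
  assume "\<exists>p. reach a0 p \<and> final p"
  then obtain p where p: "reach a0 p" "final p" by blast
  have "fst a0 \<in> verts G.G" "snd a0 \<in> verts H.G"
    using G.initial_lt H.initial_lt by (simp_all add: a0_def G.verts_eq H.verts_eq)
  then obtain es fs where "G.awalk (initial \<Gamma>) es (fst p)" "H.awalk (initial \<Lambda>) fs (snd p)" "map (letter \<Gamma>) es = map (letter \<Lambda>) fs"
    using walks_reach[OF p(1)] by (auto simp: a0_def)
  moreover from this have "accepting_path \<Gamma> es" "accepting_path \<Lambda> fs"
    using p(2) unfolding accepting_path_def final_iff by blast+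
  ultimately have "map (letter \<Gamma>) es \<in> language \<Gamma>" "map (letter \<Gamma>) es \<in> language \<Lambda>"
    unfolding language_def by blast+
  then show "language \<Gamma> \<inter> language \<Lambda> \<noteq> {}" by blast
qed

text \<open>At most \<open>u + 1\<close> queue entries cost O(\<open>u * B\<close>) each: while
  walking, \<open>u\<close> bounds the enumeration of successors at one pair, and in the periodic
  part it bounds the number of scans. Together this is \<open>u * u * B\<close>, hence the exponent
  9.\<close>

lemma main_time: "(c * c + 1) * (body_time + 5) + 5 \<le> 14000 * (c ^ 9 * (G.ne + H.ne))"
proof -
  define u where "u = c * c"
  have c: "1 \<le> c" by (simp add: c_eq)
  have cu: "c \<le> u" "1 \<le> u" using c mult_le_mono[of 1 c c c] by (simp_all add: u_def)
  have b: "1 \<le> B" using B_pos by simp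
  have ub: "1 \<le> u * B" "B \<le> u * B" "c \<le> u * B" "u \<le> u * B"
    using mult_le_mono[OF cu(2) b] mult_le_mono[OF cu(2) order.refl[of B]] mult_le_mono[OF order.refl[of u] b] mult_le_mono[OF cu(1) b]
    by simp_all
  have uB: "u \<le> B"
  proof -
    have n: "1 \<le> G.ne + H.ne" using edges by linarith
    have "u * (1 * 1 * 1 * 1) \<le> u * (c * c * c * (G.ne + H.ne))"
      by (intro mult_le_mono order.refl c n)
    also have "\<dots> = B" by (simp add: B_def u_def numeral_eq_Suc algebra_simps)
    finally show ?thesis by simp
  qed
  have "step_time = 80 * u + 40 * c + 300" by (simp add: step_time_def u_def algebra_simps)
  then have step: "step_time \<le> 420 * u" using cu by linarith
  have scan: "scan_time \<le> 780 * B" using b by (simp add: scan_time_def)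
  have "scan_time + step_time + 100 \<le> 1300 * B" using step scan uB b by linarith
  then have "u * (scan_time + step_time + 100) \<le> u * (1300 * B)" by (rule mult_le_mono2)
  moreover have "u * (1300 * B) = 1300 * (u * B)" by simp
  moreover have "regime_time = u * (scan_time + step_time + 100) + 100 * c + 2000 * B + scan_time + 500"
    by (simp add: regime_time_def u_def algebra_simps)
  ultimately have regime: "regime_time \<le> 4680 * (u * B)" using scan ub by linarith
  have "4 * B * (step_time + 4) \<le> 4 * B * (424 * u)" using step cu by (intro mult_le_mono2) linarith
  moreover have "4 * B * (424 * u) = 1696 * (u * B)" by simp
  ultimately have body: "body_time + 5 \<le> 6500 * (u * B)" using regime ub unfolding body_time_def by linarith
  have "(u + 1) * (body_time + 5) \<le> (2 * u) * (6500 * (u * B))" using body cu by (intro mult_le_mono) simp_all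
  also have "\<dots> = 13000 * (u * (u * B))" by simp
  finally have "(u + 1) * (body_time + 5) \<le> 13000 * (u * (u * B))" .
  moreover have "1 \<le> u * (u * B)" using mult_le_mono[OF cu(2) ub(1)] by simp
  moreover have "u * (u * B) = c ^ 9 * (G.ne + H.ne)" by (simp add: B_def u_def numeral_eq_Suc algebra_simps)
  ultimately show ?thesis unfolding u_def[symmetric] by linarith
qed

lemma loop_phase:
  "exec (Seq main_loop (Assign 0 (Var 61))) t (14000 * (c ^ 9 * (G.ne + H.ne)) + 10)
    (\<lambda>t. t 0 0 = (if language \<Gamma> \<inter> language \<Lambda> \<noteq> {} then 1 else 0))"
proof (rule exec_le)
  show "exec (Seq main_loop (Assign 0 (Var 61))) t ((c * c + 1) * (body_time + 5) + 5 + 10)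
    (\<lambda>t. t 0 0 = (if language \<Gamma> \<inter> language \<Lambda> \<noteq> {} then 1 else 0))"
    unfolding languages_meet
  proof (rule exec_Seq[OF main_spec])
    show "agree t" by (simp add: agree_def)
    show "(t 41 0, t 42 0) = a0" using t by (simp add: prepared_def a0_def inp_0)
    fix u :: memory assume "u 61 0 = (if \<exists>p. reach a0 p \<and> final p then 1 else 0)"
    then show "exec (Assign 0 (Var 61)) u 10 (\<lambda>t. t 0 0 = (if \<exists>p. reach a0 p \<and> final p then 1 else 0))"
      by (intro exec_loop_free) simp_all
  qed (use t in \<open>simp_all add: prepared_def\<close>)
qed (use main_time in simp)

end

context automata
begin

lemma prep_time:
  assumes edges: "0 < G.ne + H.ne"
  shows "N * 200 + c * 150 + 400 \<le> 1200 * (c ^ 9 * (G.ne + H.ne))"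
proof -
  define n where "n = G.ne + H.ne"
  have n: "1 \<le> n" using edges unfolding n_def by linarith
  have c: "1 \<le> c" by (simp add: c_eq)
  have "N \<le> c + 2 * n" using G.nv_le H.nv_le unfolding N_def c_eq n_def distrib_left by linarith
  moreover have "c * 1 \<le> c ^ 9 * n"
    using self_le_power[OF c, of 9] n by (intro mult_le_mono) simp_all
  moreover have "1 * n \<le> c ^ 9 * n" using one_le_power[OF c, of 9] by (rule mult_le_mono1)
  ultimately show ?thesis using c n unfolding n_def[symmetric] mult_1 mult_1_right by linarith
qed

lemma solve_spec:
  "exec solve_prog inp (15400 * (c ^ 9 * (G.ne + H.ne)) + 100)
    (\<lambda>t. t 0 0 = (if language \<Gamma> \<inter> language \<Lambda> \<noteq> {} then 1 else 0))"
proof -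
  let ?n = "G.ne + H.ne"
  let ?Q = "\<lambda>t. t 0 0 = (if language \<Gamma> \<inter> language \<Lambda> \<noteq> {} then 1 else 0 :: nat)"
  have "exec solve_prog inp (expr_steps (Const 0) + expr_steps (Plus (Var 1) (Var 8)) + 1 +
      max (15300 * (c ^ 9 * ?n) + 10) 50) ?Q"
    unfolding solve_prog_def
  proof (rule exec_IfLess)
    assume "expr_val (Const 0) inp < expr_val (Plus (Var 1) (Var 8)) inp"
    then have pos: "0 < ?n" by (simp add: inp_0)
    have "exec (Seq prep_prog (Seq main_loop (Assign 0 (Var 61)))) inp
      (N * 200 + c * 150 + 400 + (14000 * (c ^ 9 * ?n) + 10)) ?Q"
    proof (rule exec_Seq[OF prep_spec])
      fix t assume t: "prepared t"
      interpret prepared_automata Sig \<Gamma> \<Lambda> t using t pos by unfold_locales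
      show "exec (Seq main_loop (Assign 0 (Var 61))) t (14000 * (c ^ 9 * ?n) + 10) ?Q" by (rule loop_phase)
    qed
    moreover have "N * 200 + c * 150 + 400 \<le> 1200 * (c ^ 9 * ?n)"
      by (rule prep_time[OF pos])
    ultimately show "exec (Seq prep_prog (Seq main_loop (Assign 0 (Var 61)))) inp (15300 * (c ^ 9 * ?n) + 10) ?Q"
      by (elim exec_le) linarith
  next
    assume "\<not> expr_val (Const 0) inp < expr_val (Plus (Var 1) (Var 8)) inp"
    then have "G.ne = 0" "H.ne = 0" by (simp_all add: inp_0)
    then have "language \<Gamma> \<inter> language \<Lambda> \<noteq> {} \<longleftrightarrow> initial \<Gamma> \<in> finals \<Gamma> \<and> initial \<Lambda> \<in> finals \<Lambda>"
      by (auto simp: G.language_empty_graph H.language_empty_graph)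
    then show "exec (IfLess (Const 0) (Read 3 (Var 2)) (IfLess (Const 0) (Read 10 (Var 9)) (Assign 0 (Const 1)) (Assign 0 (Const 0)))
      (Assign 0 (Const 0))) inp 50 ?Q"
      by (intro exec_loop_free) (auto simp: inp_0)
  qed
  then show ?thesis by (rule exec_le) simp
qed

end

theorem theorem7p5:
  shows "\<exists>q::nat. q > 0 \<and> (\<exists>(P::program) (C::nat).
    \<forall>(\<Sigma>::nat set) (\<Gamma>::(nat, nat, nat) fsa) (\<Lambda>::(nat, nat, nat) fsa).
      finite \<Sigma> \<longrightarrow>
      deterministic_fsa \<Sigma> \<Gamma> \<longrightarrow> deterministic_fsa \<Sigma> \<Lambda> \<longrightarrow>
      numbered \<Gamma> \<longrightarrow> numbered \<Lambda> \<longrightarrow>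
      (let m = (betti1 (graph_of \<Gamma>) + card (boundary (graph_of \<Gamma>)))
             + (betti1 (graph_of \<Lambda>) + card (boundary (graph_of \<Lambda>)));
           n = card (arcs (graph_of \<Gamma>)) + card (arcs (graph_of \<Lambda>))
       in answers_within P (input_memory \<Gamma> \<Lambda>) (language \<Gamma> \<inter> language \<Lambda> \<noteq> {})
            (C * (m ^ q * n + 1))))"
proof (rule exI[of _ "9::nat"], rule conjI[OF zero_less_numeral], rule exI[of _ solve_prog],
    rule exI[of _ "15400 * 2506 ^ 9 :: nat"], intro allI impI)
  fix \<Sigma> :: "nat set" and \<Gamma> \<Lambda> :: "(nat, nat, nat) fsa"
  assume "deterministic_fsa \<Sigma> \<Gamma>" "deterministic_fsa \<Sigma> \<Lambda>" "numbered \<Gamma>" "numbered \<Lambda>"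
  then interpret automata \<Sigma> \<Gamma> \<Lambda> by unfold_locales
  define m where "m = (betti1 G.G + card (boundary G.G)) + (betti1 H.G + card (boundary H.G))"
  \<comment> \<open>2506 = 2500 + 6: the 2500 is absorbed because \<open>m\<close> is at least 1,
    and each branching number is at most 6 times its share of \<open>m\<close>.\<close>
  define k :: nat where "k = 2506"
  have "c \<le> k * m" using G.branching_bounds H.branching_bounds unfolding c_eq m_def k_def distrib_left by linarith
  then have "c ^ 9 * (G.ne + H.ne) \<le> (k * m) ^ 9 * (G.ne + H.ne)" by (intro mult_le_mono1 power_mono) simp_all
  then have le: "c ^ 9 * (G.ne + H.ne) \<le> k ^ 9 * (m ^ 9 * (G.ne + H.ne))" by (simp only: power_mult_distrib mult.assoc)
  have "1 \<le> k ^ 9" by (simp add: k_def)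
  with le have time: "15400 * (c ^ 9 * (G.ne + H.ne)) + 100 \<le> 15400 * k ^ 9 * (m ^ 9 * (G.ne + H.ne) + 1)"
    unfolding distrib_left mult_1_right mult.assoc by linarith
  have "answers_within solve_prog inp (language \<Gamma> \<inter> language \<Lambda> \<noteq> {}) (15400 * k ^ 9 * (m ^ 9 * (G.ne + H.ne) + 1))"
    using exec_le[OF solve_spec time] unfolding exec_def answers_within_def .
  then show "let m = (betti1 (graph_of \<Gamma>) + card (boundary (graph_of \<Gamma>)))
             + (betti1 (graph_of \<Lambda>) + card (boundary (graph_of \<Lambda>)));
           n = card (arcs (graph_of \<Gamma>)) + card (arcs (graph_of \<Lambda>))
       in answers_within solve_prog (input_memory \<Gamma> \<Lambda>) (language \<Gamma> \<inter> language \<Lambda> \<noteq> {})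
            (15400 * 2506 ^ 9 * (m ^ 9 * n + 1))"
    unfolding Let_def m_def k_def G.ne_def H.ne_def .
qed

end
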